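(* Let $\frac13<\alpha\le\frac23$. For $0<\delta<1$ define $W=\delta^{3\alpha-2}$ (so $\delta\le W^{-1}\le1$). Let $\mathbb{S}$ be a collection of Vinogradov $(\delta,1,1)$-plates, and for $I\in\mathbb{I}_\delta$ let $\mathbb{S}_I$ be the plates in $\mathbb{S}$ associated with $I$. Assume: (1) (broad structure) there are collections of intervals $\mathbb{I}_1'\subset\mathbb{I}_\delta([0,1/6])$, $\mathbb{I}_2'\subset\mathbb{I}_\delta([1/3,1/2])$, $\mathbb{I}_3'\subset\mathbb{I}_\delta([2/3,1])$ with $|\mathbb{I}_i'|\sim M^{(i)}$, and each plate in $\mathbb{S}$ is associated with some interval in $\mathbb{I}'=\mathbb{I}_1'\cup\mathbb{I}_2'\cup\mathbb{I}_3'$. Let $\mathbb{S}_1,\mathbb{S}_2,\mathbb{S}_3$ be the collections of plates associated with intervals in $\mathbb{I}_1',\mathbb{I}_2',\mathbb{I}_3'$, respectively. (2) (periodicity) for each $I\in\mathbb{I}'$, the plates in $\mathbb{S}_I$ are periodic in the $x$ direction with period $W^{-1}$. (3) (uniformity) for each $i\in\{1,2,3\}$ and each $I\in\mathbb{I}_i'$, when $[0,1]^3$ is tiled with fat $(W^{-1},1,1)$-plates $\Sigma$ with direction $\mathbf{t}(I)$, each $\Sigma$ contains $\sim N^{(i)}$ plates $S\in\mathbb{S}_I$. (Thus $|\mathbb{S}_I|\sim N^{(i)}W$ and $|\mathbb{S}_i|\sim N^{(i)}M^{(i)}W$.) For $1\le r_i\le M^{(i)}$, let $\mathcal{Q}_{r_1,r_2,r_3}(\mathbb{S}_1,\mathbb{S}_2,\mathbb{S}_3)$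 be the collection of trilinear $(r_1,r_2,r_3)$-rich $\delta$-cubes determined by $\mathbb{S}_1,\mathbb{S}_2,\mathbb{S}_3$. Put $M=(M^{(1)}M^{(2)}M^{(3)})^{1/3}$, $N=(N^{(1)}N^{(2)}N^{(3)})^{1/3}$, $r=(r_1r_2r_3)^{1/3}$. Then for each $\epsilon>0$, $$|\mathcal{Q}_{r_1,r_2,r_3}(\mathbb{S}_1,\mathbb{S}_2,\mathbb{S}_3)|\le C\,\delta^{-\epsilon}\Big(\frac{NM}{r^2\delta}\Big)^{\frac{4-6\alpha}{3\alpha-1}}\Big(\frac{NM}{r}\Big)^3W,$$ where $C$ depends only on $\epsilon$, $\alpha$ and the implicit constants in $\sim$.
   Context: For $J\subset[0,1]$ an interval, $\mathbb{I}_\delta(J)$ is the partition of $J$ into intervals of length $\delta$, and $\mathbb{I}_\delta=\mathbb{I}_\delta([0,1])$. $\mathbf{t}(t)$ is the unit tangent vector to the moment curve $(t,t^2,t^3)$ at parameter $t$; $\mathbf{t}(I)$ denotes $\mathbf{t}(t)$ for an arbitrary $t\in I$ (an angular uncertainty $O(\delta)$ for $I\in\mathbb{I}_\delta$ is harmless). Boxes are parallelepipeds in $\mathbb{R}^3$ with one face parallel to the $xy$ plane and one edge of that face parallel to the $x$ axis. Dimensions $(d_1,d_2,d_3)$ mean: $d_1$ is the length of the edge parallel to the $x$ axis, $d_2$ the length of the other edge parallel to the $xy$ plane, $d_3$ the length of the remaining edge. Boxes are almost rectangular, i.e. comparable up to $O(1)$ dilation to a genuine rectangular box with comparable dimensions;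 two boxes $B_1,B_2$ with $C^{-1}B_1\subset B_2\subset CB_1$, $C=O(1)$, are not distinguished. A plate is a box whose two longest edges have comparable length; its direction is the normal to the face with the two long edges. A Vinogradov $(\delta,1,1)$-plate associated with $I\in\mathbb{I}_\delta$ is a $(\delta,1,1)$-plate inside $[0,1]^3$ with normal vector $\mathbf{t}(I)$. The $\delta$-cubes are the (pairwise disjoint) cubes of side length $\delta$ tiling $[0,1]^3$. A $\delta$-cube $q$ is trilinear $(r_1,r_2,r_3)$-rich with respect to $\mathbb{S}_1,\mathbb{S}_2,\mathbb{S}_3$ if, for each $i$, $q$ is a subset of at least $r_i$ plates from $\mathbb{S}_i$ (the distinction between "is a subset of" and "intersects" is ignored). $A\sim B$ means comparable up to fixed multiplicative constants. *)

theory Defs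
  imports "HOL-Analysis.Analysis"
begin

text \<open>
  The parameter \<open>K\<close> below is the constant hidden in \<open>\<sim>\<close>, in \<open>O(1)\<close>, and in the identification of
  boxes that agree up to \<open>O(1)\<close> dilation; it is an arbitrary fixed number \<open>\<ge> 1\<close>.
\<close>

definition sim :: "real \<Rightarrow> real \<Rightarrow> real \<Rightarrow> bool" where
  "sim K a b \<longleftrightarrow> a \<le> K * b \<and> b \<le> K * a"

definition moment_curve :: "real \<Rightarrow> real^3" where
  "moment_curve t = vector [t, t^2, t^3]"

definition unit_tangent :: "real \<Rightarrow> real^3" where
  "unit_tangent t = sgn (vector_derivative moment_curve (at t))"

text \<open>
  Intervals are closed, so neighbours share an end point. If \<open>\<delta>\<close> does not divide \<open>b - a\<close>, the last
  one is truncated at \<open>b\<close>.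
\<close>

definition intervals :: "real \<Rightarrow> real \<Rightarrow> real \<Rightarrow> real set set" where
  "intervals \<delta> a b =
     {{a + real k * \<delta> .. min (a + (real k + 1) * \<delta>) b} | k::nat. a + real k * \<delta> < b}"

abbreviation unit_cube :: "(real^3) set" where
  "unit_cube \<equiv> cbox 0 1"


section \<open>Boxes\<close>

text \<open>
  A parallelepiped is given by its centre and its three edge vectors, so that it can be dilated
  about its centre. In a box, \<open>edge1\<close> is the edge parallel to the x axis, \<open>edge2\<close> the other edge of
  the face parallel to the xy plane, and \<open>edge3\<close> the remaining one.
\<close>

record parallelepiped =
  centre :: "real^3"
  edge1 :: "real^3"
  edge2 :: "real^3"
  edge3 :: "real^3"

definition points :: "parallelepiped \<Rightarrow> (real^3) set" where
  "points B = {centre B + a *\<^sub>R edge1 B + b *\<^sub>R edge2 B + c *\<^sub>R edge3 B | a b c.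
     \<bar>a\<bar> \<le> 1/2 \<and> \<bar>b\<bar> \<le> 1/2 \<and> \<bar>c\<bar> \<le> 1/2}"

definition dilate :: "real \<Rightarrow> parallelepiped \<Rightarrow> parallelepiped" where
  "dilate C B = \<lparr>centre = centre B,
     edge1 = C *\<^sub>R edge1 B, edge2 = C *\<^sub>R edge2 B, edge3 = C *\<^sub>R edge3 B\<rparr>"

definition shift_x :: "real \<Rightarrow> parallelepiped \<Rightarrow> parallelepiped" where
  "shift_x h B = B\<lparr>centre := centre B + h *\<^sub>R axis 1 1\<rparr>"

definition comparable :: "real \<Rightarrow> parallelepiped \<Rightarrow> parallelepiped \<Rightarrow> bool" where
  "comparable C B B' \<longleftrightarrow>
     points (dilate (1/C) B) \<subseteq> points B' \<and> points B' \<subseteq> points (dilate C B)"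

text \<open>Containment of a set in a box, up to dilation of the box.\<close>

definition contained :: "real \<Rightarrow> (real^3) set \<Rightarrow> parallelepiped \<Rightarrow> bool" where
  "contained K A B \<longleftrightarrow> A \<subseteq> points (dilate K B)"

definition has_dims :: "real \<Rightarrow> real \<Rightarrow> real \<Rightarrow> real \<Rightarrow> parallelepiped \<Rightarrow> bool" where
  "has_dims K d1 d2 d3 B \<longleftrightarrow>
     sim K (norm (edge1 B)) d1 \<and> sim K (norm (edge2 B)) d2 \<and> sim K (norm (edge3 B)) d3"

definition rectangular :: "parallelepiped \<Rightarrow> bool" where
  "rectangular B \<longleftrightarrow> orthogonal (edge1 B) (edge2 B) \<and>
     orthogonal (edge1 B) (edge3 B) \<and> orthogonal (edge2 B) (edge3 B)"

definition is_box :: "real \<Rightarrow> real \<Rightarrow> real \<Rightarrow> real \<Rightarrow> parallelepiped \<Rightarrow> bool" where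
  "is_box K d1 d2 d3 B \<longleftrightarrow>
     edge1 B $ 2 = 0 \<and> edge1 B $ 3 = 0 \<and> edge2 B $ 3 = 0 \<and>
     has_dims K d1 d2 d3 B \<and>
     (\<exists>R. rectangular R \<and> has_dims K d1 d2 d3 R \<and> comparable K B R)"


section \<open>Plates\<close>

text \<open>For \<open>w \<le> 1\<close>: a \<open>(w, 1, 1)\<close>-plate with direction \<open>n\<close>. The long edges are \<open>edge2\<close> and \<open>edge3\<close>.\<close>

definition plate :: "real \<Rightarrow> real \<Rightarrow> real^3 \<Rightarrow> parallelepiped \<Rightarrow> bool" where
  "plate K w n B \<longleftrightarrow> is_box K w 1 1 B \<and> orthogonal n (edge2 B) \<and> orthogonal n (edge3 B)"

text \<open>
  The Vinogradov plates associated with \<open>I\<close> are those with \<open>w = \<delta>\<close>. Slanted plates with edges of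
  length about 1 cannot be fitted into the corners of the unit cube, so lying in the unit cube is
  taken up to \<open>O(1)\<close> dilation: a plate has to meet the cube, and then it lies in the dilate of the
  cube by a factor \<open>O(K)\<close>.
\<close>

definition moment_plate :: "real \<Rightarrow> real \<Rightarrow> real set \<Rightarrow> parallelepiped \<Rightarrow> bool" where
  "moment_plate K w I B \<longleftrightarrow>
     (\<exists>t\<in>I. plate K w (unit_tangent t) B) \<and> points B \<inter> unit_cube \<noteq> {}"

definition associated ::
    "real \<Rightarrow> real \<Rightarrow> parallelepiped set \<Rightarrow> real set \<Rightarrow> parallelepiped set" where
  "associated K \<delta> S I = {P \<in> S. moment_plate K \<delta> I P}"

text \<open>
  Comparable boxes are not distinguished, so the members of a collection of boxes are distinct
  modulo comparability. Without this a plate could be repeated arbitrarily often.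
\<close>

definition essentially_distinct :: "real \<Rightarrow> parallelepiped set \<Rightarrow> bool" where
  "essentially_distinct D S \<longleftrightarrow> (\<forall>P\<in>S. \<forall>P'\<in>S. P \<noteq> P' \<longrightarrow> \<not> comparable D P P')"

text \<open>Periodicity inside the unit cube, again modulo comparability of boxes.\<close>

definition periodic_x :: "real \<Rightarrow> real \<Rightarrow> parallelepiped set \<Rightarrow> bool" where
  "periodic_x K w S \<longleftrightarrow>
     (\<forall>P\<in>S. \<forall>k::int. points (shift_x (of_int k * w) P) \<inter> unit_cube \<noteq> {} \<longrightarrow>
        (\<exists>P'\<in>S. comparable K (shift_x (of_int k * w) P) P'))"

definition plate_tiling :: "real \<Rightarrow> real \<Rightarrow> real set \<Rightarrow> parallelepiped set \<Rightarrow> bool" where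
  "plate_tiling K w I T \<longleftrightarrow>
     (\<forall>\<Sigma>\<in>T. moment_plate K w I \<Sigma>) \<and>
     (\<forall>\<Sigma>\<in>T. \<forall>\<Sigma>'\<in>T. \<Sigma> \<noteq> \<Sigma>' \<longrightarrow> interior (points \<Sigma>) \<inter> interior (points \<Sigma>') = {}) \<and>
     unit_cube \<subseteq> (\<Union>\<Sigma>\<in>T. points \<Sigma>)"

text \<open>
  The first condition after the tiling says that no plate is missed by the tiles, as is needed for
  \<open>S\<close> to have about \<open>N / w\<close> elements.
\<close>

definition uniform_plates :: "real \<Rightarrow> real \<Rightarrow> real set \<Rightarrow> real \<Rightarrow> parallelepiped set \<Rightarrow> bool" where
  "uniform_plates K w I N S \<longleftrightarrow>
     (\<exists>T. plate_tiling K w I T \<and>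
        (\<forall>P\<in>S. \<exists>\<Sigma>\<in>T. contained K (points P) \<Sigma>) \<and>
        (\<forall>\<Sigma>\<in>T. sim K (real (card {P \<in> S. contained K (points P) \<Sigma>})) N))"


section \<open>Rich cubes\<close>

text \<open>If \<open>1/\<delta>\<close> is not an integer, the outermost cubes stick out of the unit cube.\<close>

definition delta_cubes :: "real \<Rightarrow> (real^3) set set" where
  "delta_cubes \<delta> =
     {{p. \<forall>j. real (k j) * \<delta> \<le> p $ j \<and> p $ j < (real (k j) + 1) * \<delta>} | k :: 3 \<Rightarrow> nat.
        \<forall>j. real (k j) * \<delta> < 1}"

text \<open>
  Since \<open>contained\<close> allows dilation of the plates, this covers both readings of richness (the cube is
  a subset of the plate, or intersects it).
\<close>

definition rich_cubes ::
    "real \<Rightarrow> real \<Rightarrow> (nat \<Rightarrow> parallelepiped set) \<Rightarrow> (nat \<Rightarrow> real) \<Rightarrow> (real^3) set set" where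
  "rich_cubes K \<delta> S r =
     {q \<in> delta_cubes \<delta>. \<forall>i\<in>{1..3}. r i \<le> real (card {P \<in> S i. contained K q P})}"

definition geom_mean3 :: "(nat \<Rightarrow> real) \<Rightarrow> real" where
  "geom_mean3 a = (a 1 * a 2 * a 3) powr (1/3)"

end

theory Submission
  imports Defs
begin

text \<open>
  Write \<open>m\<^sub>i = N\<^sub>i M\<^sub>i / r\<^sub>i\<close>. Up to \<open>O(\<delta>)\<close>, a plate with direction \<open>\<^bold>t(t)\<close> is the set where the
  linear form \<open>x + 2 t y + 3 t\<^sup>2 z\<close> takes a prescribed value, so the problem is one about points
  (corners of rich cubes), parameters \<open>t\<close> (left end points of intervals) and values. Three
  plates from the three families meet in \<open>O(1)\<close> cubes, since their parameters are separated
  (\<open>transversal\<close>). For the set \<open>Q\<close> of rich cubes, counting triples of plates gives at once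
  \<open>card Q \<lesssim> W\<^sup>3 m\<^sub>1 m\<^sub>2 m\<^sub>3\<close> (\<open>trilinear_bound\<close>), whereas the claim is
  \<open>card Q \<lesssim> A powr p * W m\<^sub>1 m\<^sub>2 m\<^sub>3\<close> with \<open>A = N M / (r\<^sup>2 \<delta>)\<close> and \<open>p = (4 - 6 \<alpha>) / (3 \<alpha> - 1)\<close>.

  When \<open>A\<close> is too small to pay for \<open>W\<^sup>2\<close>, powers of \<open>W\<close> are saved by a second moment argument (\<open>second_moment\<close>). Because the plates are periodic,
  the incidences of one family live on only \<open>O(N\<^sub>i M\<^sub>i)\<close> classes of plates modulo shifts by \<open>1/W\<close>.
  Cauchy-Schwarz thus produces many pairs of points that are congruent modulo such shifts for
  many parameters. Pairs that are close in \<open>y\<close> and \<open>z\<close> are controlled by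
  counting with the other two families: each point has \<open>O(W m\<^sub>j m\<^sub>k)\<close> close partners on a given class
  (\<open>close_pairs\<close>). For a pair that is not close, the difference of the form is a quadratic
  polynomial in \<open>t\<close>, and it is within \<open>O(\<delta>)\<close> of a multiple of \<open>1/W\<close> for few parameters:
  \<open>O(W)\<close> of them if the polynomial has no critical point nearby, and \<open>O(sqrt (W / \<delta>))\<close> of them always.
  Hence, with \<open>A\<^sub>i = N\<^sub>i M\<^sub>i / (r\<^sub>i\<^sup>2 \<delta>)\<close>, there are three regimes.

    \<^item> If some \<open>A\<^sub>i\<close> is small compared with \<open>(\<delta> W) powr (-1/2)\<close>, the distant pairs are negligible and
      \<open>card Q \<lesssim> W m\<^sub>1 m\<^sub>2 m\<^sub>3\<close> (\<open>bound_very_rich\<close>).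
    \<^item> If some \<open>A\<^sub>i\<close> is small compared with \<open>1 / (\<delta> W)\<close>, the same works inside each of the \<open>W\<close> slices of
      height \<open>1/W\<close> in \<open>z\<close>, where distant pairs have no critical point, and
      \<open>card Q \<lesssim> W\<^sup>2 m\<^sub>1 m\<^sub>2 m\<^sub>3\<close> (\<open>bound_rich\<close>).
    \<^item> Otherwise the trilinear bound is used.

  The exponent \<open>p\<close> satisfies \<open>(\<delta> W) powr (-p) = W\<^sup>2\<close>. In the second regime,
  outside of the first, \<open>A \<ge> c (\<delta> W) powr (-1/2)\<close>, so \<open>A powr p\<close> pays for the extra factor \<open>W\<close>; in the
  third, \<open>A \<ge> c / (\<delta> W)\<close> pays for \<open>W\<^sup>2\<close>; in the first, \<open>A \<ge> c\<close> is enough (\<open>card_X_le\<close>).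

  The geometric part shows that collections of plates satisfy the axioms of the locale
  \<open>plate_incidences\<close>. Boundedly many pairwise different plates can have almost the same parameters:
  plates whose normalised parameters agree closely enough contain each other up to a dilation
  (\<open>subset_of_nearby_plate\<close>), so the pigeonhole principle bounds both the essentially distinct plates
  through a cube and the tiles near a fat plate.
\<close>

section \<open>Counting\<close>

lemma card_grid_le:
  fixes A :: "real set"
  assumes "0 < \<delta>" "0 \<le> L" and grid: "\<And>x. x \<in> A \<Longrightarrow> \<exists>n::int. x = a + of_int n * \<delta>"
    and close: "\<And>x y. x \<in> A \<Longrightarrow> y \<in> A \<Longrightarrow> \<bar>x - y\<bar> \<le> L"
  shows "finite A" and "real (card A) \<le> L / \<delta> + 1"
proof -
  have "finite A \<and> real (card A) \<le> L / \<delta> + 1"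
  proof (cases "A = {}")
    case True
    then show ?thesis using assms by simp
  next
    case False
    then obtain x0 where x0: "x0 \<in> A" by auto
    define f where "f x = \<lfloor>(x - a) / \<delta>\<rfloor>" for x
    have fx: "x = a + of_int (f x) * \<delta>" if "x \<in> A" for x
      using grid[OF that] assms(1) unfolding f_def by auto
    have inj: "inj_on f A" by (metis fx inj_onI)
    have bd: "\<bar>f x - f y\<bar> \<le> \<lfloor>L / \<delta>\<rfloor>" if "x \<in> A" "y \<in> A" for x y
    proof -
      have "(of_int (f x) - of_int (f y)) * \<delta> = x - y"
        using fx[OF that(1)] fx[OF that(2)] by (simp add: algebra_simps)
      then have "\<bar>of_int (f x) - of_int (f y)\<bar> * \<delta> \<le> L"
        using close[OF that] assms(1) by (metis abs_mult abs_of_pos)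
      then have "real_of_int \<bar>f x - f y\<bar> \<le> L / \<delta>"
        using assms(1) by (simp add: pos_le_divide_eq)
      then show ?thesis by (simp add: le_floor_iff)
    qed
    have "f ` A \<subseteq> {f x0 - \<lfloor>L / \<delta>\<rfloor> .. f x0 + \<lfloor>L / \<delta>\<rfloor>}"
      using bd[OF _ x0] by (force simp: abs_le_iff)
    then have fin: "finite (f ` A)" using finite_subset by blast
    then have finA: "finite A" using inj finite_imageD by blast
    define m where "m = Min (f ` A)"
    have mA: "m \<in> f ` A" unfolding m_def using fin False by (intro Min_in) auto
    have "f ` A \<subseteq> {m .. m + \<lfloor>L / \<delta>\<rfloor>}"
    proof
      fix k assume k: "k \<in> f ` A"
      have "m \<le> k" unfolding m_def using fin k by simp
      moreover have "\<bar>k - m\<bar> \<le> \<lfloor>L / \<delta>\<rfloor>" using bd k mA by blast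
      ultimately show "k \<in> {m .. m + \<lfloor>L / \<delta>\<rfloor>}" by auto
    qed
    then have "card (f ` A) \<le> card {m .. m + \<lfloor>L / \<delta>\<rfloor>}" by (intro card_mono) auto
    then have "card A \<le> nat (\<lfloor>L / \<delta>\<rfloor> + 1)" using card_image[OF inj] by simp
    moreover have "0 \<le> \<lfloor>L / \<delta>\<rfloor>" using bd[OF x0 x0] by simp
    ultimately have "int (card A) \<le> \<lfloor>L / \<delta>\<rfloor> + 1" by linarith
    then have "real (card A) \<le> real_of_int (\<lfloor>L / \<delta>\<rfloor> + 1)" by (metis of_int_le_iff of_int_of_nat_eq)
    moreover have "real_of_int (\<lfloor>L / \<delta>\<rfloor> + 1) \<le> L / \<delta> + 1" by simp
    ultimately show ?thesis using finA by (meson order.trans)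
  qed
  then show "finite A" "real (card A) \<le> L / \<delta> + 1" by auto
qed

lemma card_le_card_image_times_fibres:
  fixes b :: real
  assumes "finite A" and "\<And>y. y \<in> f ` A \<Longrightarrow> real (card {x \<in> A. f x = y}) \<le> b"
  shows "real (card A) \<le> real (card (f ` A)) * b"
proof -
  have "card A = (\<Sum>y\<in>f ` A. card {x \<in> A. f x = y})"
    using sum.image_gen[OF assms(1), of "\<lambda>_. 1::nat" f] by simp
  then have "real (card A) = (\<Sum>y\<in>f ` A. real (card {x \<in> A. f x = y}))" by simp
  also have "\<dots> \<le> (\<Sum>y\<in>f ` A. b)" by (intro sum_mono assms)
  finally show ?thesis by simp
qed

lemma real_card_UN_le:
  fixes b :: real
  assumes "finite I" and "\<And>i. i \<in> I \<Longrightarrow> real (card (F i)) \<le> b"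
  shows "real (card (\<Union>i\<in>I. F i)) \<le> real (card I) * b"
proof -
  have "real (card (\<Union>i\<in>I. F i)) \<le> (\<Sum>i\<in>I. real (card (F i)))"
    using card_UN_le[OF assms(1), of F] by (metis of_nat_mono of_nat_sum)
  also have "\<dots> \<le> (\<Sum>i\<in>I. b)" by (intro sum_mono assms)
  finally show ?thesis by simp
qed

lemma real_card_Sigma_le:
  fixes b :: real
  assumes "finite I" and "\<And>i. i \<in> I \<Longrightarrow> finite (F i)" and "\<And>i. i \<in> I \<Longrightarrow> real (card (F i)) \<le> b"
  shows "real (card (Sigma I F)) \<le> real (card I) * b"
proof -
  have "real (card (Sigma I F)) = (\<Sum>i\<in>I. real (card (F i)))"
    using assms by (subst card_SigmaI) auto
  also have "\<dots> \<le> (\<Sum>i\<in>I. b)" by (intro sum_mono assms)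
  finally show ?thesis by simp
qed

text \<open>Double counting of the quadruples \<open>(p, e1, e2, e3)\<close> with \<open>e\<^sub>i \<in> a\<^sub>i p\<close>.\<close>
lemma trilinear_card_le:
  fixes r1 r2 r3 b :: real
  assumes fin: "finite X" "finite E1" "finite E2" "finite E3"
    and sub: "\<And>p. p \<in> X \<Longrightarrow> a1 p \<subseteq> E1" "\<And>p. p \<in> X \<Longrightarrow> a2 p \<subseteq> E2" "\<And>p. p \<in> X \<Longrightarrow> a3 p \<subseteq> E3"
    and rich: "\<And>p. p \<in> X \<Longrightarrow> r1 \<le> real (card (a1 p))" "\<And>p. p \<in> X \<Longrightarrow> r2 \<le> real (card (a2 p))"
      "\<And>p. p \<in> X \<Longrightarrow> r3 \<le> real (card (a3 p))"
    and nonneg: "0 \<le> r1" "0 \<le> r2" "0 \<le> r3"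
    and determined: "\<And>e1 e2 e3. e1 \<in> E1 \<Longrightarrow> e2 \<in> E2 \<Longrightarrow> e3 \<in> E3 \<Longrightarrow>
      real (card {p \<in> X. e1 \<in> a1 p \<and> e2 \<in> a2 p \<and> e3 \<in> a3 p}) \<le> b"
  shows "real (card X) * (r1 * r2 * r3) \<le> real (card E1) * real (card E2) * real (card E3) * b"
proof -
  define Z where "Z = (SIGMA p:X. a1 p \<times> a2 p \<times> a3 p)"
  define Z' where "Z' = (SIGMA e:E1 \<times> E2 \<times> E3.
    {p \<in> X. fst e \<in> a1 p \<and> fst (snd e) \<in> a2 p \<and> snd (snd e) \<in> a3 p})"
  have fa: "finite (a1 p)" "finite (a2 p)" "finite (a3 p)" if "p \<in> X" for p
    using sub[OF that] fin finite_subset by blast+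
  have "Z' = prod.swap ` Z" unfolding Z_def Z'_def using sub by force
  then have "card Z = card Z'" by (metis card_image inj_swap)
  have "real (card X) * (r1 * r2 * r3) = (\<Sum>p\<in>X. r1 * r2 * r3)" by simp
  also have "\<dots> \<le> (\<Sum>p\<in>X. real (card (a1 p)) * real (card (a2 p)) * real (card (a3 p)))"
    using rich nonneg by (intro sum_mono mult_mono) auto
  also have "\<dots> = real (card Z)"
    unfolding Z_def using fa fin by (subst card_SigmaI) (auto simp: card_cartesian_product mult.assoc)
  also have "\<dots> = real (card Z')" using \<open>card Z = card Z'\<close> by simp
  also have "\<dots> \<le> real (card (E1 \<times> E2 \<times> E3)) * b"
    unfolding Z'_def using fin determined by (intro real_card_Sigma_le) auto
  finally show ?thesis by (simp add: card_cartesian_product mult.assoc)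
qed

text \<open>Cauchy-Schwarz for the cardinalities of the fibres of \<open>f\<close>.\<close>
lemma card_square_le_card_collisions:
  assumes "finite R" "finite V" "f ` R \<subseteq> V"
  shows "(real (card R))\<^sup>2 \<le> real (card V) * real (card {(x, y) \<in> R \<times> R. f x = f y})"
proof -
  define n where "n v = real (card {x \<in> R. f x = v})" for v
  have "real (card R) = (\<Sum>v\<in>V. n v)"
    using sum.group[OF assms, of "\<lambda>_. 1::real"] unfolding n_def by simp
  moreover have "(\<Sum>v\<in>V. n v)\<^sup>2 \<le> real (card V) * (\<Sum>v\<in>V. (n v)\<^sup>2)"
    using Cauchy_Schwarz_ineq_sum[of "\<lambda>_. 1" n V] by simp
  moreover have "(\<Sum>v\<in>V. (n v)\<^sup>2) = real (card {(x, y) \<in> R \<times> R. f x = f y})"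
  proof -
    have eq: "{(x, y) \<in> R \<times> R. f x = f y} = (\<Union>v\<in>V. {x \<in> R. f x = v} \<times> {x \<in> R. f x = v})"
      using assms(3) by auto
    have "card (\<Union>v\<in>V. {x \<in> R. f x = v} \<times> {x \<in> R. f x = v})
        = (\<Sum>v\<in>V. card ({x \<in> R. f x = v} \<times> {x \<in> R. f x = v}))"
      using assms by (intro card_UN_disjoint) auto
    then show ?thesis unfolding eq n_def by (simp add: card_cartesian_product power2_eq_square)
  qed
  ultimately show ?thesis by metis
qed

text \<open>
  The values of \<open>F\<close> fill an interval of length \<open>8 h\<close>, which meets \<open>O(h W)\<close> multiples of \<open>1/W\<close>, and
  near each of them the lower bound on the slope leaves room for \<open>O(1 / (\<eta> h))\<close> points of the grid.
\<close>
lemma card_near_multiples_le: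
  fixes F :: "real \<Rightarrow> real" and A :: "real set"
  assumes pos: "0 < \<delta>" "1 \<le> W" "\<delta> * W \<le> 1" "0 < \<eta>" "\<eta> \<le> 1" "1 / W \<le> h" "h \<le> 1" "1 \<le> E"
    and grid: "\<And>x. x \<in> A \<Longrightarrow> \<exists>n::int. x = a + of_int n * \<delta>"
    and unit: "A \<subseteq> {0..1}"
    and lower: "\<And>x y. x \<in> A \<Longrightarrow> y \<in> A \<Longrightarrow> \<eta> * h * \<bar>x - y\<bar> \<le> \<bar>F x - F y\<bar>"
    and upper: "\<And>x y. x \<in> A \<Longrightarrow> y \<in> A \<Longrightarrow> \<bar>F x - F y\<bar> \<le> 8 * h * \<bar>x - y\<bar>"
    and near: "\<And>x. x \<in> A \<Longrightarrow> \<exists>k::int. \<bar>F x - of_int k / W\<bar> \<le> E * \<delta>"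
  shows "real (card A) \<le> 33 * E\<^sup>2 * W / \<eta>"
proof -
  have h: "h > 0" using pos by (meson divide_pos_pos less_le_trans zero_less_one)
  have diam: "\<bar>x - y\<bar> \<le> 1" if "x \<in> A" "y \<in> A" for x y
  proof -
    have "x \<in> {0..1}" "y \<in> {0..1}" using unit that by blast+
    then show ?thesis by auto
  qed
  have finA: "finite A"
    using card_grid_le(1)[OF pos(1) _ grid diam] by simp
  obtain k where k: "\<And>x. x \<in> A \<Longrightarrow> \<bar>F x - of_int (k x) / W\<bar> \<le> E * \<delta>"
    using near by metis
  have "real (card ((\<lambda>x. real_of_int (k x)) ` A)) \<le> (W * (8 * h + 2 * E * \<delta>)) / 1 + 1"
  proof (rule card_grid_le(2)[where a = 0])
    fix u v assume "u \<in> (\<lambda>x. real_of_int (k x)) ` A" "v \<in> (\<lambda>x. real_of_int (k x)) ` A"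
    then obtain x y where xy: "x \<in> A" "y \<in> A" "u = of_int (k x)" "v = of_int (k y)" by auto
    have "\<bar>x - y\<bar> \<le> 1" using xy diam by blast
    then have "8 * h * \<bar>x - y\<bar> \<le> 8 * h" using h by (simp add: mult_left_le)
    then have "\<bar>u / W - v / W\<bar> \<le> 8 * h + 2 * E * \<delta>"
      unfolding xy(3,4) using k[OF xy(1)] k[OF xy(2)] upper[OF xy(1,2)] by linarith
    then have "\<bar>u - v\<bar> / W \<le> 8 * h + 2 * E * \<delta>"
      using pos by (simp add: diff_divide_distrib[symmetric])
    then show "\<bar>u - v\<bar> \<le> W * (8 * h + 2 * E * \<delta>)"
      using pos by (simp add: field_simps)
  qed (use pos h in auto)
  moreover have "real (card A) \<le> real (card ((\<lambda>x. real_of_int (k x)) ` A)) * ((2 * E * \<delta> / (\<eta> * h)) / \<delta> + 1)"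
  proof (rule card_le_card_image_times_fibres[OF finA])
    fix z
    show "real (card {x \<in> A. real_of_int (k x) = z}) \<le> (2 * E * \<delta> / (\<eta> * h)) / \<delta> + 1"
    proof (rule card_grid_le(2))
      fix x y assume "x \<in> {x \<in> A. real_of_int (k x) = z}" "y \<in> {x \<in> A. real_of_int (k x) = z}"
      then have xy: "x \<in> A" "y \<in> A" "real_of_int (k x) = real_of_int (k y)" by auto
      have "\<eta> * h * \<bar>x - y\<bar> \<le> 2 * E * \<delta>"
      proof -
        have "\<bar>F x - of_int (k y) / W\<bar> \<le> E * \<delta>" using k[OF xy(1)] xy(3) by simp
        then show ?thesis using k[OF xy(2)] lower[OF xy(1,2)] by argo
      qed
      then show "\<bar>x - y\<bar> \<le> 2 * E * \<delta> / (\<eta> * h)"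
        using pos h by (simp add: pos_le_divide_eq mult.commute)
    qed (use pos h grid in auto)
  qed
  ultimately have "real (card A) \<le> (W * (8 * h + 2 * E * \<delta>) + 1) * (2 * E / (\<eta> * h) + 1)"
    using pos h
    by (smt (verit) divide_divide_eq_left divide_nonneg_pos div_by_1 mult.commute
        mult_pos_pos mult_right_mono nonzero_mult_divide_mult_cancel_right2 times_divide_eq_left
        nonzero_divide_eq_eq)
  also have "\<dots> \<le> (8 * h * W + 3 * E) * (2 * E / (\<eta> * h) + 1)"
  proof (rule mult_right_mono)
    have "E * (\<delta> * W) \<le> E" using pos by (simp add: mult_left_le)
    moreover have "W * (8 * h + 2 * E * \<delta>) = 8 * h * W + 2 * (E * (\<delta> * W))"
      by (simp add: algebra_simps)
    ultimately show "W * (8 * h + 2 * E * \<delta>) + 1 \<le> 8 * h * W + 3 * E" using pos by linarith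
  qed (use pos h in auto)
  also have "\<dots> = 16 * E * (W / \<eta>) + 6 * E\<^sup>2 * (1 / (\<eta> * h)) + 8 * h * W + 3 * E"
    using pos h by (simp add: field_simps power2_eq_square)
  also have "\<dots> \<le> 16 * E\<^sup>2 * (W / \<eta>) + 6 * E\<^sup>2 * (W / \<eta>) + 8 * E\<^sup>2 * (W / \<eta>) + 3 * E\<^sup>2 * (W / \<eta>)"
  proof -
    have a: "1 \<le> E\<^sup>2" "E \<le> E\<^sup>2" using pos
      by (simp add: one_le_power, simp add: power2_eq_square mult_le_cancel_left1)
    have w: "W \<le> W / \<eta>" using pos by (simp add: pos_le_divide_eq mult_left_le)
    have "1 / h \<le> W" using pos h by (simp add: field_simps)
    then have b: "1 / (\<eta> * h) \<le> W / \<eta>" using pos by (simp add: field_simps)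
    have c1: "E * (W / \<eta>) \<le> E\<^sup>2 * (W / \<eta>)" using a w pos by (intro mult_right_mono) auto
    have c2: "E\<^sup>2 * (1 / (\<eta> * h)) \<le> E\<^sup>2 * (W / \<eta>)" using b by (intro mult_left_mono) auto
    have "h * W \<le> 1 * (W / \<eta>)" using w pos h by (intro mult_mono) auto
    also have "\<dots> \<le> E\<^sup>2 * (W / \<eta>)" using a w pos by (intro mult_right_mono) auto
    finally have c3: "h * W \<le> E\<^sup>2 * (W / \<eta>)" .
    have "E * 1 \<le> E\<^sup>2 * (W / \<eta>)" using a w pos by (intro mult_mono) auto
    then show ?thesis using c1 c2 c3 unfolding mult.assoc by linarith
  qed
  also have "\<dots> = 33 * E\<^sup>2 * W / \<eta>" by (simp add: field_simps)
  finally show ?thesis .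
qed

section \<open>The linear forms defining the plates\<close>

text \<open>The inner product with the velocity \<open>(1, 2 t, 3 t\<^sup>2)\<close> of the moment curve.\<close>
definition tangent_form :: "real \<Rightarrow> real^3 \<Rightarrow> real" where
  "tangent_form t v = v $ 1 + 2 * t * v $ 2 + 3 * t\<^sup>2 * v $ 3"

lemma tangent_form_diff: "tangent_form t (u - v) = tangent_form t u - tangent_form t v"
  unfolding tangent_form_def by (simp add: algebra_simps)

lemma tangent_form_add: "tangent_form t (u + v) = tangent_form t u + tangent_form t v"
  unfolding tangent_form_def by (simp add: algebra_simps)

lemma tangent_form_scaleR: "tangent_form t (c *\<^sub>R v) = c * tangent_form t v"
  unfolding tangent_form_def by (simp add: algebra_simps)

text \<open>
  The second factor on the right is, with \<open>t = s\<close>, the derivative in \<open>t\<close>; in general it is the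
  derivative at the midpoint of \<open>s\<close> and \<open>t\<close>, the form being quadratic in \<open>t\<close>.
\<close>
lemma tangent_form_param_diff:
  "tangent_form s v - tangent_form t v = (s - t) * (2 * v $ 2 + 3 * (s + t) * v $ 3)"
  unfolding tangent_form_def by (simp add: algebra_simps power2_eq_square)

lemma abs_tangent_form_le:
  assumes "0 \<le> t" "t \<le> 1" "\<bar>v $ 2\<bar> \<le> c" "\<bar>v $ 3\<bar> \<le> c"
  shows "\<bar>tangent_form t v - v $ 1\<bar> \<le> 5 * c"
proof -
  have t2: "0 \<le> t\<^sup>2" "t\<^sup>2 \<le> 1" using assms by (auto simp: power_le_one)
  have "\<bar>t * v $ 2\<bar> \<le> 1 * c" unfolding abs_mult using assms by (intro mult_mono) auto
  moreover have "\<bar>t\<^sup>2 * v $ 3\<bar> \<le> 1 * c" unfolding abs_mult using assms t2 by (intro mult_mono) auto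
  ultimately show ?thesis unfolding tangent_form_def by auto
qed

lemma abs_mult_le_coeff:
  fixes g x e :: real
  assumes "\<bar>g * x\<bar> \<le> e" "c \<le> g" "0 < c"
  shows "\<bar>x\<bar> \<le> e / c"
proof -
  have "c * \<bar>x\<bar> \<le> g * \<bar>x\<bar>" using assms by (intro mult_right_mono) auto
  then show ?thesis using assms by (simp add: abs_mult pos_le_divide_eq mult.commute)
qed

text \<open>
  Divided differences recover the coefficients of a quadratic polynomial from its values at three
  separated points.
\<close>
lemma transversal:
  assumes t: "0 \<le> t1" "t1 \<le> 1/6" "1/3 \<le> t2" "t2 \<le> 1/2" "2/3 \<le> t3" "t3 \<le> 1"
    and f: "\<bar>tangent_form t1 v\<bar> \<le> e" "\<bar>tangent_form t2 v\<bar> \<le> e" "\<bar>tangent_form t3 v\<bar> \<le> e"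
  shows "\<bar>v $ j\<bar> \<le> 22 * e"
proof -
  define x y z where "x = v $ 1" "y = v $ 2" "z = v $ 3"
  note xyz = this
  have e: "0 \<le> e" using f by linarith
  have "\<bar>(t2 - t1) * (2 * y + 3 * (t2 + t1) * z)\<bar> \<le> 2 * e"
    using f tangent_form_param_diff[of t2 v t1] unfolding xyz by linarith
  then have d12: "\<bar>2 * y + 3 * (t2 + t1) * z\<bar> \<le> 12 * e"
    using abs_mult_le_coeff[of "t2 - t1" _ "2 * e" "1/6"] t by simp
  have "\<bar>(t3 - t2) * (2 * y + 3 * (t3 + t2) * z)\<bar> \<le> 2 * e"
    using f tangent_form_param_diff[of t3 v t2] unfolding xyz by linarith
  then have d23: "\<bar>2 * y + 3 * (t3 + t2) * z\<bar> \<le> 12 * e"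
    using abs_mult_le_coeff[of "t3 - t2" _ "2 * e" "1/6"] t by simp
  have "(t3 - t1) * (3 * z) = (2 * y + 3 * (t3 + t2) * z) - (2 * y + 3 * (t2 + t1) * z)"
    by (simp add: algebra_simps)
  then have "\<bar>(t3 - t1) * (3 * z)\<bar> \<le> 24 * e" using d12 d23 by linarith
  then have "\<bar>3 * z\<bar> \<le> 48 * e"
    using abs_mult_le_coeff[of "t3 - t1" _ "24 * e" "1/2"] t by simp
  then have z: "\<bar>z\<bar> \<le> 16 * e" by simp
  have "\<bar>(t2 + t1) * z\<bar> \<le> 2/3 * (16 * e)"
    unfolding abs_mult using t z by (intro mult_mono) auto
  then have "\<bar>3 * (t2 + t1) * z\<bar> \<le> 32 * e" by (simp only: abs_mult mult.assoc abs_numeral)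
  then have y: "\<bar>y\<bar> \<le> 22 * e" using d12 by linarith
  have "\<bar>t1 * y\<bar> \<le> 1/6 * (22 * e)" unfolding abs_mult using t y by (intro mult_mono) auto
  moreover have "\<bar>t1\<^sup>2 * z\<bar> \<le> (1/6)\<^sup>2 * (16 * e)"
    unfolding abs_mult using t z by (intro mult_mono) (auto intro: power_mono)
  ultimately have x: "\<bar>x\<bar> \<le> 22 * e"
    using f(1) e unfolding tangent_form_def xyz by (simp add: power2_eq_square)
  have "j = 1 \<or> j = 2 \<or> j = 3" using exhaust_3 by blast
  then show ?thesis using x y z e unfolding xyz by auto
qed

lemma card_lattice_cluster_le:
  fixes Y :: "(real^3) set"
  assumes "0 < \<delta>" "0 \<le> L" and lattice: "\<And>p j. p \<in> Y \<Longrightarrow> \<exists>n::int. p $ j = of_int n * \<delta>"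
    and close: "\<And>p p' j. p \<in> Y \<Longrightarrow> p' \<in> Y \<Longrightarrow> \<bar>p $ j - p' $ j\<bar> \<le> L * \<delta>"
  shows "finite Y" and "real (card Y) \<le> (L + 1) ^ 3"
proof -
  define c where "c p = (p $ 1, p $ 2, p $ 3)" for p :: "real^3"
  have inj: "inj_on c Y" unfolding c_def by (auto intro!: inj_onI simp: vec_eq_iff forall_3)
  have grid: "\<exists>n::int. x = 0 + of_int n * \<delta>" if "x \<in> (\<lambda>p. p $ j) ` Y" for x j
    using that lattice by auto
  have near: "\<bar>x - y\<bar> \<le> L * \<delta>" if "x \<in> (\<lambda>p. p $ j) ` Y" "y \<in> (\<lambda>p. p $ j) ` Y" for x y j
    using that close by auto
  have A: "finite ((\<lambda>p. p $ j) ` Y)" "real (card ((\<lambda>p. p $ j) ` Y)) \<le> L + 1" for j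
  proof -
    have "0 \<le> L * \<delta>" using assms by simp
    note g = card_grid_le[OF assms(1) this grid[of _ j] near[of _ j]]
    show "finite ((\<lambda>p. p $ j) ` Y)" by (rule g(1))
    show "real (card ((\<lambda>p. p $ j) ` Y)) \<le> L + 1" using g(2) assms(1) by simp
  qed
  have "c ` Y \<subseteq> (\<lambda>p. p $ 1) ` Y \<times> (\<lambda>p. p $ 2) ` Y \<times> (\<lambda>p. p $ 3) ` Y"
    unfolding c_def by auto
  moreover from this show "finite Y"
    using A(1) inj finite_imageD finite_subset by (metis finite_cartesian_product)
  ultimately have "card (c ` Y) \<le> card ((\<lambda>p. p $ 1) ` Y) * (card ((\<lambda>p. p $ 2) ` Y) * card ((\<lambda>p. p $ 3) ` Y))"
    unfolding card_cartesian_product[symmetric] using A by (intro card_mono) auto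
  then have "real (card Y) \<le> real (card ((\<lambda>p. p $ 1) ` Y)) *
      (real (card ((\<lambda>p. p $ 2) ` Y)) * real (card ((\<lambda>p. p $ 3) ` Y)))"
    using card_image[OF inj] by (metis of_nat_le_iff of_nat_mult)
  also have "\<dots> \<le> (L + 1) * ((L + 1) * (L + 1))" using A assms by (intro mult_mono) auto
  finally show "real (card Y) \<le> (L + 1) ^ 3" by (simp add: power3_eq_cube mult.assoc)
qed

section \<open>Incidences between points and periodic families of plates\<close>

text \<open>
  \<open>Is i\<close> stands for the intervals of family \<open>i\<close>, \<open>pos I\<close> for the left end point of \<open>I\<close>, \<open>S I\<close> for
  the plates associated with \<open>I\<close>, and \<open>v I P\<close> for the value that the form of \<open>I\<close> takes on the plate
  \<open>P\<close>, known up to \<open>O(\<delta>)\<close>. The single constant \<open>B\<close> collects all implicit constants.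

  The axiom \<open>periodic\<close> moves every plate, by a multiple of the period, next to one of the seven
  values \<open>0, \<dots>, 6\<close>. One target value would not do: a plate that meets the unit cube
  only near one of its corners can be shifted only over a range of values of length 1, and this range
  depends on the corner.
\<close>
locale plate_incidences =
  fixes \<delta> W B :: real and X :: "(real^3) set" and Is :: "nat \<Rightarrow> 'i set" and pos :: "'i \<Rightarrow> real"
    and a :: "nat \<Rightarrow> real" and S :: "'i \<Rightarrow> 'p set" and v :: "'i \<Rightarrow> 'p \<Rightarrow> real"
    and inc :: "'p \<Rightarrow> real^3 \<Rightarrow> bool" and M N r :: "nat \<Rightarrow> real"
  assumes \<delta>: "0 < \<delta>" and W: "1 \<le> W" and \<delta>W: "\<delta> * W \<le> 1" and B: "1 \<le> B"
    and finite_X: "finite X"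
    and X_unit: "p \<in> X \<Longrightarrow> 0 \<le> p $ l \<and> p $ l \<le> 1"
    and X_lattice: "p \<in> X \<Longrightarrow> \<exists>n::int. p $ l = of_int n * \<delta>"
    and pos1: "I \<in> Is 1 \<Longrightarrow> 0 \<le> pos I \<and> pos I \<le> 1/6"
    and pos2: "I \<in> Is 2 \<Longrightarrow> 1/3 \<le> pos I \<and> pos I \<le> 1/2"
    and pos3: "I \<in> Is 3 \<Longrightarrow> 2/3 \<le> pos I \<and> pos I \<le> 1"
    and finite_Is: "i \<in> {1,2,3} \<Longrightarrow> finite (Is i)"
    and inj_pos: "i \<in> {1,2,3} \<Longrightarrow> inj_on pos (Is i)"
    and pos_grid: "i \<in> {1,2,3} \<Longrightarrow> I \<in> Is i \<Longrightarrow> \<exists>n::int. pos I = a i + of_int n * \<delta>"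
    and card_Is: "i \<in> {1,2,3} \<Longrightarrow> real (card (Is i)) \<le> B * M i"
    and N_nonneg: "i \<in> {1,2,3} \<Longrightarrow> 0 \<le> N i"
    and r_ge_1: "i \<in> {1,2,3} \<Longrightarrow> 1 \<le> r i"
    and finite_S: "i \<in> {1,2,3} \<Longrightarrow> I \<in> Is i \<Longrightarrow> finite (S I)"
    and rich: "i \<in> {1,2,3} \<Longrightarrow> p \<in> X \<Longrightarrow> r i \<le> real (\<Sum>I\<in>Is i. card {P \<in> S I. inc P p})"
    and inc_value: "i \<in> {1,2,3} \<Longrightarrow> I \<in> Is i \<Longrightarrow> P \<in> S I \<Longrightarrow> inc P p \<Longrightarrow>
      \<bar>tangent_form (pos I) p - v I P\<bar> \<le> B * \<delta>"
    and value_bounded: "i \<in> {1,2,3} \<Longrightarrow> I \<in> Is i \<Longrightarrow> P \<in> S I \<Longrightarrow> \<bar>v I P\<bar> \<le> B"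
    and card_fat: "i \<in> {1,2,3} \<Longrightarrow> I \<in> Is i \<Longrightarrow>
      real (card {P \<in> S I. \<bar>v I P - u\<bar> \<le> 1 / W}) \<le> B * N i"
    and card_through: "i \<in> {1,2,3} \<Longrightarrow> I \<in> Is i \<Longrightarrow> p \<in> X \<Longrightarrow> real (card {P \<in> S I. inc P p}) \<le> B"
    and periodic: "i \<in> {1,2,3} \<Longrightarrow> I \<in> Is i \<Longrightarrow> P \<in> S I \<Longrightarrow>
      \<exists>P'\<in>S I. (\<exists>k::int. \<bar>v I P' - v I P - of_int k / W\<bar> \<le> B * \<delta>) \<and>
        (\<exists>l::nat. l \<le> 6 \<and> \<bar>v I P' - real l\<bar> \<le> B / W)"
begin

lemma W0: "0 < W" using W by simp

lemma \<delta>_le: "\<delta> \<le> 1 / W" using \<delta>W W0 by (simp add: pos_le_divide_eq)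

lemma pos_unit: "i \<in> {1,2,3} \<Longrightarrow> I \<in> Is i \<Longrightarrow> 0 \<le> pos I \<and> pos I \<le> 1"
  using pos1[of I] pos2[of I] pos3[of I] by auto

lemma M_nonneg: "i \<in> {1,2,3} \<Longrightarrow> 0 \<le> M i"
  using card_Is[of i] B by (smt (verit) of_nat_0_le_iff zero_le_mult_iff)

text \<open>A slab of thickness \<open>c/W\<close> is covered by \<open>O(c)\<close> fat plates.\<close>
lemma card_slab_le:
  assumes "i \<in> {1,2,3}" "I \<in> Is i" "1 \<le> c"
  shows "real (card {P \<in> S I. \<bar>v I P - u\<bar> \<le> c / W}) \<le> 5 * c * B * N i"
proof -
  define m where "m = \<lceil>c\<rceil>"
  have m: "c \<le> of_int m" "of_int m \<le> c + 1" unfolding m_def by linarith+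
  let ?F = "\<lambda>k::int. {P \<in> S I. \<bar>v I P - (u + of_int k / W)\<bar> \<le> 1 / W}"
  have "{P \<in> S I. \<bar>v I P - u\<bar> \<le> c / W} \<subseteq> (\<Union>k\<in>{-m..m}. ?F k)"
  proof
    fix P assume "P \<in> {P \<in> S I. \<bar>v I P - u\<bar> \<le> c / W}"
    then have P: "P \<in> S I" "\<bar>v I P - u\<bar> * W \<le> c" using W0 by (auto simp: field_simps)
    define k where "k = \<lfloor>(v I P - u) * W\<rfloor>"
    have "\<bar>(v I P - u) * W\<bar> \<le> of_int m" using P(2) m W0 by (simp add: abs_mult)
    then have "k \<in> {-m..m}" unfolding k_def by (auto simp: abs_le_iff le_floor_iff floor_le_iff)
    moreover have "\<bar>(v I P - u) * W - of_int k\<bar> \<le> 1" unfolding k_def by linarith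
    then have "\<bar>((v I P - u) * W - of_int k) / W\<bar> \<le> 1 / W"
      unfolding abs_divide using W0 by (simp add: divide_right_mono)
    then have "\<bar>v I P - (u + of_int k / W)\<bar> \<le> 1 / W"
      using W0 by (simp add: diff_divide_distrib diff_diff_eq)
    ultimately show "P \<in> (\<Union>k\<in>{-m..m}. ?F k)" using P(1) by blast
  qed
  then have "real (card {P \<in> S I. \<bar>v I P - u\<bar> \<le> c / W}) \<le> real (card (\<Union>k\<in>{-m..m}. ?F k))"
    using finite_S[OF assms(1,2)] by (intro of_nat_mono card_mono) auto
  also have "\<dots> \<le> real (card {-m..m}) * (B * N i)"
    using card_fat[OF assms(1,2)] by (intro real_card_UN_le) auto
  also have "\<dots> \<le> (5 * c) * (B * N i)"
    using m assms(3) B N_nonneg[OF assms(1)] by (intro mult_right_mono) auto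
  finally show ?thesis by (simp add: mult.assoc)
qed

lemma card_S_le:
  assumes "i \<in> {1,2,3}" "I \<in> Is i"
  shows "real (card (S I)) \<le> 5 * B\<^sup>2 * W * N i"
proof -
  have "S I = {P \<in> S I. \<bar>v I P - 0\<bar> \<le> (B * W) / W}"
    using value_bounded[OF assms] W0 by auto
  moreover have "1 \<le> B * W" using B W by (metis mult_mono' mult_1 zero_le_one)
  ultimately have "real (card (S I)) \<le> 5 * (B * W) * B * N i"
    using card_slab_le[OF assms, of "B * W" 0] by simp
  then show ?thesis by (simp add: power2_eq_square algebra_simps)
qed

lemma card_Sigma_Is_le:
  assumes "i \<in> {1,2,3}" "\<And>I. I \<in> Is i \<Longrightarrow> F I \<subseteq> S I"
    "\<And>I. I \<in> Is i \<Longrightarrow> real (card (F I)) \<le> c * N i" "0 \<le> c"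
  shows "finite (Sigma (Is i) F)" "real (card (Sigma (Is i) F)) \<le> B * c * (N i * M i)"
proof -
  have fin: "finite (F I)" if "I \<in> Is i" for I
    using assms that finite_S finite_subset by metis
  then show "finite (Sigma (Is i) F)" using finite_Is[OF assms(1)] by blast
  have "real (card (Sigma (Is i) F)) \<le> real (card (Is i)) * (c * N i)"
    using finite_Is[OF assms(1)] fin assms by (intro real_card_Sigma_le) auto
  also have "\<dots> \<le> (B * M i) * (c * N i)"
    using card_Is[OF assms(1)] N_nonneg[OF assms(1)] assms(4) by (intro mult_right_mono) auto
  finally show "real (card (Sigma (Is i) F)) \<le> B * c * (N i * M i)" by (simp add: algebra_simps)
qed

text \<open>Three plates with transversal directions meet in \<open>O(1)\<close> lattice cubes.\<close>
lemma determined: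
  assumes "{i, j, k} = {1, 2, 3}" "I \<in> Is i" "J \<in> Is j" "K \<in> Is k" "Y \<subseteq> X" "0 \<le> e"
    and close: "\<And>p p'. p \<in> Y \<Longrightarrow> p' \<in> Y \<Longrightarrow> \<bar>tangent_form (pos I) (p - p')\<bar> \<le> e * \<delta>"
      "\<And>p p'. p \<in> Y \<Longrightarrow> p' \<in> Y \<Longrightarrow> \<bar>tangent_form (pos J) (p - p')\<bar> \<le> e * \<delta>"
      "\<And>p p'. p \<in> Y \<Longrightarrow> p' \<in> Y \<Longrightarrow> \<bar>tangent_form (pos K) (p - p')\<bar> \<le> e * \<delta>"
  shows "real (card Y) \<le> (22 * e + 1) ^ 3"
proof (rule card_lattice_cluster_le(2)[OF \<delta>])
  fix p l assume "p \<in> Y"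
  then show "\<exists>n::int. p $ l = of_int n * \<delta>" using X_lattice assms(5) by blast
next
  fix p p' l assume p: "p \<in> Y" "p' \<in> Y"
  define H where "H n = (if n = i then I else if n = j then J else K)" for n
  have "H n \<in> Is n \<and> \<bar>tangent_form (pos (H n)) (p - p')\<bar> \<le> e * \<delta>" if "n \<in> {1,2,3}" for n
    using that assms(1-4) close[OF p] unfolding assms(1)[symmetric] H_def by auto
  then have H: "H 1 \<in> Is 1" "H 2 \<in> Is 2" "H 3 \<in> Is 3" "\<bar>tangent_form (pos (H 1)) (p - p')\<bar> \<le> e * \<delta>"
    "\<bar>tangent_form (pos (H 2)) (p - p')\<bar> \<le> e * \<delta>" "\<bar>tangent_form (pos (H 3)) (p - p')\<bar> \<le> e * \<delta>"
    by auto
  have "\<bar>(p - p') $ l\<bar> \<le> 22 * (e * \<delta>)"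
    using transversal[OF _ _ _ _ _ _ H(4-6)] pos1[OF H(1)] pos2[OF H(2)] pos3[OF H(3)] by blast
  then show "\<bar>p $ l - p' $ l\<bar> \<le> 22 * e * \<delta>" by (simp add: mult.assoc)
qed (use assms in auto)

lemma rich_card:
  assumes "i \<in> {1,2,3}" "p \<in> X"
  shows "r i \<le> real (card (SIGMA I:Is i. {P \<in> S I. inc P p}))"
  using rich[OF assms] finite_S[OF assms(1)] finite_Is[OF assms(1)] by (subst card_SigmaI) auto

lemma plates_through_pair:
  assumes "i \<in> {1,2,3}" "I \<in> Is i" "P \<in> S I" "inc P p" "inc P p'"
  shows "\<bar>tangent_form (pos I) (p - p')\<bar> \<le> 2 * B * \<delta>"
  using inc_value[OF assms(1-3), of p] inc_value[OF assms(1-3), of p'] assms(4,5)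
  unfolding tangent_form_diff by linarith

lemma trilinear_bound:
  "real (card X) * (r 1 * r 2 * r 3) \<le>
    (5 * B^3 * W * (N 1 * M 1)) * (5 * B^3 * W * (N 2 * M 2)) * (5 * B^3 * W * (N 3 * M 3)) * (45 * B)^3"
proof -
  define E where "E i = Sigma (Is i) S" for i
  have E: "finite (E i)" "real (card (E i)) \<le> 5 * B^3 * W * (N i * M i)" if "i \<in> {1,2,3}" for i
  proof -
    have "real (card (S I)) \<le> (5 * B\<^sup>2 * W) * N i" if "I \<in> Is i" for I
      using card_S_le[OF \<open>i \<in> {1,2,3}\<close> that] by simp
    then show "finite (E i)" "real (card (E i)) \<le> 5 * B^3 * W * (N i * M i)"
      unfolding E_def using card_Sigma_Is_le[OF that, of S "5 * B\<^sup>2 * W"] B W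
      by (auto simp: power2_eq_square power3_eq_cube algebra_simps)
  qed
  have "real (card X) * (r 1 * r 2 * r 3) \<le>
      real (card (E 1)) * real (card (E 2)) * real (card (E 3)) * (45 * B)^3"
  proof (rule trilinear_card_le[where ?a1.0 = "\<lambda>p. SIGMA I:Is 1. {P \<in> S I. inc P p}"
        and ?a2.0 = "\<lambda>p. SIGMA I:Is 2. {P \<in> S I. inc P p}"
        and ?a3.0 = "\<lambda>p. SIGMA I:Is 3. {P \<in> S I. inc P p}"])
    fix e1 e2 e3 assume "e1 \<in> E 1" "e2 \<in> E 2" "e3 \<in> E 3"
    then obtain I1 P1 I2 P2 I3 P3 where e: "e1 = (I1, P1)" "e2 = (I2, P2)" "e3 = (I3, P3)"
      "I1 \<in> Is 1" "I2 \<in> Is 2" "I3 \<in> Is 3" "P1 \<in> S I1" "P2 \<in> S I2" "P3 \<in> S I3"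
      unfolding E_def by blast
    let ?Y = "{p \<in> X. e1 \<in> (SIGMA I:Is 1. {P \<in> S I. inc P p}) \<and> e2 \<in> (SIGMA I:Is 2. {P \<in> S I. inc P p})
      \<and> e3 \<in> (SIGMA I:Is 3. {P \<in> S I. inc P p})}"
    have "real (card ?Y) \<le> (22 * (2 * B) + 1)^3"
    proof (rule determined[of 1 2 3 I1 I2 I3])
      fix p p' assume "p \<in> ?Y" "p' \<in> ?Y"
      then show "\<bar>tangent_form (pos I1) (p - p')\<bar> \<le> 2 * B * \<delta>"
        "\<bar>tangent_form (pos I2) (p - p')\<bar> \<le> 2 * B * \<delta>" "\<bar>tangent_form (pos I3) (p - p')\<bar> \<le> 2 * B * \<delta>"
        using plates_through_pair[of 1 I1 P1] plates_through_pair[of 2 I2 P2]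
          plates_through_pair[of 3 I3 P3] e by auto
    qed (use e B in auto)
    also have "\<dots> \<le> (45 * B)^3" using B by (intro power_mono) auto
    finally show "real (card ?Y) \<le> (45 * B)^3" .
  qed (use E finite_X rich_card r_ge_1[of 1] r_ge_1[of 2] r_ge_1[of 3] in \<open>auto simp: E_def\<close>)
  also have "\<dots> \<le> (5 * B^3 * W * (N 1 * M 1)) * (5 * B^3 * W * (N 2 * M 2)) * (5 * B^3 * W * (N 3 * M 3))
    * (45 * B)^3"
    using E(2) B W M_nonneg N_nonneg by (intro mult_mono mult_nonneg_nonneg) auto
  finally show ?thesis .
qed

text \<open>
  The x coordinate is left out, since shifts by multiples of \<open>1/W\<close> in that direction are factored out.
\<close>
definition close :: "real^3 \<Rightarrow> real^3 \<Rightarrow> bool" where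
  "close p p' \<longleftrightarrow> \<bar>p' $ 2 - p $ 2\<bar> \<le> 6 / W \<and> \<bar>p' $ 3 - p $ 3\<bar> \<le> 6 / W"

definition congruent_mod_period :: "'i \<Rightarrow> real^3 \<Rightarrow> real^3 \<Rightarrow> bool" where
  "congruent_mod_period I p p' \<longleftrightarrow>
    (\<exists>k::int. \<bar>tangent_form (pos I) (p' - p) - of_int k / W\<bar> \<le> 4 * B * \<delta>)"

text \<open>
  There are \<open>21 B W\<close> multiples of the period to consider, \<open>325 B\<^sup>3 N M\<close> plates in a slab for each of
  the two other families, and \<open>(177 B)\<^sup>3\<close> cubes for each choice. The factors \<open>W\<close>
  and \<open>N M\<close> are written separately in \<open>close_pairs\<close>.
\<close>
definition C\<^sub>1 :: real where "C\<^sub>1 = 21 * B * (325 * B^3)\<^sup>2 * (177 * B)^3"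

text \<open>
  Once the multiple \<open>n/W\<close> of the period is chosen, \<open>p'\<close> is confined to a ball of radius \<open>O(1/W)\<close>. A
  plate of another family through that ball has its value in an interval of length \<open>O(1/W)\<close>, so only
  \<open>O(N M)\<close> plates of that family qualify. Two such plates from different families, with the plate
  through \<open>p\<close>, determine \<open>p'\<close>.
\<close>
lemma close_pairs:
  assumes ijk: "{i, j, k} = {1, 2, 3}" and p: "p \<in> X" and I: "I \<in> Is i"
  shows "real (card {p' \<in> X. close p p' \<and> congruent_mod_period I p p'}) * (r j * r k)
    \<le> C\<^sub>1 * W * ((N j * M j) * (N k * M k))"
proof -
  have in3: "i \<in> {1,2,3}" "j \<in> {1,2,3}" "k \<in> {1,2,3}" using ijk by auto
  define Y where "Y n = {p' \<in> X. close p p' \<and> \<bar>tangent_form (pos I) (p' - p) - of_int n / W\<bar> \<le> 4 * B * \<delta>}"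
    for n :: int
  define m where "m = \<lfloor>10 * B * W\<rfloor>"
  have BW: "1 \<le> B * W" using B W by (metis mult_mono' mult_1 zero_le_one)
  have B\<delta>: "B * \<delta> \<le> B / W" using \<delta>_le B
    by (metis mult_left_mono order.trans zero_le_one times_divide_eq_right mult.right_neutral)
  have sub: "{p' \<in> X. close p p' \<and> congruent_mod_period I p p'} \<subseteq> (\<Union>n\<in>{-m..m}. Y n)"
  proof
    fix p' assume "p' \<in> {p' \<in> X. close p p' \<and> congruent_mod_period I p p'}"
    then obtain n :: int where n: "p' \<in> X" "close p p'"
      "\<bar>tangent_form (pos I) (p' - p) - of_int n / W\<bar> \<le> 4 * B * \<delta>"
      unfolding congruent_mod_period_def by auto
    have u: "\<bar>(p' - p) $ l\<bar> \<le> 1" for l using X_unit[OF p, of l] X_unit[OF n(1), of l] by auto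
    have "\<bar>tangent_form (pos I) (p' - p) - (p' - p) $ 1\<bar> \<le> 5 * 1"
      using pos_unit[OF in3(1) I] u by (intro abs_tangent_form_le) auto
    moreover have "B * \<delta> \<le> B" using \<delta>_le B W by (simp add: mult_le_cancel_left1 order.trans)
    ultimately have "\<bar>of_int n / W\<bar> \<le> 10 * B" using n(3) u[of 1] B by linarith
    then have "real_of_int \<bar>n\<bar> \<le> 10 * B * W" using W0 by (simp add: abs_divide pos_divide_le_eq)
    then have "n \<in> {-m..m}" unfolding m_def by (auto simp: le_floor_iff abs_le_iff) linarith
    then show "p' \<in> (\<Union>n\<in>{-m..m}. Y n)" using n unfolding Y_def by blast
  qed
  have Y: "real (card (Y n)) * (r j * r k)
    \<le> (325 * B^3 * (N j * M j)) * (325 * B^3 * (N k * M k)) * (177 * B)^3" for n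
  proof -
    define F where "F J = {P \<in> S J. \<bar>v J P - (tangent_form (pos J) p + of_int n / W)\<bar> \<le> 65 * B / W}" for J
    have F: "finite (Sigma (Is l) F)" "real (card (Sigma (Is l) F)) \<le> 325 * B^3 * (N l * M l)"
      if l: "l \<in> {1,2,3}" for l
    proof -
      have "real (card (F J)) \<le> 325 * B\<^sup>2 * N l" if "J \<in> Is l" for J
        unfolding F_def using card_slab_le[OF l that, of "65 * B"] B
          by (simp add: power2_eq_square algebra_simps)
      then show "finite (Sigma (Is l) F)" "real (card (Sigma (Is l) F)) \<le> 325 * B^3 * (N l * M l)"
        using card_Sigma_Is_le[OF l, of F "325 * B\<^sup>2"] B
        by (auto simp: F_def power2_eq_square power3_eq_cube algebra_simps)
    qed
    have inF: "P \<in> F J" if "l \<in> {1,2,3}" "J \<in> Is l" "P \<in> S J" "inc P p'" "p' \<in> Y n" for l J P p'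
    proof -
      have p': "p' \<in> X" "\<bar>(p' - p) $ 2\<bar> \<le> 6 / W" "\<bar>(p' - p) $ 3\<bar> \<le> 6 / W"
        "\<bar>tangent_form (pos I) (p' - p) - of_int n / W\<bar> \<le> 4 * B * \<delta>"
        using that(5) unfolding Y_def close_def by auto
      have "\<bar>tangent_form (pos I) (p' - p) - (p' - p) $ 1\<bar> \<le> 5 * (6 / W)"
        using pos_unit[OF in3(1) I] p' by (intro abs_tangent_form_le) auto
      moreover have "\<bar>tangent_form (pos J) (p' - p) - (p' - p) $ 1\<bar> \<le> 5 * (6 / W)"
        using pos_unit[OF that(1,2)] p' by (intro abs_tangent_form_le) auto
      moreover have "\<bar>tangent_form (pos J) p' - v J P\<bar> \<le> B * \<delta>" by (rule inc_value[OF that(1-4)])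
      moreover have "1 / W \<le> B / W" using B W0 by (simp add: divide_right_mono)
      ultimately have "\<bar>v J P - (tangent_form (pos J) p + of_int n / W)\<bar> \<le> 65 * (B / W)"
        using p'(4) B\<delta> unfolding tangent_form_diff[of "pos J"] by linarith
      then show ?thesis using that unfolding F_def by simp
    qed
    have "real (card (Y n)) * (1 * r j * r k) \<le>
        real (card {()}) * real (card (Sigma (Is j) F)) * real (card (Sigma (Is k) F)) * (177 * B)^3"
    proof (rule trilinear_card_le[where ?a1.0 = "\<lambda>_. {()}" and ?a2.0 = "\<lambda>p. SIGMA I:Is j. {P \<in> S I. inc P p}"
        and ?a3.0 = "\<lambda>p. SIGMA I:Is k. {P \<in> S I. inc P p}"])
      fix e1 e2 e3 assume "e2 \<in> Sigma (Is j) F" "e3 \<in> Sigma (Is k) F"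
      then obtain I2 P2 I3 P3 where e: "e2 = (I2, P2)" "e3 = (I3, P3)"
        "I2 \<in> Is j" "I3 \<in> Is k" "P2 \<in> S I2" "P3 \<in> S I3"
        unfolding F_def by blast
      let ?Y = "{p \<in> Y n. e1 \<in> {()} \<and> e2 \<in> (SIGMA I:Is j. {P \<in> S I. inc P p})
        \<and> e3 \<in> (SIGMA I:Is k. {P \<in> S I. inc P p})}"
      have "real (card ?Y) \<le> (22 * (8 * B) + 1)^3"
      proof (rule determined[OF ijk I e(3,4)])
        fix p1 p2 assume p12: "p1 \<in> ?Y" "p2 \<in> ?Y"
        show "\<bar>tangent_form (pos I) (p1 - p2)\<bar> \<le> 8 * B * \<delta>"
          using p12 unfolding Y_def tangent_form_diff by simp linarith
        have "2 * B * \<delta> \<le> 8 * B * \<delta>" using B \<delta> by simp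
        then show "\<bar>tangent_form (pos I2) (p1 - p2)\<bar> \<le> 8 * B * \<delta>"
          "\<bar>tangent_form (pos I3) (p1 - p2)\<bar> \<le> 8 * B * \<delta>"
          using plates_through_pair[OF in3(2) e(3,5), of p1 p2]
            plates_through_pair[OF in3(3) e(4,6), of p1 p2] p12 e by auto
      qed (use B in \<open>auto simp: Y_def\<close>)
      also have "\<dots> \<le> (177 * B)^3" using B by (intro power_mono) auto
      finally show "real (card ?Y) \<le> (177 * B)^3" .
    next
      fix p' assume p': "p' \<in> Y n"
      then have "p' \<in> X" unfolding Y_def by simp
      then show "r j \<le> real (card (SIGMA I:Is j. {P \<in> S I. inc P p'}))"
        "r k \<le> real (card (SIGMA I:Is k. {P \<in> S I. inc P p'}))" using rich_card in3 by blast+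
      show "(SIGMA I:Is j. {P \<in> S I. inc P p'}) \<subseteq> Sigma (Is j) F"
        "(SIGMA I:Is k. {P \<in> S I. inc P p'}) \<subseteq> Sigma (Is k) F"
        using inF[OF in3(2) _ _ _ p'] inF[OF in3(3) _ _ _ p'] by auto
    qed (use F in3 r_ge_1[OF in3(2)] r_ge_1[OF in3(3)] finite_X in \<open>auto simp: Y_def\<close>)
    also have "\<dots> \<le> 1 * (325 * B^3 * (N j * M j)) * (325 * B^3 * (N k * M k)) * (177 * B)^3"
      using F(2) in3 B M_nonneg N_nonneg by (intro mult_mono mult_nonneg_nonneg) auto
    finally show ?thesis by simp
  qed
  have rr: "0 < r j * r k" using r_ge_1[OF in3(2)] r_ge_1[OF in3(3)] by simp
  define U where "U = (325 * B^3 * (N j * M j)) * (325 * B^3 * (N k * M k)) * (177 * B)^3"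
  have U: "0 \<le> U" unfolding U_def using in3 B M_nonneg N_nonneg by (intro mult_nonneg_nonneg) auto
  have "real (card {p' \<in> X. close p p' \<and> congruent_mod_period I p p'}) \<le> real (card (\<Union>n\<in>{-m..m}. Y n))"
    using sub finite_X by (intro of_nat_mono card_mono) (auto simp: Y_def)
  also have "\<dots> \<le> real (card {-m..m}) * (U / (r j * r k))"
    using Y rr unfolding U_def by (intro real_card_UN_le) (auto simp: pos_le_divide_eq)
  also have "\<dots> \<le> (21 * B * W) * (U / (r j * r k))"
  proof (rule mult_right_mono)
    have "0 \<le> m" unfolding m_def using BW by simp
    then have "real (card {-m..m}) = 2 * of_int m + 1" by simp
    moreover have "of_int m \<le> 10 * B * W" unfolding m_def by simp
    ultimately show "real (card {-m..m}) \<le> 21 * B * W" using BW by simp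
  qed (use U rr in auto)
  finally have "real (card {p' \<in> X. close p p' \<and> congruent_mod_period I p p'}) * (r j * r k) \<le> 21 * B * W * U"
    using rr by (simp add: pos_le_divide_eq)
  then show ?thesis unfolding U_def C\<^sub>1_def by (simp add: algebra_simps power2_eq_square)
qed

text \<open>
  Incidences between \<open>X'\<close> and the intervals of family \<open>i\<close> are sorted by the plates near \<open>0, \<dots>, 6\<close> to
  which \<open>periodic\<close> moves them. Two points of one class are congruent modulo the period. If close pairs
  dominate the collisions, the first alternative holds, otherwise the second.
\<close>
lemma second_moment:
  assumes ijk: "{i, j, k} = {1, 2, 3}" and sub: "X' \<subseteq> X" and G: "0 \<le> G"
    and far: "\<And>p p'. p \<in> X' \<Longrightarrow> p' \<in> X' \<Longrightarrow> \<not> close p p' \<Longrightarrow>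
      real (card {I \<in> Is i. congruent_mod_period I p p'}) \<le> G"
  shows "real (card X') * (r i * r j * r k) \<le> 70 * B^4 * C\<^sub>1 * W * ((N i * M i) * (N j * M j) * (N k * M k))
    \<or> (r i)\<^sup>2 \<le> 70 * B^5 * (N i * M i) * G"
proof (cases "X' = {}")
  case True
  have "0 \<le> C\<^sub>1" unfolding C\<^sub>1_def using B by auto
  moreover have "i \<in> {1,2,3}" "j \<in> {1,2,3}" "k \<in> {1,2,3}" using ijk by auto
  ultimately have "0 \<le> 70 * B^4 * C\<^sub>1 * W * ((N i * M i) * (N j * M j) * (N k * M k))"
    using B W N_nonneg M_nonneg by (intro mult_nonneg_nonneg) auto
  then show ?thesis using True by simp
next
  case False
  have in3: "i \<in> {1,2,3}" "j \<in> {1,2,3}" "k \<in> {1,2,3}" using ijk by auto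
  have finX': "finite X'" using sub finite_X finite_subset by blast
  define R where "R = (SIGMA p:X'. {I \<in> Is i. \<exists>P\<in>S I. inc P p})"
  define V where "V = (SIGMA I:Is i. {P \<in> S I. \<exists>l::nat. l \<le> 6 \<and> \<bar>v I P - real l\<bar> \<le> B / W})"
  define x where "x = real (card R)"
  define n where "n = real (card X')"
  define m where "m = N i * M i"
  have m: "0 \<le> m" unfolding m_def using N_nonneg M_nonneg in3 by simp
  have n: "0 < n" unfolding n_def using False finX' by (simp add: card_gt_0_iff)
  have ri: "0 < r i" "0 < r j" "0 < r k" using r_ge_1 in3 by (meson less_le_trans zero_less_one)+
  have finR: "finite R" unfolding R_def using finX' finite_Is[OF in3(1)] by auto
  have x_ge: "n * r i \<le> B * x"
  proof -
    have "r i \<le> real (card {I \<in> Is i. \<exists>P\<in>S I. inc P p}) * B" if "p \<in> X'" for p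
    proof -
      have pX: "p \<in> X" using that sub by auto
      have "(\<Sum>I\<in>Is i. card {P \<in> S I. inc P p}) = (\<Sum>I\<in>{I \<in> Is i. \<exists>P\<in>S I. inc P p}. card {P \<in> S I. inc P p})"
        using finite_Is[OF in3(1)] by (intro sum.mono_neutral_right) (auto simp: card_gt_0_iff)
      then have "r i \<le> (\<Sum>I\<in>{I \<in> Is i. \<exists>P\<in>S I. inc P p}. real (card {P \<in> S I. inc P p}))"
        using rich[OF in3(1) pX] by simp
      also have "\<dots> \<le> (\<Sum>I\<in>{I \<in> Is i. \<exists>P\<in>S I. inc P p}. B)"
        using card_through[OF in3(1) _ pX] by (intro sum_mono) auto
      finally show ?thesis by simp
    qed
    then have "(\<Sum>p\<in>X'. r i) \<le> (\<Sum>p\<in>X'. real (card {I \<in> Is i. \<exists>P\<in>S I. inc P p}) * B)"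
      by (intro sum_mono) auto
    also have "\<dots> = x * B"
      unfolding x_def R_def using finX' finite_Is[OF in3(1)]
      by (subst card_SigmaI) (auto simp: sum_distrib_right)
    finally show ?thesis unfolding n_def by (simp add: mult.commute)
  qed
  have V: "finite V" "real (card V) \<le> 35 * B^3 * m"
  proof -
    have "real (card {P \<in> S I. \<exists>l::nat. l \<le> 6 \<and> \<bar>v I P - real l\<bar> \<le> B / W}) \<le> (35 * B\<^sup>2) * N i"
      if I: "I \<in> Is i" for I
    proof -
      have "{P \<in> S I. \<exists>l::nat. l \<le> 6
        \<and> \<bar>v I P - real l\<bar> \<le> B / W} = (\<Union>l\<in>{..6::nat}. {P \<in> S I. \<bar>v I P - real l\<bar> \<le> B / W})"
        by auto
      moreover have "real (card (\<Union>l\<in>{..6::nat}. {P \<in> S I. \<bar>v I P - real l\<bar> \<le> B / W}))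
        \<le> real (card {..6::nat}) * (5 * B * B * N i)"
        using card_slab_le[OF in3(1) I B] by (intro real_card_UN_le) auto
      ultimately show ?thesis by (simp add: power2_eq_square algebra_simps)
    qed
    then show "finite V" "real (card V) \<le> 35 * B^3 * m"
      unfolding V_def m_def using card_Sigma_Is_le[OF in3(1), of "\<lambda>I. {P \<in> S I. \<exists>l::nat. l \<le> 6
        \<and> \<bar>v I P - real l\<bar> \<le> B / W}" "35 * B\<^sup>2"] B
      by (auto simp: power2_eq_square power3_eq_cube algebra_simps)
  qed
  have "\<exists>P'. (I, P') \<in> V \<and> (\<exists>k::int. \<bar>tangent_form (pos I) p + of_int k / W - v I P'\<bar> \<le> 2 * B * \<delta>)"
    if pI: "(p, I) \<in> R" for p I
  proof -
    obtain P where P: "I \<in> Is i" "P \<in> S I" "inc P p" using pI unfolding R_def by auto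
    obtain P' k l where "P' \<in> S I" "\<bar>v I P' - v I P - of_int k / W\<bar> \<le> B * \<delta>" "l \<le> (6::nat)"
      "\<bar>v I P' - real l\<bar> \<le> B / W"
      using periodic[OF in3(1) P(1,2)] by blast
    moreover from this have "\<bar>tangent_form (pos I) p + of_int k / W - v I P'\<bar> \<le> 2 * B * \<delta>"
      using inc_value[OF in3(1) P] by linarith
    ultimately show ?thesis unfolding V_def using P(1) by blast
  qed
  then obtain \<pi> where \<pi>: "\<And>p I. (p, I) \<in> R \<Longrightarrow> (I, \<pi> p I) \<in> V"
    "\<And>p I. (p, I) \<in> R \<Longrightarrow> \<exists>k::int. \<bar>tangent_form (pos I) p + of_int k / W - v I (\<pi> p I)\<bar> \<le> 2 * B * \<delta>"
    by metis
  define f where "f = (\<lambda>(p, I). (I, \<pi> p I))"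
  \<comment> \<open>The collisions \<open>Z\<close> are split into those from close pairs, \<open>Zc\<close>, and from distant pairs, \<open>Zf\<close>.\<close>
  define Z where "Z = {(x, y) \<in> R \<times> R. f x = f y}"
  define Zc where "Zc = (SIGMA q:R. {p' \<in> X. close (fst q) p' \<and> congruent_mod_period (snd q) (fst q) p'})"
  define Zf where "Zf = (SIGMA q:{(p, p') \<in> X' \<times> X'. \<not> close p p'}. {I \<in> Is i. congruent_mod_period I
    (fst q) (snd q)})"
  have cong: "congruent_mod_period I p p'" if pp: "(p, I) \<in> R" "(p', I) \<in> R" "\<pi> p I = \<pi> p' I" for p p' I
  proof -
    obtain k k' :: int where k: "\<bar>tangent_form (pos I) p + of_int k / W - v I (\<pi> p I)\<bar> \<le> 2 * B * \<delta>"
      "\<bar>tangent_form (pos I) p' + of_int k' / W - v I (\<pi> p I)\<bar> \<le> 2 * B * \<delta>"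
      using \<pi>(2)[OF pp(1)] \<pi>(2)[OF pp(2)] pp(3) by auto
    have "\<bar>tangent_form (pos I) (p' - p) - of_int (k - k') / W\<bar> \<le> 4 * B * \<delta>"
      using k unfolding tangent_form_diff by (simp add: diff_divide_distrib)
    then show ?thesis unfolding congruent_mod_period_def by blast
  qed
  have fin_pairs: "finite {(p, p') \<in> X' \<times> X'. \<not> close p p'}"
    by (rule finite_subset[of _ "X' \<times> X'"]) (use finX' in auto)
  have fin: "finite Zc" "finite Zf"
    unfolding Zc_def Zf_def
    by (rule finite_SigmaI[OF finR], use finite_X in simp,
        rule finite_SigmaI[OF fin_pairs], use finite_Is[OF in3(1)] in simp)
  have collisions: "x\<^sup>2 \<le> real (card V) * real (card Z)"
    unfolding x_def Z_def using \<pi>(1) by (intro card_square_le_card_collisions finR V) (auto simp: f_def)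
  have card_Z: "real (card Z) \<le> real (card Zc) + real (card Zf)"
  proof -
    define g where "g = (\<lambda>((p::real^3, I::'i), (p'::real^3, I'::'i)). ((p, I), p'))"
    have inj: "inj_on g Z" unfolding g_def Z_def f_def by (auto intro!: inj_onI)
    have "g ` Z \<subseteq> Zc \<union> (\<lambda>((p, p'), I). ((p, I), p')) ` Zf"
    proof
      fix z assume "z \<in> g ` Z"
      then obtain p I p' where z: "z = ((p, I), p')" "(p, I) \<in> R" "(p', I) \<in> R" "\<pi> p I = \<pi> p' I"
        unfolding g_def Z_def f_def by auto
      have c: "congruent_mod_period I p p'" using cong z by blast
      have X': "p \<in> X'" "p' \<in> X'" "I \<in> Is i" using z unfolding R_def by auto
      show "z \<in> Zc \<union> (\<lambda>((p, p'), I). ((p, I), p')) ` Zf"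
      proof (cases "close p p'")
        case True
        then have "z \<in> Zc" unfolding Zc_def using z c X' sub by auto
        then show ?thesis by blast
      next
        case False
        then have "((p, p'), I) \<in> Zf" unfolding Zf_def using c X' by auto
        then show ?thesis using z by force
      qed
    qed
    then have "card (g ` Z) \<le> card (Zc \<union> (\<lambda>((p, p'), I). ((p, I), p')) ` Zf)"
      using fin by (intro card_mono) auto
    also have "\<dots> \<le> card Zc + card ((\<lambda>((p, p'), I). ((p, I), p')) ` Zf)" by (rule card_Un_le)
    also have "\<dots> \<le> card Zc + card Zf" using card_image_le[OF fin(2)] by simp
    finally show ?thesis using card_image[OF inj] by linarith
  qed
  have card_Zc: "real (card Zc) \<le> x * (C\<^sub>1 * W * ((N j * M j) * (N k * M k)) / (r j * r k))"
    unfolding Zc_def x_def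
  proof (rule real_card_Sigma_le[OF finR])
    fix q assume "q \<in> R"
    then have "fst q \<in> X" "snd q \<in> Is i" using sub unfolding R_def by auto
    from close_pairs[OF ijk this] ri
    show "real (card {p' \<in> X. close (fst q) p' \<and> congruent_mod_period (snd q) (fst q) p'})
        \<le> C\<^sub>1 * W * ((N j * M j) * (N k * M k)) / (r j * r k)"
      by (simp add: pos_le_divide_eq)
  qed (use finite_X in auto)
  have card_Zf: "real (card Zf) \<le> n\<^sup>2 * G"
  proof -
    have "real (card Zf) \<le> real (card {(p, p') \<in> X' \<times> X'. \<not> close p p'}) * G"
      unfolding Zf_def using far finite_Is[OF in3(1)] by (intro real_card_Sigma_le[OF fin_pairs]) auto
    also have "\<dots> \<le> real (card (X' \<times> X')) * G"
      using finX' G by (intro mult_right_mono of_nat_mono card_mono) auto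
    finally show ?thesis unfolding n_def by (simp add: card_cartesian_product power2_eq_square)
  qed
  define y where "y = C\<^sub>1 * W * ((N j * M j) * (N k * M k)) / (r j * r k)"
  have "real (card V) * real (card Z) \<le> 35 * B^3 * m * (x * y + n\<^sup>2 * G)"
    using V(2) card_Z card_Zc card_Zf B m unfolding y_def by (intro mult_mono) auto
  then have main: "x\<^sup>2 \<le> 35 * B^3 * m * (x * y + n\<^sup>2 * G)" using collisions by linarith
  have xpos: "0 < x" using x_ge n ri B by (smt (verit) mult_pos_pos mult_nonneg_nonpos zero_less_mult_pos)
  have B3: "0 \<le> 35 * B^3 * m" using B m by simp
  show ?thesis
  proof (cases "n\<^sup>2 * G \<le> x * y")
    case True
    have "x * x \<le> 35 * B^3 * m * (x * y + x * y)"
      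
      using main mult_left_mono[OF add_left_mono[OF True] B3, of "x * y"] unfolding power2_eq_square
        by linarith
    also have "\<dots> = x * (70 * B^3 * m * y)" by (simp add: algebra_simps)
    finally have "x \<le> 70 * B^3 * m * y" using xpos by simp
    then have "n * r i \<le> B * (70 * B^3 * m * y)" using x_ge B by (smt (verit) mult_left_mono)
    then have "n * r i * (r j * r k) \<le> B * (70 * B^3 * m * y) * (r j * r k)"
      using ri by (intro mult_right_mono) auto
    also have "\<dots> = 70 * B^4 * m * (y * (r j * r k))" by (simp add: eval_nat_numeral algebra_simps)
    also have "y * (r j * r k) = C\<^sub>1 * W * ((N j * M j) * (N k * M k))" unfolding y_def using ri by simp
    finally show ?thesis unfolding n_def m_def by (simp add: algebra_simps)
  next
    case False
    have "x * x \<le> 35 * B^3 * m * (n\<^sup>2 * G + n\<^sup>2 * G)"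
      
      using main mult_left_mono[OF add_right_mono[OF less_imp_le[OF False[unfolded not_le]]] B3, of "n\<^sup>2 * G"]
      unfolding power2_eq_square by linarith
    then have *: "x * x \<le> 70 * B^3 * m * G * n\<^sup>2" by (simp add: algebra_simps)
    have "(n * r i) * (n * r i) \<le> (B * x) * (B * x)" using n ri by (intro mult_mono'[OF x_ge x_ge]) auto
    also have "\<dots> = B * B * (x * x)" by simp
    also have "\<dots> \<le> B * B * (70 * B^3 * m * G * n\<^sup>2)" using * B by (intro mult_left_mono) auto
    finally have "n\<^sup>2 * (r i)\<^sup>2 \<le> n\<^sup>2 * (70 * B^5 * m * G)" by (simp add: eval_nat_numeral algebra_simps)
    then have "(r i)\<^sup>2 \<le> 70 * B^5 * m * G" using n by simp
    then show ?thesis unfolding m_def by simp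
  qed
qed

text \<open>
  The quantity bounded in \<open>slope\<close> is the difference quotient of the form of \<open>p' - p\<close> in the parameter.
\<close>
lemma card_congruent_le:
  assumes i: "i \<in> {1,2,3}" and J: "J \<subseteq> {I \<in> Is i. congruent_mod_period I p p'}"
    and h: "1 / W \<le> h" "h \<le> 1" and \<eta>: "0 < \<eta>" "\<eta> \<le> 1"
    and slope: "\<And>s t. s \<in> pos ` J \<Longrightarrow> t \<in> pos ` J \<Longrightarrow>
      \<eta> * h \<le> \<bar>2 * (p' - p) $ 2 + 3 * (s + t) * (p' - p) $ 3\<bar>
      \<and> \<bar>2 * (p' - p) $ 2 + 3 * (s + t) * (p' - p) $ 3\<bar> \<le> 8 * h"
  shows "real (card J) \<le> 528 * B\<^sup>2 * W / \<eta>"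
proof -
  have inj: "inj_on pos J" using inj_pos[OF i] J by (auto intro: inj_on_subset)
  have "real (card (pos ` J)) \<le> 33 * (4 * B)\<^sup>2 * W / \<eta>"
  proof (rule card_near_multiples_le[OF \<delta> W \<delta>W \<eta> h, where F = "\<lambda>t. tangent_form t (p' - p)"])
    fix s t assume st: "s \<in> pos ` J" "t \<in> pos ` J"
    show "\<eta> * h * \<bar>s - t\<bar> \<le> \<bar>tangent_form s (p' - p) - tangent_form t (p' - p)\<bar>"
      "\<bar>tangent_form s (p' - p) - tangent_form t (p' - p)\<bar> \<le> 8 * h * \<bar>s - t\<bar>"
      unfolding tangent_form_param_diff abs_mult mult.commute[of "\<bar>s - t\<bar>"]
      using slope[OF st] by (auto intro!: mult_right_mono)
  next
    fix s assume "s \<in> pos ` J"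
    then obtain I where I: "s = pos I" "I \<in> Is i" "congruent_mod_period I p p'" using J by auto
    show "\<exists>n::int. s = a i + of_int n * \<delta>" using pos_grid[OF i I(2)] I by simp
    show "\<exists>k::int. \<bar>tangent_form s (p' - p) - of_int k / W\<bar> \<le> 4 * B * \<delta>"
      using I unfolding congruent_mod_period_def by simp
  next
    show "pos ` J \<subseteq> {0..1}" using J pos_unit[OF i] by auto
  qed (use B in auto)
  then show ?thesis using card_image[OF inj] by (simp add: power_mult_distrib)
qed

lemma coordinate_diff_le:
  assumes "p \<in> X" "p' \<in> X"
  shows "\<bar>(p' - p) $ l\<bar> \<le> 1"
  using X_unit[OF assms(1), of l] X_unit[OF assms(2), of l] by auto

text \<open>
  Within a slice of height \<open>1/W\<close> a pair that is not close differs mostly in \<open>y\<close>, so the quadratic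
  polynomial \<open>\<lambda>t. tangent_form t (p' - p)\<close> has a slope comparable to that difference throughout.
\<close>
lemma far_in_slice:
  assumes i: "i \<in> {1,2,3}" and p: "p \<in> X" "p' \<in> X" "\<not> close p p'" "\<bar>p' $ 3 - p $ 3\<bar> \<le> 1 / W"
  shows "real (card {I \<in> Is i. congruent_mod_period I p p'}) \<le> 528 * B\<^sup>2 * W"
proof -
  define h where "h = \<bar>(p' - p) $ 2\<bar>"
  have h: "6 * (1 / W) \<le> h" using p W0 unfolding close_def h_def by (auto simp: field_simps)
  have "real (card {I \<in> Is i. congruent_mod_period I p p'}) \<le> 528 * B\<^sup>2 * W / 1"
  proof (rule card_congruent_le[OF i order.refl, of h])
    show "1 / W \<le> h" using h W0 by (smt (verit) divide_pos_pos)
    show "h \<le> 1" unfolding h_def by (rule coordinate_diff_le[OF p(1,2)])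
    fix s t assume "s \<in> pos ` {I \<in> Is i. congruent_mod_period I p p'}"
      "t \<in> pos ` {I \<in> Is i. congruent_mod_period I p p'}"
    then have "0 \<le> s" "s \<le> 1" "0 \<le> t" "t \<le> 1" using pos_unit[OF i] by auto
    then have "\<bar>(s + t) * (p' - p) $ 3\<bar> \<le> 2 * (1 / W)"
      unfolding abs_mult using p(4) by (intro mult_mono) auto
    then have "\<bar>3 * (s + t) * (p' - p) $ 3\<bar> \<le> 6 * (1 / W)" by (simp only: abs_mult mult.assoc abs_numeral)
    then show "1 * h \<le> \<bar>2 * (p' - p) $ 2 + 3 * (s + t) * (p' - p) $ 3\<bar>
      \<and> \<bar>2 * (p' - p) $ 2 + 3 * (s + t) * (p' - p) $ 3\<bar> \<le> 8 * h"
      using h unfolding h_def by linarith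
  qed auto
  then show ?thesis by simp
qed

text \<open>
  Parameters within \<open>\<eta>\<close> of the critical point \<open>t0\<close> are counted trivially, and on either side of
  that neighbourhood the slope is at least \<open>\<eta> h / 2\<close>.
\<close>
lemma far_in_general:
  assumes i: "i \<in> {1,2,3}" and p: "p \<in> X" "p' \<in> X" "\<not> close p p'" and \<eta>: "0 < \<eta>" "\<eta> \<le> 1"
  shows "real (card {I \<in> Is i. congruent_mod_period I p p'}) \<le> 2 * \<eta> / \<delta> + 1 + 2112 * B\<^sup>2 * W / \<eta>"
proof -
  define J where "J = {I \<in> Is i. congruent_mod_period I p p'}"
  define y z where "y = (p' - p) $ 2" "z = (p' - p) $ 3"
  note yz = this
  define h where "h = max \<bar>y\<bar> \<bar>z\<bar>"
  have hyz: "\<bar>y\<bar> \<le> h" "\<bar>z\<bar> \<le> h" "h = \<bar>y\<bar> \<or> h = \<bar>z\<bar>" unfolding h_def by auto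
  have "6 * (1 / W) < h" using p unfolding close_def h_def yz by auto
  then have h: "1 / W \<le> h" using W0 by (smt (verit) divide_pos_pos)
  have h0: "0 < h" using h W0 by (smt (verit) divide_pos_pos)
  have h1: "h \<le> 1" using coordinate_diff_le[OF p(1,2)] unfolding h_def yz by auto
  have unit: "0 \<le> s \<and> s \<le> 1" if "s \<in> pos ` J" for s using that pos_unit[OF i] unfolding J_def by auto
  have upper: "\<bar>2 * y + 3 * (s + t) * z\<bar> \<le> 8 * h" if "s \<in> pos ` J" "t \<in> pos ` J" for s t
  proof -
    have "\<bar>(s + t) * z\<bar> \<le> 2 * h" unfolding abs_mult using hyz unit[OF that(1)] unit[OF that(2)]
      by (intro mult_mono) auto
    then have "\<bar>3 * (s + t) * z\<bar> \<le> 6 * h" by (simp only: abs_mult mult.assoc abs_numeral)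
    then show ?thesis using hyz by linarith
  qed
  have finJ: "finite J" unfolding J_def using finite_Is[OF i] by simp
  have nonneg: "0 \<le> 2 * \<eta> / \<delta>" "0 \<le> 528 * B\<^sup>2 * W / \<eta>" using \<eta> \<delta> W by auto
  show ?thesis
  \<comment> \<open>If \<open>z\<close> is much smaller than \<open>y\<close>, the form has no critical point near the unit interval.\<close>
  proof (cases "\<bar>z\<bar> < h / 12")
    case True
    have "real (card J) \<le> 528 * B\<^sup>2 * W / 1"
    proof (rule card_congruent_le[OF i _ h h1])
      fix s t assume st: "s \<in> pos ` J" "t \<in> pos ` J"
      have "\<bar>(s + t) * z\<bar> \<le> 2 * (h / 12)" unfolding abs_mult using True unit[OF st(1)] unit[OF st(2)]
        by (intro mult_mono) auto
      then have "\<bar>3 * (s + t) * z\<bar> \<le> h / 2" by (simp only: abs_mult mult.assoc abs_numeral)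
      moreover have "h = \<bar>y\<bar>" using hyz True h0 by auto
      ultimately have "1 * h \<le> \<bar>2 * y + 3 * (s + t) * z\<bar>" by linarith
      then show "1 * h \<le> \<bar>2 * (p' - p) $ 2 + 3 * (s + t) * (p' - p) $ 3\<bar>
          \<and> \<bar>2 * (p' - p) $ 2 + 3 * (s + t) * (p' - p) $ 3\<bar> \<le> 8 * h"
        using upper[OF st] unfolding yz by blast
    qed (auto simp: J_def)
    also have "\<dots> \<le> 528 * B\<^sup>2 * W / \<eta>" using \<eta> W by (intro divide_left_mono) auto
    finally show ?thesis using nonneg unfolding J_def by simp
  next
    case False
    then have z: "h / 12 \<le> \<bar>z\<bar>" "z \<noteq> 0" using h0 by auto
    define t0 where "t0 = - y / (3 * z)"
    define J0 J1 J2 where "J0 = {I \<in> J. \<bar>pos I - t0\<bar> \<le> \<eta>}" "J1 = {I \<in> J. pos I > t0 + \<eta>}"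
      "J2 = {I \<in> J. pos I < t0 - \<eta>}"
    note JJ = this
    have "J = J0 \<union> J1 \<union> J2" unfolding JJ by auto
    then have "card J \<le> card J0 + card J1 + card J2"
      by (metis card_Un_le add_le_mono1 order.trans)
    moreover have "real (card J0) \<le> 2 * \<eta> / \<delta> + 1"
    proof -
      have "inj_on pos J0" using inj_pos[OF i] unfolding JJ J_def by (auto intro: inj_on_subset)
      moreover have "real (card (pos ` J0)) \<le> 2 * \<eta> / \<delta> + 1"
      proof (rule card_grid_le(2)[OF \<delta>])
        fix s assume "s \<in> pos ` J0"
        then show "\<exists>n::int. s = a i + of_int n * \<delta>" using pos_grid[OF i] unfolding JJ J_def by auto
      qed (use \<eta> in \<open>auto simp: JJ\<close>)
      ultimately show ?thesis by (simp add: card_image)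
    qed
    moreover have slope: "real (card J') \<le> 528 * B\<^sup>2 * W / (\<eta> / 2)"
      if J': "J' \<subseteq> J" "\<And>s t. s \<in> pos ` J' \<Longrightarrow> t \<in> pos ` J' \<Longrightarrow> \<eta> \<le> \<bar>(s + t) / 2 - t0\<bar>" for J'
    proof (rule card_congruent_le[OF i _ h h1])
      fix s t assume st: "s \<in> pos ` J'" "t \<in> pos ` J'"
      have "2 * y + 3 * (s + t) * z = 6 * z * ((s + t) / 2 - t0)"
        using z(2) unfolding t0_def by (simp add: field_simps)
      then have "\<bar>2 * y + 3 * (s + t) * z\<bar> = 6 * (\<bar>z\<bar> * \<bar>(s + t) / 2 - t0\<bar>)"
        by (simp only: abs_mult mult.assoc abs_numeral)
      moreover have "h / 12 * \<eta> \<le> \<bar>z\<bar> * \<bar>(s + t) / 2 - t0\<bar>"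
        using z J'(2)[OF st] \<eta> h0 by (intro mult_mono) auto
      ultimately have "\<eta> / 2 * h \<le> \<bar>2 * y + 3 * (s + t) * z\<bar>" by (simp add: mult.commute)
      then show "\<eta> / 2 * h \<le> \<bar>2 * (p' - p) $ 2 + 3 * (s + t) * (p' - p) $ 3\<bar>
          \<and> \<bar>2 * (p' - p) $ 2 + 3 * (s + t) * (p' - p) $ 3\<bar> \<le> 8 * h"
        using upper st J'(1) unfolding yz by blast
    qed (use J' \<eta> in \<open>auto simp: J_def\<close>)
    have "real (card J1) \<le> 528 * B\<^sup>2 * W / (\<eta> / 2)" "real (card J2) \<le> 528 * B\<^sup>2 * W / (\<eta> / 2)"
      by (rule slope; use \<eta> in \<open>auto simp: JJ field_simps abs_if\<close>)+
    ultimately show ?thesis unfolding J_def by simp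
  qed
qed

text \<open>The constant of the first alternative in \<open>second_moment\<close>.\<close>
definition C\<^sub>2 :: real where "C\<^sub>2 = 70 * B^4 * C\<^sub>1"

definition prod_NM :: real where "prod_NM = (N 1 * M 1) * (N 2 * M 2) * (N 3 * M 3)"

lemma permutation_containing:
  assumes "i \<in> {1, 2, 3::nat}"
  obtains j k where "{i, j, k} = {1, 2, 3}" "i \<noteq> j" "i \<noteq> k" "j \<noteq> k"
proof -
  have "{1, 2, 3} = {1, 2, 3::nat}" "{2, 1, 3} = {1, 2, 3::nat}" "{3, 1, 2} = {1, 2, 3::nat}" by auto
  then show ?thesis using that[of 2 3] that[of 1 3] that[of 1 2] assms by auto
qed

lemma prod_over_permutation:
  fixes g :: "nat \<Rightarrow> real"
  assumes "{i, j, k} = {1, 2, 3}" "i \<noteq> j" "i \<noteq> k" "j \<noteq> k"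
  shows "g i * g j * g k = g 1 * g 2 * g 3"
proof -
  have "g i * g j * g k = (\<Prod>l\<in>{i, j, k}. g l)" using assms(2-4) by simp
  also have "\<dots> = (\<Prod>l\<in>{1, 2, 3}. g l)" using assms(1) by simp
  finally show ?thesis by simp
qed

lemma second_moment_rich:
  assumes i: "i \<in> {1, 2, 3}" and sub: "X' \<subseteq> X" and G: "0 \<le> G"
    and far: "\<And>p p'. p \<in> X' \<Longrightarrow> p' \<in> X' \<Longrightarrow> \<not> close p p' \<Longrightarrow>
      real (card {I \<in> Is i. congruent_mod_period I p p'}) \<le> G"
    and large: "70 * B^5 * (N i * M i) * G < (r i)\<^sup>2"
  shows "real (card X') * (r 1 * r 2 * r 3) \<le> C\<^sub>2 * W * prod_NM"
proof -
  obtain j k where jk: "{i, j, k} = {1, 2, 3}" "i \<noteq> j" "i \<noteq> k" "j \<noteq> k"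
    using permutation_containing[OF i] by blast
  have "real (card X') * (r i * r j * r k) \<le> 70 * B^4 * C\<^sub>1 * W * ((N i * M i) * (N j * M j) * (N k * M k))"
    using second_moment[OF jk(1) sub G far] large by linarith
  then show ?thesis
    unfolding prod_over_permutation[OF jk] prod_over_permutation[OF jk, of "\<lambda>l. N l * M l"]
    unfolding C\<^sub>2_def prod_NM_def .
qed

text \<open>
  The choice \<open>\<eta> = sqrt (\<delta> W)\<close> balances the two terms \<open>\<eta> / \<delta>\<close> and \<open>W / \<eta>\<close> in \<open>far_in_general\<close>.
\<close>
lemma bound_very_rich:
  assumes i: "i \<in> {1, 2, 3}"
    and large: "70 * B^5 * (N i * M i) * (2115 * B\<^sup>2 * sqrt (W / \<delta>)) < (r i)\<^sup>2"
  shows "real (card X) * (r 1 * r 2 * r 3) \<le> C\<^sub>2 * W * prod_NM"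
proof (rule second_moment_rich[OF i order.refl _ _ large])
  fix p p' assume p: "p \<in> X" "p' \<in> X" "\<not> close p p'"
  define \<eta> where "\<eta> = sqrt (\<delta> * W)"
  define q where "q = sqrt (W / \<delta>)"
  have sd: "sqrt \<delta> * sqrt \<delta> = \<delta>" "sqrt W * sqrt W = W" using \<delta> W by auto
  have q: "\<eta> / \<delta> = q" "W / \<eta> = q"
    unfolding \<eta>_def q_def real_sqrt_mult real_sqrt_divide using \<delta> W sd by (simp_all add: field_simps)
  have "\<delta> \<le> W" using \<delta>_le W by (smt (verit) divide_le_eq_1)
  then have q1: "1 \<le> q" unfolding q_def using \<delta> by simp
  have b1: "1 \<le> B\<^sup>2" using B by simp
  have "real (card {I \<in> Is i. congruent_mod_period I p p'}) \<le> 2 * \<eta> / \<delta> + 1 + 2112 * B\<^sup>2 * W / \<eta>"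
    by (rule far_in_general[OF i p]) (use \<delta> W \<delta>W in \<open>auto simp: \<eta>_def\<close>)
  also have "\<dots> = 2 * q + 1 + 2112 * B\<^sup>2 * q" using q by (simp flip: times_divide_eq_right)
  also have "\<dots> \<le> 2115 * B\<^sup>2 * q" using q1 mult_right_mono[OF b1, of q] by linarith
  finally show "real (card {I \<in> Is i. congruent_mod_period I p p'}) \<le> 2115 * B\<^sup>2 * sqrt (W / \<delta>)"
    unfolding q_def .
qed (use \<delta> W in auto)

text \<open>Summing the bound over the slices costs a factor \<open>2 W\<close>.\<close>
lemma bound_rich:
  assumes i: "i \<in> {1, 2, 3}"
    and large: "70 * B^5 * (N i * M i) * (528 * B\<^sup>2 * W) < (r i)\<^sup>2"
  shows "real (card X) * (r 1 * r 2 * r 3) \<le> 2 * W * (C\<^sub>2 * W * prod_NM)"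
proof -
  define X' where "X' s = {p \<in> X. \<lfloor>p $ 3 * W\<rfloor> = s}" for s :: int
  define m where "m = \<lfloor>W\<rfloor>"
  have "0 < r l" if "l \<in> {1,2,3}" for l using r_ge_1[OF that] by simp
  then have rpos: "0 < r 1 * r 2 * r 3" by simp
  have "p \<in> (\<Union>s\<in>{0..m}. X' s)" if "p \<in> X" for p
  proof -
    have "0 \<le> p $ 3 * W" "p $ 3 * W \<le> W" using X_unit[OF that, of 3] W by (auto simp: mult_le_cancel_right1)
    then have "\<lfloor>p $ 3 * W\<rfloor> \<in> {0..m}" unfolding m_def by (simp add: floor_mono)
    then show ?thesis unfolding X'_def using that by blast
  qed
  then have "X \<subseteq> (\<Union>s\<in>{0..m}. X' s)" by blast
  then have "real (card X) \<le> real (card (\<Union>s\<in>{0..m}. X' s))"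
    using finite_X by (intro of_nat_mono card_mono) (auto simp: X'_def)
  also have "\<dots> \<le> real (card {0..m}) * (C\<^sub>2 * W * prod_NM / (r 1 * r 2 * r 3))"
  proof (rule real_card_UN_le)
    fix s
    have "real (card (X' s)) * (r 1 * r 2 * r 3) \<le> C\<^sub>2 * W * prod_NM"
    proof (rule second_moment_rich[OF i _ _ _ large])
      fix p p' assume p: "p \<in> X' s" "p' \<in> X' s" "\<not> close p p'"
      have "\<bar>p' $ 3 * W - p $ 3 * W\<bar> \<le> 1" using p(1,2) unfolding X'_def by simp linarith
      then have "\<bar>(p' $ 3 - p $ 3) * W\<bar> \<le> 1" by (simp add: left_diff_distrib)
      then have "\<bar>p' $ 3 - p $ 3\<bar> \<le> 1 / W" using W0 by (simp add: abs_mult pos_le_divide_eq)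
      then show "real (card {I \<in> Is i. congruent_mod_period I p p'}) \<le> 528 * B\<^sup>2 * W"
        using far_in_slice[OF i _ _ p(3)] p unfolding X'_def by simp
    qed (use W in \<open>auto simp: X'_def\<close>)
    then show "real (card (X' s)) \<le> C\<^sub>2 * W * prod_NM / (r 1 * r 2 * r 3)" using rpos
      by (simp add: pos_le_divide_eq)
  qed simp
  finally have "real (card X) * (r 1 * r 2 * r 3) \<le> real (card {0..m}) * (C\<^sub>2 * W * prod_NM)"
    using rpos by (simp add: pos_le_divide_eq)
  also have "\<dots> \<le> 2 * W * (C\<^sub>2 * W * prod_NM)"
  proof (rule mult_right_mono)
    have "1 \<le> m" "of_int m \<le> W" unfolding m_def using W by auto
    then show "real (card {0..m}) \<le> 2 * W" by simp
    show "0 \<le> C\<^sub>2 * W * prod_NM"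
      unfolding C\<^sub>2_def C\<^sub>1_def prod_NM_def using B W M_nonneg N_nonneg by (intro mult_nonneg_nonneg) auto
  qed
  finally show ?thesis .
qed

text \<open>
  One summand for each of the three regimes: the constant of the bound used there, times the \<open>p\<close>-th
  power of the constant \<open>k\<close> for which \<open>A\<^sub>i \<ge> 1 / (k x)\<close>, with \<open>x\<close> equal to \<open>\<delta> W\<close>, \<open>sqrt (\<delta> W)\<close> and \<open>1\<close>.
\<close>
definition final_constant :: "real \<Rightarrow> real" where
  "final_constant p = 125 * B^9 * (45 * B)^3 * (36960 * B^7) powr p
    + 2 * C\<^sub>2 * (148050 * B^7) powr p + C\<^sub>2 * (2 * B\<^sup>2) powr p"

lemma geom_mean3_cube:
  assumes "\<And>i. i \<in> {1,2,3} \<Longrightarrow> 0 < g i"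
  shows "0 < geom_mean3 g" "(geom_mean3 g)^3 = g 1 * g 2 * g 3"
proof -
  define x where "x = g 1 * g 2 * g 3"
  have x: "0 < x" unfolding x_def using assms by simp
  then show "0 < geom_mean3 g" unfolding geom_mean3_def x_def[symmetric] by simp
  have "(x powr (1/3))^3 = x powr (1/3 * 3)" using x
    by (simp add: powr_realpow[symmetric] powr_powr del: powr_one)
  then show "(geom_mean3 g)^3 = g 1 * g 2 * g 3" unfolding geom_mean3_def x_def[symmetric] using x by simp
qed

text \<open>
  A lower bound for all three quotients \<open>A i\<close> passes to their geometric mean \<open>A0\<close>. In the regime where
  some family is very rich, \<open>A i \<ge> 1 / (2 B\<^sup>2)\<close> follows from \<open>r i \<le> M i\<close>, \<open>M i \<lesssim> 1 / \<delta>\<close> and \<open>N i \<gtrsim> 1\<close>.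
\<close>
lemma card_X_le:
  assumes \<alpha>: "1/3 < \<alpha>" "\<alpha> \<le> 2/3" and W\<alpha>: "W = \<delta> powr (3 * \<alpha> - 2)"
    and rM: "\<And>i. i \<in> {1,2,3} \<Longrightarrow> r i \<le> M i" and M\<delta>: "\<And>i. i \<in> {1,2,3} \<Longrightarrow> M i * \<delta> \<le> 2 * B"
    and N: "\<And>i. i \<in> {1,2,3} \<Longrightarrow> 1 \<le> B * N i"
  shows "real (card X) \<le> final_constant ((4 - 6 * \<alpha>) / (3 * \<alpha> - 1))
    * (geom_mean3 N * geom_mean3 M / ((geom_mean3 r)\<^sup>2 * \<delta>)) powr ((4 - 6 * \<alpha>) / (3 * \<alpha> - 1))
    * (geom_mean3 N * geom_mean3 M / geom_mean3 r) ^ 3 * W"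
proof -
  define p where "p = (4 - 6 * \<alpha>) / (3 * \<alpha> - 1)"
  define A where "A i = N i * M i / ((r i)\<^sup>2 * \<delta>)" for i
  define A0 where "A0 = geom_mean3 N * geom_mean3 M / ((geom_mean3 r)\<^sup>2 * \<delta>)"
  define R where "R = r 1 * r 2 * r 3"
  have p: "0 \<le> p" unfolding p_def using \<alpha> by simp
  have rpos: "0 < r i" and Mpos: "0 < M i" if "i \<in> {1,2,3}" for i
    using r_ge_1[OF that] rM[OF that] by linarith+
  have Npos: "0 < N i" if "i \<in> {1,2,3}" for i
    using N[OF that] N_nonneg[OF that] by (cases "N i = 0") auto
  have gN: "0 < geom_mean3 N" "(geom_mean3 N)^3 = N 1 * N 2 * N 3"
    and gM: "0 < geom_mean3 M" "(geom_mean3 M)^3 = M 1 * M 2 * M 3"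
    and gr: "0 < geom_mean3 r" "(geom_mean3 r)^3 = r 1 * r 2 * r 3"
    by (rule geom_mean3_cube; use Npos Mpos rpos in blast)+
  have R: "0 < R" unfolding R_def using rpos by simp
  have prod_NM: "0 \<le> prod_NM" unfolding prod_NM_def using Npos Mpos by (simp add: less_imp_le)
  have C\<^sub>2: "0 \<le> C\<^sub>2" unfolding C\<^sub>2_def C\<^sub>1_def using B by simp
  have QR: "(geom_mean3 N * geom_mean3 M / geom_mean3 r) ^ 3 = prod_NM / R"
    unfolding power_divide power_mult_distrib gN(2) gM(2) gr(2) prod_NM_def R_def by simp
  have A0: "A0 ^ 3 = A 1 * A 2 * A 3"
  proof -
    have "A0 ^ 3 = ((geom_mean3 N)^3 * (geom_mean3 M)^3) / (((geom_mean3 r)^3)\<^sup>2 * \<delta>^3)"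
      unfolding A0_def power_divide power_mult_distrib by (simp flip: power_mult)
    then show ?thesis unfolding gN(2) gM(2) gr(2) A_def
      by (simp add: power_mult_distrib power3_eq_cube mult_ac)
  qed
  have A0_pos: "0 < A0" unfolding A0_def using gN(1) gM(1) gr(1) \<delta> by simp
  have A0_ge: "L powr p \<le> A0 powr p" if L: "0 < L" "\<And>i. i \<in> {1,2,3} \<Longrightarrow> L \<le> A i" for L
  proof -
    have "0 \<le> A i" if "i \<in> {1,2,3}" for i using L(1) L(2)[OF that] by linarith
    then have "L * L * L \<le> A 1 * A 2 * A 3" using L by (intro mult_mono mult_nonneg_nonneg) auto
    then have "L ^ 3 \<le> A0 ^ 3" unfolding A0 by (simp add: power3_eq_cube)
    then have "L \<le> A0" using A0_pos by (simp add: power_mono_iff L(1) less_imp_le)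
    then show ?thesis using L(1) p by (intro powr_mono2) auto
  qed
  have reduce: "1 \<le> k powr p * A0 powr p / y"
    if "0 < k" "0 < x" "\<And>i. i \<in> {1,2,3} \<Longrightarrow> (r i)\<^sup>2 * \<delta> \<le> k * x * (N i * M i)" "x powr (- p) = y" for k x y
  proof -
    have "1 / (k * x) \<le> A i" if i: "i \<in> {1,2,3}" for i
    proof -
      have "0 < (r i)\<^sup>2 * \<delta>" using rpos[OF i] \<delta> by simp
      then show ?thesis unfolding A_def
        using \<open>0 < k\<close> \<open>0 < x\<close> that(1) \<open>\<And>i. i \<in> {1,2,3} \<Longrightarrow> (r i)\<^sup>2 * \<delta> \<le> k * x * (N i * M i)\<close>[OF i]
        by (simp add: pos_divide_le_eq pos_le_divide_eq mult.commute)
    qed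
    then have "(1 / (k * x)) powr p \<le> A0 powr p" using that(1,2) by (intro A0_ge) auto
    moreover have "(1 / (k * x)) powr p = y / k powr p"
      using that(1,2) unfolding that(4)[symmetric] by (simp add: powr_divide powr_mult powr_minus field_simps)
    moreover have "0 < y" unfolding that(4)[symmetric] using that(2) by simp
    ultimately show ?thesis using that(1) by (simp add: pos_divide_le_eq pos_le_divide_eq mult.commute)
  qed
  have \<delta>W_powr: "(\<delta> * W) powr (- p) = W\<^sup>2"
  proof -
    have "\<delta> * W = \<delta> powr (3 * \<alpha> - 1)" unfolding W\<alpha> using \<delta> by (simp add: powr_mult_base)
    then have "(\<delta> * W) powr (- p) = \<delta> powr ((3 * \<alpha> - 1) * (- p))" by (simp add: powr_powr)
    also have "(3 * \<alpha> - 1) * (- p) = 2 * (3 * \<alpha> - 2)" unfolding p_def using \<alpha> by (simp add: field_simps)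
    also have "\<delta> powr (2 * (3 * \<alpha> - 2)) = W\<^sup>2" unfolding W\<alpha> mult_2 powr_add power2_eq_square ..
    finally show ?thesis .
  qed
  have sqrt_powr: "(sqrt (\<delta> * W)) powr (- p) = W"
  proof -
    have "(sqrt (\<delta> * W)) powr (- p) = ((\<delta> * W) powr (- p)) powr (1/2)"
      using \<delta> W by (simp add: powr_half_sqrt[symmetric] powr_powr)
    also have "\<dots> = W" unfolding \<delta>W_powr using W by (simp add: powr_half_sqrt)
    finally show ?thesis .
  qed
  \<comment> \<open>In each of the three regimes the bound for \<open>card X\<close> carries a power of \<open>W\<close> that \<open>A0 powr p\<close> absorbs.\<close>
  have conclude: ?thesis
    if bound: "real (card X) * R \<le> c * (y * (W * prod_NM))" and absorb: "1 \<le> k powr p * A0 powr p / y"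
      and "0 < y" and c: "0 \<le> c" "c * k powr p \<le> final_constant p" for c k y
  proof -
    have "c * (y * (W * prod_NM)) \<le> c * ((k powr p * A0 powr p) * (W * prod_NM))"
      using absorb \<open>0 < y\<close> c(1) prod_NM W
        by (intro mult_left_mono mult_right_mono) (auto simp: pos_le_divide_eq)
    also have "\<dots> = (c * k powr p) * (A0 powr p * (W * prod_NM))" by simp
    also have "\<dots> \<le> final_constant p * (A0 powr p * (W * prod_NM))"
      using c(2) prod_NM W by (intro mult_right_mono) auto
    finally have "real (card X) * R \<le> final_constant p * (A0 powr p * (W * prod_NM))" using bound by linarith
    then have "real (card X) \<le> final_constant p * (A0 powr p * (W * prod_NM)) / R" using R
      by (simp add: pos_le_divide_eq)
    then show ?thesis unfolding p_def[symmetric] A0_def[symmetric] QR by (simp add: algebra_simps)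
  qed
  have parts: "125 * B^9 * (45 * B)^3 * (36960 * B^7) powr p \<le> final_constant p"
    "2 * C\<^sub>2 * (148050 * B^7) powr p \<le> final_constant p" "C\<^sub>2 * (2 * B\<^sup>2) powr p \<le> final_constant p"
    unfolding final_constant_def using C\<^sub>2 B by simp_all
  consider (some_very_rich) i where
    "i \<in> {1,2,3}" "70 * B^5 * (N i * M i) * (2115 * B\<^sup>2 * sqrt (W / \<delta>)) < (r i)\<^sup>2"
    | (some_rich) i where "i \<in> {1,2,3}" "70 * B^5 * (N i * M i) * (528 * B\<^sup>2 * W) < (r i)\<^sup>2"
        "\<And>j. j \<in> {1,2,3} \<Longrightarrow> (r j)\<^sup>2 \<le> 70 * B^5 * (N j * M j) * (2115 * B\<^sup>2 * sqrt (W / \<delta>))"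
    | (none_rich) "\<And>j. j \<in> {1,2,3} \<Longrightarrow> (r j)\<^sup>2 \<le> 70 * B^5 * (N j * M j) * (528 * B\<^sup>2 * W)"
    by (meson not_le)
  then show ?thesis
  proof cases
    case some_very_rich
    have "1 \<le> (2 * B\<^sup>2) powr p * A0 powr p / 1"
    proof (rule reduce[of _ 1])
      fix j :: nat assume j: "j \<in> {1,2,3}"
      have "(r j)\<^sup>2 * \<delta> \<le> (M j)\<^sup>2 * \<delta>" using rM[OF j] rpos[OF j] \<delta> by (intro mult_right_mono power_mono) auto
      also have "\<dots> = M j * (M j * \<delta>)" by (simp add: power2_eq_square)
      also have "\<dots> \<le> M j * ((2 * B) * (B * N j))"
      proof (rule mult_left_mono)
        have "(2 * B) * 1 \<le> (2 * B) * (B * N j)" using N[OF j] B by (intro mult_left_mono) auto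
        then show "M j * \<delta> \<le> (2 * B) * (B * N j)" using M\<delta>[OF j] by linarith
      qed (use Mpos[OF j] in simp)
      finally show "(r j)\<^sup>2 * \<delta> \<le> 2 * B\<^sup>2 * 1 * (N j * M j)" by (simp add: power2_eq_square algebra_simps)
    qed (use B in auto)
    moreover have "real (card X) * R \<le> C\<^sub>2 * (1 * (W * prod_NM))"
      using bound_very_rich[OF some_very_rich] unfolding R_def by (simp add: mult.assoc)
    ultimately show ?thesis using conclude parts(3) C\<^sub>2 by (metis zero_less_one)
  next
    case some_rich
    have "1 \<le> (148050 * B^7) powr p * A0 powr p / W"
    proof (rule reduce[OF _ _ _ sqrt_powr])
      fix j :: nat assume j: "j \<in> {1,2,3}"
      have e1: "sqrt (W / \<delta>) * \<delta> = sqrt (\<delta> * W)"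
        using \<delta> by (simp add: real_sqrt_divide real_sqrt_mult field_simps)
      have e2: "(r j)\<^sup>2 * \<delta> \<le> 70 * B^5 * (N j * M j) * (2115 * B\<^sup>2 * sqrt (W / \<delta>)) * \<delta>"
        using some_rich(3)[OF j] \<delta> by (intro mult_right_mono) auto
      have e3: "70 * B^5 * (N j * M j) * (2115 * B\<^sup>2 * sqrt (W / \<delta>)) * \<delta>
          = 148050 * B^7 * (sqrt (W / \<delta>) * \<delta>) * (N j * M j)" by (simp add: eval_nat_numeral)
      show "(r j)\<^sup>2 * \<delta> \<le> 148050 * B^7 * sqrt (\<delta> * W) * (N j * M j)"
        using e2 unfolding e3 e1 .
    qed (use B \<delta> W in auto)
    moreover have "real (card X) * R \<le> 2 * C\<^sub>2 * (W * (W * prod_NM))"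
      using bound_rich[OF some_rich(1,2)] unfolding R_def by (simp add: algebra_simps)
    ultimately show ?thesis using conclude[of "2 * C\<^sub>2" W "148050 * B^7"] parts(2) C\<^sub>2 W by simp
  next
    case none_rich
    have "1 \<le> (36960 * B^7) powr p * A0 powr p / W\<^sup>2"
    proof (rule reduce[OF _ _ _ \<delta>W_powr])
      fix j :: nat assume j: "j \<in> {1,2,3}"
      have "(r j)\<^sup>2 * \<delta> \<le> 70 * B^5 * (N j * M j) * (528 * B\<^sup>2 * W) * \<delta>"
        using none_rich[OF j] \<delta> by (intro mult_right_mono) auto
      then show "(r j)\<^sup>2 * \<delta> \<le> 36960 * B^7 * (\<delta> * W) * (N j * M j)"
        by (simp add: eval_nat_numeral algebra_simps)
    qed (use B \<delta> W in auto)
    moreover have "real (card X) * R \<le> 125 * B^9 * (45 * B)^3 * (W\<^sup>2 * (W * prod_NM))"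
      using trilinear_bound unfolding R_def prod_NM_def by (simp add: eval_nat_numeral algebra_simps)
    ultimately show ?thesis using conclude parts(1) B W by simp
  qed
qed

end

section \<open>The geometry of plates\<close>

lemma orthogonal_unit_tangent: "orthogonal (unit_tangent t) e \<longleftrightarrow> tangent_form t e = 0"
proof -
  define d :: "real^3" where "d = axis 1 1 + (2 * t) *\<^sub>R axis 2 1 + (3 * t\<^sup>2) *\<^sub>R axis 3 1"
  have mc: "moment_curve = (\<lambda>t. t *\<^sub>R axis 1 1 + t^2 *\<^sub>R axis 2 1 + t^3 *\<^sub>R axis 3 1)"
    unfolding moment_curve_def by (auto simp: vec_eq_iff forall_3 vector_3 axis_def)
  have "(moment_curve has_vector_derivative d) (at t)"
    unfolding mc d_def by (auto intro!: derivative_eq_intros simp: has_vector_derivative_def fun_eq_iff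
      algebra_simps)
  then have ut: "unit_tangent t = sgn d" unfolding unit_tangent_def by (simp add: vector_derivative_at)
  have "d $ 1 = 1" unfolding d_def by (simp add: axis_def)
  then have "norm d \<noteq> 0" by auto
  moreover have "d \<bullet> e = tangent_form t e"
    unfolding d_def tangent_form_def by (simp add: inner_add_left inner_axis')
  ultimately show ?thesis unfolding ut orthogonal_def sgn_div_norm by simp
qed

lemma dilate_sel [simp]:
  "centre (dilate s P) = centre P" "edge1 (dilate s P) = s *\<^sub>R edge1 P"
  "edge2 (dilate s P) = s *\<^sub>R edge2 P" "edge3 (dilate s P) = s *\<^sub>R edge3 P"
  unfolding dilate_def by auto

lemma shift_x_sel [simp]:
  "centre (shift_x h P) = centre P + h *\<^sub>R axis 1 1" "edge1 (shift_x h P) = edge1 P"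
  "edge2 (shift_x h P) = edge2 P" "edge3 (shift_x h P) = edge3 P"
  unfolding shift_x_def by auto

lemma dilate_1: "dilate 1 P = P"
  unfolding dilate_def by simp

text \<open>The determinant of a matrix with orthogonal rows, by the Gram determinant.\<close>
lemma square_determinant_orthogonal:
  fixes f g h :: "real^3"
  assumes "orthogonal f g" "orthogonal f h" "orthogonal g h"
  shows "(f $ 1 * (g $ 2 * h $ 3 - g $ 3 * h $ 2) - g $ 1 * (f $ 2 * h $ 3 - f $ 3 * h $ 2)
    + h $ 1 * (f $ 2 * g $ 3 - f $ 3 * g $ 2))\<^sup>2 = (norm f * norm g * norm h)\<^sup>2"
proof -
  have o: "f $ 1 * g $ 1 + f $ 2 * g $ 2 + f $ 3 * g $ 3 = 0"
    "f $ 1 * h $ 1 + f $ 2 * h $ 2 + f $ 3 * h $ 3 = 0"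
    "g $ 1 * h $ 1 + g $ 2 * h $ 2 + g $ 3 * h $ 3 = 0"
    using assms unfolding orthogonal_def inner_vec_def by (auto simp: sum_3)
  have n: "(norm v)\<^sup>2 = (v $ 1)\<^sup>2 + (v $ 2)\<^sup>2 + (v $ 3)\<^sup>2" for v :: "real^3"
    unfolding power2_norm_eq_inner inner_vec_def by (simp add: sum_3 power2_eq_square)
  show ?thesis unfolding power_mult_distrib n using o by algebra
qed

text \<open>
  Explicit coordinates for a plate of thickness \<open>w\<close>. The entries \<open>edge1 P $ 1\<close>, \<open>edge2 P $ 2\<close>,
  \<open>edge3 P $ 2\<close> and \<open>edge3 P $ 3\<close> determine the edges, since the form of \<open>t\<close> vanishes on the two long ones.
\<close>
definition plate_form :: "real \<Rightarrow> real \<Rightarrow> real \<Rightarrow> parallelepiped \<Rightarrow> bool" where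
  "plate_form K w t P \<longleftrightarrow> 0 \<le> t \<and> t \<le> 1 \<and>
     edge1 P $ 2 = 0 \<and> edge1 P $ 3 = 0 \<and> edge2 P $ 3 = 0 \<and>
     tangent_form t (edge2 P) = 0 \<and> tangent_form t (edge3 P) = 0 \<and>
     w / K \<le> \<bar>edge1 P $ 1\<bar> \<and> \<bar>edge1 P $ 1\<bar> \<le> K * w \<and>
     1 / (3 * K) \<le> \<bar>edge2 P $ 2\<bar> \<and> \<bar>edge2 P $ 2\<bar> \<le> K \<and> \<bar>edge3 P $ 2\<bar> \<le> K \<and>
     1 / (12 * K^8) \<le> \<bar>edge3 P $ 3\<bar> \<and> \<bar>edge3 P $ 3\<bar> \<le> K"

text \<open>
  The point is the lower bound for \<open>edge3 P $ 3\<close>: the two long edges must not be nearly parallel. The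
  rectangular box comparable to \<open>P\<close> has edges \<open>f, g, h\<close> whose determinant is at least \<open>w / K\<^sup>3\<close>. As \<open>P\<close>
  contains them up to dilation, their third coordinates are \<open>O(edge3 P $ 3)\<close> and their forms
  are \<open>O(w)\<close>. The form has coefficient 1 at the first coordinate, so it may replace that
  coordinate in the determinant, which is therefore \<open>O(w \<bar>edge3 P $ 3\<bar>)\<close>.
\<close>
lemma plate_imp_plate_form:
  assumes K: "1 \<le> K" and w: "0 < w" and t: "0 \<le> t" "t \<le> 1" and P: "plate K w (unit_tangent t) P"
  shows "plate_form K w t P"
proof -
  define a b y z where "a = edge1 P $ 1" "b = edge2 P $ 2" "y = edge3 P $ 2" "z = edge3 P $ 3"
  note abyz = this
  have zeros: "edge1 P $ 2 = 0" "edge1 P $ 3 = 0" "edge2 P $ 3 = 0"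
    using P unfolding plate_def is_box_def by auto
  have T: "tangent_form t (edge2 P) = 0" "tangent_form t (edge3 P) = 0"
    using P unfolding plate_def orthogonal_unit_tangent by auto
  have dims: "norm (edge1 P) \<le> K * w" "w \<le> K * norm (edge1 P)" "norm (edge2 P) \<le> K" "1 \<le> K * norm (edge2 P)"
    "norm (edge3 P) \<le> K"
    using P unfolding plate_def is_box_def has_dims_def sim_def by auto
  have "edge1 P = a *\<^sub>R axis 1 1" unfolding abyz using zeros by (auto simp: vec_eq_iff forall_3 axis_def)
  then have n1: "norm (edge1 P) = \<bar>a\<bar>" by (simp add: norm_axis_1)
  have "edge2 P $ 1 = - 2 * t * b" using T(1) zeros(3) unfolding tangent_form_def abyz by simp
  then have "edge2 P = b *\<^sub>R (axis 2 1 - (2 * t) *\<^sub>R axis 1 1)"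
    unfolding abyz using zeros by (auto simp: vec_eq_iff forall_3 axis_def)
  then have "norm (edge2 P) = \<bar>b\<bar> * norm ((axis 2 1 :: real^3) - (2 * t) *\<^sub>R axis 1 1)" by simp
  also have "\<dots> \<le> \<bar>b\<bar> * (norm (axis 2 1 :: real^3) + norm ((2 * t) *\<^sub>R axis 1 1 :: real^3))"
    by (intro mult_left_mono norm_triangle_ineq4) auto
  also have "\<dots> \<le> \<bar>b\<bar> * 3" using t by (intro mult_left_mono) (auto simp: norm_axis_1)
  finally have "K * norm (edge2 P) \<le> K * (\<bar>b\<bar> * 3)" using K by (intro mult_left_mono) auto
  then have "1 \<le> K * (\<bar>b\<bar> * 3)" using dims(4) by linarith
  then have b_ge: "1 / (3 * K) \<le> \<bar>b\<bar>" using K by (simp add: pos_divide_le_eq algebra_simps)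
  have upper: "\<bar>b\<bar> \<le> K" "\<bar>y\<bar> \<le> K" "\<bar>z\<bar> \<le> K"
    unfolding abyz using dims component_le_norm_cart order.trans by blast+
  obtain R where R: "rectangular R" "has_dims K w 1 1 R" "points R \<subseteq> points (dilate K P)"
    using P unfolding plate_def is_box_def comparable_def by auto
  \<comment> \<open>An edge of the rectangular box is a difference of two of its points.\<close>
  have edge: "\<bar>tangent_form t f\<bar> \<le> K\<^sup>2 * w \<and> \<bar>f $ 2\<bar> \<le> 2 * K\<^sup>2 \<and> \<bar>f $ 3\<bar> \<le> K * \<bar>z\<bar>"
    if "centre R + (1/2) *\<^sub>R f \<in> points R" "centre R - (1/2) *\<^sub>R f \<in> points R" for f
  proof -
    have coords: "\<exists>x1 x2 x3. q
      = centre P + x1 *\<^sub>R (K *\<^sub>R edge1 P) + x2 *\<^sub>R (K *\<^sub>R edge2 P) + x3 *\<^sub>R (K *\<^sub>R edge3 P)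
      \<and> \<bar>x1\<bar> \<le> 1/2 \<and> \<bar>x2\<bar> \<le> 1/2 \<and> \<bar>x3\<bar> \<le> 1/2" if "q \<in> points R" for q
    proof -
      have "q \<in> points (dilate K P)" using that R(3) by blast
      then show ?thesis unfolding points_def dilate_sel by blast
    qed
    from coords[OF that(1)] coords[OF that(2)] obtain x1 x2 x3 y1 y2 y3 where
      x: "centre R + (1/2) *\<^sub>R f
        = centre P + x1 *\<^sub>R (K *\<^sub>R edge1 P) + x2 *\<^sub>R (K *\<^sub>R edge2 P) + x3 *\<^sub>R (K *\<^sub>R edge3 P)"
        "\<bar>x1\<bar> \<le> 1/2" "\<bar>x2\<bar> \<le> 1/2" "\<bar>x3\<bar> \<le> 1/2" and
      y: "centre R - (1/2) *\<^sub>R f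
        = centre P + y1 *\<^sub>R (K *\<^sub>R edge1 P) + y2 *\<^sub>R (K *\<^sub>R edge2 P) + y3 *\<^sub>R (K *\<^sub>R edge3 P)"
        "\<bar>y1\<bar> \<le> 1/2" "\<bar>y2\<bar> \<le> 1/2" "\<bar>y3\<bar> \<le> 1/2"
      by blast
    have "f = (centre R + (1/2) *\<^sub>R f) - (centre R - (1/2) *\<^sub>R f)" by (simp flip: scaleR_add_left)
    also have "\<dots> = (K * (x1 - y1)) *\<^sub>R edge1 P + (K * (x2 - y2)) *\<^sub>R edge2 P + (K * (x3 - y3)) *\<^sub>R edge3 P"
      unfolding x(1) y(1) by (simp add: algebra_simps)
    finally have f: "f = (K * (x1 - y1)) *\<^sub>R edge1 P + (K * (x2 - y2)) *\<^sub>R edge2 P + (K * (x3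
      - y3)) *\<^sub>R edge3 P" .
    have c: "\<bar>x1 - y1\<bar> \<le> 1" "\<bar>x2 - y2\<bar> \<le> 1" "\<bar>x3 - y3\<bar> \<le> 1" using x y by linarith+
    have "tangent_form t f = K * ((x1 - y1) * a)"
      unfolding f tangent_form_add tangent_form_scaleR T using zeros by (simp add: tangent_form_def abyz)
    moreover have "\<bar>(x1 - y1) * a\<bar> \<le> 1 * (K * w)" unfolding abs_mult using c dims(1) n1
      by (intro mult_mono) auto
    ultimately have f1: "\<bar>tangent_form t f\<bar> \<le> K * (K * w)" using K by (simp add: abs_mult)
    have "f $ 2 = K * ((x2 - y2) * b + (x3 - y3) * y)" unfolding f abyz using zeros
      by (simp add: algebra_simps)
    moreover have "\<bar>(x2 - y2) * b\<bar> \<le> 1 * K" "\<bar>(x3 - y3) * y\<bar> \<le> 1 * K"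
      unfolding abs_mult using c upper by (intro mult_mono; simp)+
    then have "\<bar>(x2 - y2) * b + (x3 - y3) * y\<bar> \<le> 2 * K" by linarith
    ultimately have f2: "\<bar>f $ 2\<bar> \<le> K * (2 * K)" using K by (simp add: abs_mult)
    have "f $ 3 = K * ((x3 - y3) * z)" unfolding f abyz using zeros by simp
    moreover have "\<bar>(x3 - y3) * z\<bar> \<le> 1 * \<bar>z\<bar>" unfolding abs_mult using c by (intro mult_mono) auto
    ultimately have f3: "\<bar>f $ 3\<bar> \<le> K * \<bar>z\<bar>" using K by (simp add: abs_mult)
    show ?thesis using f1 f2 f3 by (simp add: power2_eq_square)
  qed
  have inR: "centre R + x1 *\<^sub>R edge1 R + x2 *\<^sub>R edge2 R + x3 *\<^sub>R edge3 R \<in> points R"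
    if "\<bar>x1\<bar> \<le> 1/2" "\<bar>x2\<bar> \<le> 1/2" "\<bar>x3\<bar> \<le> 1/2" for x1 x2 x3
    using that unfolding points_def by blast
  define f g h where "f = edge1 R" "g = edge2 R" "h = edge3 R"
  note fgh = this
  have ef: "\<bar>tangent_form t f\<bar> \<le> K\<^sup>2 * w \<and> \<bar>f $ 2\<bar> \<le> 2 * K\<^sup>2 \<and> \<bar>f $ 3\<bar> \<le> K * \<bar>z\<bar>"
    unfolding fgh by (rule edge) (use inR[of "1/2" 0 0] inR[of "-1/2" 0 0] in auto)
  have eg: "\<bar>tangent_form t g\<bar> \<le> K\<^sup>2 * w \<and> \<bar>g $ 2\<bar> \<le> 2 * K\<^sup>2 \<and> \<bar>g $ 3\<bar> \<le> K * \<bar>z\<bar>"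
    unfolding fgh by (rule edge) (use inR[of 0 "1/2" 0] inR[of 0 "-1/2" 0] in auto)
  have eh: "\<bar>tangent_form t h\<bar> \<le> K\<^sup>2 * w \<and> \<bar>h $ 2\<bar> \<le> 2 * K\<^sup>2 \<and> \<bar>h $ 3\<bar> \<le> K * \<bar>z\<bar>"
    unfolding fgh by (rule edge) (use inR[of 0 0 "1/2"] inR[of 0 0 "-1/2"] in auto)
  define d where "d = f $ 1 * (g $ 2 * h $ 3 - g $ 3 * h $ 2) - g $ 1 * (f $ 2 * h $ 3 - f $ 3 * h $ 2)
    + h $ 1 * (f $ 2 * g $ 3 - f $ 3 * g $ 2)"
  have "d\<^sup>2 = (norm f * norm g * norm h)\<^sup>2"
    unfolding d_def by (rule square_determinant_orthogonal) (use R(1) in \<open>auto simp: rectangular_def fgh\<close>)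
  then have "\<bar>d\<bar> = norm f * norm g * norm h"
    by (metis abs_norm_cancel abs_mult power2_eq_iff_nonneg abs_ge_zero power2_abs)
  moreover have "w \<le> K * norm f" "1 \<le> K * norm g" "1 \<le> K * norm h"
    using R(2) unfolding has_dims_def sim_def fgh by auto
  then have "w * 1 * 1 \<le> (K * norm f) * (K * norm g) * (K * norm h)" using w K by (intro mult_mono) auto
  ultimately have d_ge: "w \<le> K^3 * \<bar>d\<bar>" by (simp add: power3_eq_cube algebra_simps)
  have d_eq: "d = tangent_form t f * (g $ 2 * h $ 3 - g $ 3 * h $ 2) - tangent_form t g * (f $ 2 * h $ 3
    - f $ 3 * h $ 2)
    + tangent_form t h * (f $ 2 * g $ 3 - f $ 3 * g $ 2)"
    unfolding d_def tangent_form_def by (simp add: algebra_simps)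
  have minor: "\<bar>T * (q2 * s3 - q3 * s2)\<bar> \<le> (K\<^sup>2 * w) * (2 * ((2 * K\<^sup>2) * (K * \<bar>z\<bar>)))"
    if "\<bar>T\<bar> \<le> K\<^sup>2 * w" "\<bar>q2\<bar> \<le> 2 * K\<^sup>2" "\<bar>q3\<bar> \<le> K * \<bar>z\<bar>" "\<bar>s2\<bar> \<le> 2 * K\<^sup>2" "\<bar>s3\<bar> \<le> K * \<bar>z\<bar>"
      for T q2 q3 s2 s3 :: real
  proof -
    have "\<bar>q2 * s3\<bar> \<le> (2 * K\<^sup>2) * (K * \<bar>z\<bar>)" "\<bar>s2 * q3\<bar> \<le> (2 * K\<^sup>2) * (K * \<bar>z\<bar>)"
      unfolding abs_mult using that by (intro mult_mono; simp)+
    then have "\<bar>q2 * s3 - q3 * s2\<bar> \<le> 2 * ((2 * K\<^sup>2) * (K * \<bar>z\<bar>))" by (simp add: mult.commute[of q3])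
    then show ?thesis unfolding abs_mult using that by (intro mult_mono) auto
  qed
  have "\<bar>d\<bar> \<le> 3 * ((K\<^sup>2 * w) * (2 * ((2 * K\<^sup>2) * (K * \<bar>z\<bar>))))"
  proof -
    have sum3: "\<bar>x - y + z\<bar> \<le> 3 * u" if "\<bar>x\<bar> \<le> u" "\<bar>y\<bar> \<le> u" "\<bar>z\<bar> \<le> u" for x y z u :: real
      using that by linarith
    show ?thesis unfolding d_eq by (rule sum3; rule minor) (use ef eg eh in blast)+
  qed
  then have "K^3 * \<bar>d\<bar> \<le> K^3 * (3 * ((K\<^sup>2 * w) * (2 * ((2 * K\<^sup>2) * (K * \<bar>z\<bar>)))))"
    using K by (intro mult_left_mono) auto
  then have "w * 1 \<le> w * (12 * K^8 * \<bar>z\<bar>)" using d_ge by (simp add: eval_nat_numeral algebra_simps)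
  then have "1 \<le> 12 * K^8 * \<bar>z\<bar>" using w by simp
  then have "1 / (12 * K^8) \<le> \<bar>z\<bar>" using K by (simp add: field_simps)
  moreover have "w / K \<le> \<bar>a\<bar>" using dims(2) n1 K by (simp add: field_simps)
  ultimately show ?thesis
    unfolding plate_form_def using t zeros T b_ge upper dims(1) n1 unfolding abyz by auto
qed

lemma plate_form_shift_x: "plate_form K w t P \<Longrightarrow> plate_form K w t (shift_x h P)"
  unfolding plate_form_def by simp

lemma plate_form_nonzero:
  assumes "1 \<le> K" "0 < w" "plate_form K w t P"
  shows "edge1 P $ 1 \<noteq> 0" "edge2 P $ 2 \<noteq> 0" "edge3 P $ 3 \<noteq> 0"
proof -
  have "0 < w / K" "0 < 1 / (3 * K)" "0 < 1 / (12 * K^8)" using assms by auto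
  then show "edge1 P $ 1 \<noteq> 0" "edge2 P $ 2 \<noteq> 0" "edge3 P $ 3 \<noteq> 0"
    using assms(3) unfolding plate_form_def by auto
qed

text \<open>The coordinates of a point along the three edges, made explicit.\<close>
lemma points_plate_form:
  assumes K: "1 \<le> K" and w: "0 < w" and P: "plate_form K w t P" and s: "0 < s"
  shows "p \<in> points (dilate s P) \<longleftrightarrow>
    \<bar>tangent_form t (p - centre P)\<bar> \<le> s * \<bar>edge1 P $ 1\<bar> / 2 \<and>
    \<bar>(p - centre P) $ 2 - (p - centre P) $ 3 * (edge3 P $ 2 / edge3 P $ 3)\<bar> \<le> s * \<bar>edge2 P $ 2\<bar> / 2 \<and>
    \<bar>(p - centre P) $ 3\<bar> \<le> s * \<bar>edge3 P $ 3\<bar> / 2" (is "?L \<longleftrightarrow> ?A \<and> ?B \<and> ?C")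
proof -
  define a b y z where "a = edge1 P $ 1" "b = edge2 P $ 2" "y = edge3 P $ 2" "z = edge3 P $ 3"
  note abyz = this
  note nz = plate_form_nonzero[OF K w P, folded abyz]
  have zeros: "edge1 P $ 2 = 0" "edge1 P $ 3 = 0" "edge2 P $ 3 = 0"
    and T: "tangent_form t (edge2 P) = 0" "tangent_form t (edge3 P) = 0"
    using P unfolding plate_form_def by auto
  have T1: "tangent_form t (edge1 P) = a" unfolding tangent_form_def abyz using zeros by simp
  have bound: "\<bar>x * (s * e)\<bar> \<le> s * \<bar>e\<bar> / 2 \<longleftrightarrow> \<bar>x\<bar> \<le> 1/2" if "e \<noteq> 0" for x e :: real
  proof -
    have "\<bar>x * (s * e)\<bar> = \<bar>x\<bar> * (s * \<bar>e\<bar>)" using s by (simp add: abs_mult)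
    moreover have "0 < s * \<bar>e\<bar>" using s that by simp
    ultimately show ?thesis using mult_le_cancel_right_pos[of "s * \<bar>e\<bar>" "\<bar>x\<bar>" "1/2"] by simp
  qed
  have coords: "tangent_form t v = x1 * (s * a)" "v $ 2 - v $ 3 * (y / z) = x2 * (s * b)"
    "v $ 3 = x3 * (s * z)"
    if "v = x1 *\<^sub>R (s *\<^sub>R edge1 P) + x2 *\<^sub>R (s *\<^sub>R edge2 P) + x3 *\<^sub>R (s *\<^sub>R edge3 P)" for v x1 x2 x3
    unfolding that tangent_form_add tangent_form_scaleR T T1 using zeros nz by (simp_all flip: abyz)
  show ?thesis unfolding abyz[symmetric]
  proof
    assume ?L
    then obtain x1 x2 x3 where "p
      = centre P + x1 *\<^sub>R (s *\<^sub>R edge1 P) + x2 *\<^sub>R (s *\<^sub>R edge2 P) + x3 *\<^sub>R (s *\<^sub>R edge3 P)"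
      and x: "\<bar>x1\<bar> \<le> 1/2" "\<bar>x2\<bar> \<le> 1/2" "\<bar>x3\<bar> \<le> 1/2" unfolding points_def by auto
    then have v: "p - centre P = x1 *\<^sub>R (s *\<^sub>R edge1 P) + x2 *\<^sub>R (s *\<^sub>R edge2 P) + x3 *\<^sub>R (s *\<^sub>R edge3 P)"
      by simp
    have "\<bar>tangent_form t (p - centre P)\<bar> \<le> s * \<bar>a\<bar> / 2"
      unfolding coords(1)[OF v] bound[OF nz(1)] by (rule x)
    moreover have "\<bar>(p - centre P) $ 2 - (p - centre P) $ 3 * (y / z)\<bar> \<le> s * \<bar>b\<bar> / 2"
      unfolding coords(2)[OF v] bound[OF nz(2)] by (rule x)
    moreover have "\<bar>(p - centre P) $ 3\<bar> \<le> s * \<bar>z\<bar> / 2"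
      unfolding coords(3)[OF v] bound[OF nz(3)] by (rule x)
    ultimately show "\<bar>tangent_form t (p - centre P)\<bar> \<le> s * \<bar>a\<bar> / 2 \<and>
      \<bar>(p - centre P) $ 2 - (p - centre P) $ 3 * (y / z)\<bar> \<le> s * \<bar>b\<bar> / 2 \<and> \<bar>(p - centre P) $ 3\<bar> \<le> s * \<bar>z\<bar> / 2"
      by blast
  next
    assume A: "\<bar>tangent_form t (p - centre P)\<bar> \<le> s * \<bar>a\<bar> / 2 \<and>
      \<bar>(p - centre P) $ 2 - (p - centre P) $ 3 * (y / z)\<bar> \<le> s * \<bar>b\<bar> / 2 \<and> \<bar>(p - centre P) $ 3\<bar> \<le> s * \<bar>z\<bar> / 2"
    define v where "v = p - centre P"
    define x1 x2 x3 where "x1 = tangent_form t v / (s * a)" "x2 = (v $ 2 - v $ 3 * (y / z)) / (s * b)"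
      "x3 = v $ 3 / (s * z)"
    note x = this
    define v' where "v' = x1 *\<^sub>R (s *\<^sub>R edge1 P) + x2 *\<^sub>R (s *\<^sub>R edge2 P) + x3 *\<^sub>R (s *\<^sub>R edge3 P)"
    have e: "tangent_form t v = x1 * (s * a)" "v $ 2 - v $ 3 * (y / z) = x2 * (s * b)" "v $ 3 = x3 * (s * z)"
      unfolding x using nz s by auto
    note e' = coords[OF v'_def]
    have "v $ 3 = v' $ 3" "v $ 2 = v' $ 2" using e e' by auto
    moreover from this have "v $ 1 = v' $ 1" using e(1) e'(1) unfolding tangent_form_def by simp
    ultimately have "v = v'" by (simp add: vec_eq_iff forall_3)
    then have p: "p = centre P + x1 *\<^sub>R (s *\<^sub>R edge1 P) + x2 *\<^sub>R (s *\<^sub>R edge2 P) + x3 *\<^sub>R (s *\<^sub>R edge3 P)"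
      unfolding v'_def v_def by (simp add: algebra_simps)
    have "\<bar>x1 * (s * a)\<bar> \<le> s * \<bar>a\<bar> / 2" "\<bar>x2 * (s * b)\<bar> \<le> s * \<bar>b\<bar> / 2" "\<bar>x3 * (s * z)\<bar> \<le> s * \<bar>z\<bar> / 2"
      using A[folded v_def] unfolding e(1)[symmetric] e(2)[symmetric] e(3)[symmetric] by blast+
    then have "\<bar>x1\<bar> \<le> 1/2" "\<bar>x2\<bar> \<le> 1/2" "\<bar>x3\<bar> \<le> 1/2"
      unfolding bound[OF nz(1)] bound[OF nz(2)] bound[OF nz(3)] .
    then show ?L using p unfolding points_def dilate_sel by blast
  qed
qed

lemma points_plate_form_mono:
  assumes "1 \<le> K" "0 < w" "plate_form K w t P" "0 < s" "s \<le> s'"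
  shows "points (dilate s P) \<subseteq> points (dilate s' P)"
proof
  fix p assume p: "p \<in> points (dilate s P)"
  have "s * \<bar>e\<bar> / 2 \<le> s' * \<bar>e\<bar> / 2" for e :: real
    using assms(5) by (intro divide_right_mono mult_right_mono) auto
  moreover have "0 < s'" using assms by simp
  ultimately show "p \<in> points (dilate s' P)"
    using p points_plate_form[OF assms(1-3)] assms(4) by (meson order.trans)
qed

lemma plate_form_point_bounds:
  assumes K: "1 \<le> K" and w: "0 < w" and P: "plate_form K w t P" and s: "0 < s"
    and p: "p \<in> points (dilate s P)"
  shows "\<bar>(p - centre P) $ 2\<bar> \<le> s * K" "\<bar>(p - centre P) $ 3\<bar> \<le> s * K / 2"
    "\<bar>tangent_form t (p - centre P)\<bar> \<le> s * (K * w) / 2"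
proof -
  define b y z v where "b = edge2 P $ 2" "y = edge3 P $ 2" "z = edge3 P $ 3" "v = p - centre P"
  note byzv = this
  have z: "z \<noteq> 0" using plate_form_nonzero(3)[OF K w P] unfolding byzv .
  have u: "\<bar>b\<bar> \<le> K" "\<bar>y\<bar> \<le> K" "\<bar>z\<bar> \<le> K" "\<bar>edge1 P $ 1\<bar> \<le> K * w"
    using P unfolding plate_form_def byzv by auto
  have p': "\<bar>tangent_form t v\<bar> \<le> s * \<bar>edge1 P $ 1\<bar> / 2" "\<bar>v $ 2 - v $ 3 * (y / z)\<bar> \<le> s * \<bar>b\<bar> / 2"
    "\<bar>v $ 3\<bar> \<le> s * \<bar>z\<bar> / 2"
    using p points_plate_form[OF K w P s] unfolding byzv by auto
  have m: "s * \<bar>e\<bar> \<le> s * c" if "\<bar>e\<bar> \<le> c" for e c :: real using that s by (intro mult_left_mono) auto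
  have "\<bar>v $ 3 * (y / z)\<bar> \<le> (s * \<bar>z\<bar> / 2) * \<bar>y / z\<bar>"
    unfolding abs_mult using p'(3) by (intro mult_right_mono) auto
  also have "\<dots> = s * \<bar>y\<bar> / 2" using z by (simp add: abs_divide)
  finally have "\<bar>v $ 2\<bar> \<le> s * K" using p'(2) m[OF u(1)] m[OF u(2)] by linarith
  then show "\<bar>(p - centre P) $ 2\<bar> \<le> s * K" unfolding byzv .
  show "\<bar>(p - centre P) $ 3\<bar> \<le> s * K / 2" using p'(3) m[OF u(3)] unfolding byzv by linarith
  show "\<bar>tangent_form t (p - centre P)\<bar> \<le> s * (K * w) / 2" using p'(1) m[OF u(4)] unfolding byzv by linarith
qed

text \<open>
  Replacing the parameter \<open>t\<close> of the plate by \<open>l\<close> changes the form by \<open>O(w)\<close> on vectors of bounded length.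
\<close>
lemma value_near_centre:
  assumes K: "1 \<le> K" and w: "0 < w" and P: "plate_form K w t P" and l: "0 \<le> l" "l \<le> 1" "\<bar>t - l\<bar> \<le> w"
    and p: "p \<in> points (dilate K P)"
  shows "\<bar>tangent_form l p - tangent_form l (centre P)\<bar> \<le> 6 * K\<^sup>2 * w"
proof -
  define v where "v = p - centre P"
  have t: "0 \<le> t" "t \<le> 1" using P unfolding plate_form_def by auto
  have b: "\<bar>v $ 2\<bar> \<le> K * K" "\<bar>v $ 3\<bar> \<le> K * K / 2" "\<bar>tangent_form t v\<bar> \<le> K * (K * w) / 2"
    using plate_form_point_bounds[OF K w P _ p] K unfolding v_def by auto
  have "\<bar>(l + t) * v $ 3\<bar> \<le> 2 * (K * K / 2)" unfolding abs_mult using t l b by (intro mult_mono) auto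
  then have "\<bar>3 * (l + t) * v $ 3\<bar> \<le> 3 * (K * K)" by (simp only: abs_mult mult.assoc abs_numeral)
  then have "\<bar>2 * v $ 2 + 3 * (l + t) * v $ 3\<bar> \<le> 5 * (K * K)" using b by linarith
  then have "\<bar>(l - t) * (2 * v $ 2 + 3 * (l + t) * v $ 3)\<bar> \<le> w * (5 * (K * K))"
    unfolding abs_mult using l w by (intro mult_mono) auto
  then have "\<bar>tangent_form l v\<bar> \<le> K * (K * w) / 2 + w * (5 * (K * K))"
    using b(3) tangent_form_param_diff[of l v t] by linarith
  also have "\<dots> \<le> 6 * K\<^sup>2 * w" using K w by (simp add: power2_eq_square algebra_simps)
  finally show ?thesis unfolding v_def tangent_form_diff .
qed

lemma centre_bounds:
  assumes K: "1 \<le> K" and w: "0 < w" "w \<le> 1" and P: "plate_form K w t P" and l: "0 \<le> l" "l \<le> 1" "\<bar>t - l\<bar> \<le> w"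
    and meets: "points P \<inter> unit_cube \<noteq> {}"
  shows "\<bar>centre P $ 2\<bar> \<le> 2 * K" "\<bar>centre P $ 3\<bar> \<le> 2 * K" "\<bar>tangent_form l (centre P)\<bar> \<le> 12 * K\<^sup>2"
proof -
  obtain p where p: "p \<in> points (dilate 1 P)" "p \<in> unit_cube" using meets unfolding dilate_1 by auto
  have pj: "0 \<le> p $ j" "p $ j \<le> 1" for j using p(2) by (auto simp: mem_box_cart)
  have "\<bar>(p - centre P) $ 2\<bar> \<le> 1 * K" "\<bar>(p - centre P) $ 3\<bar> \<le> 1 * K / 2"
    using plate_form_point_bounds[OF K w(1) P _ p(1)] by auto
  then show "\<bar>centre P $ 2\<bar> \<le> 2 * K" "\<bar>centre P $ 3\<bar> \<le> 2 * K" 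
    using pj[of 2] pj[of 3] K unfolding vector_minus_component by linarith+
  have "p \<in> points (dilate K P)" using p(1) points_plate_form_mono[OF K w(1) P _ K] by auto
  note value_near_centre[OF K w(1) P l this]
  also have "6 * K\<^sup>2 * w \<le> 6 * K\<^sup>2 * 1" using w by (intro mult_left_mono) auto
  finally have "\<bar>tangent_form l p - tangent_form l (centre P)\<bar> \<le> 6 * K\<^sup>2 * 1" .
  moreover have "\<bar>tangent_form l p - p $ 1\<bar> \<le> 5 * 1"
    using l pj by (intro abs_tangent_form_le) auto
  moreover have "1 \<le> K\<^sup>2" using K by simp
  ultimately show "\<bar>tangent_form l (centre P)\<bar> \<le> 12 * K\<^sup>2" using pj[of 1] by linarith
qed

lemma interior_plate_nonempty:
  assumes K: "1 \<le> K" and w: "0 < w" and P: "plate_form K w t P" and s: "0 < s"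
  shows "interior (points (dilate s P)) \<noteq> {}"
proof -
  define U where "U = {p. \<bar>tangent_form t (p - centre P)\<bar> < s * \<bar>edge1 P $ 1\<bar> / 2} \<inter>
    ({p. \<bar>(p - centre P) $ 2 - (p - centre P) $ 3 * (edge3 P $ 2 / edge3 P $ 3)\<bar> < s * \<bar>edge2 P $ 2\<bar> / 2} \<inter>
    {p. \<bar>(p - centre P) $ 3\<bar> < s * \<bar>edge3 P $ 3\<bar> / 2})"
  have "open U" unfolding U_def tangent_form_def
    by (intro open_Int open_Collect_less continuous_intros)
  moreover have "U \<subseteq> points (dilate s P)"
  proof
    fix p assume "p \<in> U"
    then show "p \<in> points (dilate s P)"
      unfolding U_def Int_iff mem_Collect_eq points_plate_form[OF K w P s] by (meson less_imp_le)
  qed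
  moreover have "centre P \<in> U"
    unfolding U_def using plate_form_nonzero[OF K w P] s by (simp add: tangent_form_def)
  ultimately have "centre P \<in> interior (points (dilate s P))" using interior_maximal by blast
  then show ?thesis by blast
qed

text \<open>
  Parameters across the plate have to agree up to \<open>h w\<close>, those along the plate up to \<open>h\<close>. The three
  coordinates of a point of \<open>P'\<close> along the edges of \<open>P\<close> then exceed those along the edges of \<open>P'\<close> by
  \<open>O(h)\<close>; the power of \<open>K\<close> comes from dividing by the short coordinates \<open>edge3 P $ 3\<close> and \<open>edge2 P $ 2\<close>.
\<close>
lemma subset_of_nearby_plate:
  assumes K: "1 \<le> K" and w: "0 < w" and P: "plate_form K w t P" and P': "plate_form K w t' P'"
    and l: "0 \<le> l" "l \<le> 1" "\<bar>t - l\<bar> \<le> w" and h: "0 \<le> h" "h \<le> 1"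
    and near: "\<bar>tangent_form l (centre P' - centre P)\<bar> \<le> h * w"
      "\<bar>(centre P' - centre P) $ 2\<bar> \<le> h" "\<bar>(centre P' - centre P) $ 3\<bar> \<le> h"
      "\<bar>edge1 P' $ 1 - edge1 P $ 1\<bar> \<le> h * w" "\<bar>edge2 P' $ 2 - edge2 P $ 2\<bar> \<le> h" "\<bar>t' - t\<bar> \<le> h * w"
      "\<bar>edge3 P' $ 2 - edge3 P $ 2\<bar> \<le> h" "\<bar>edge3 P' $ 3 - edge3 P $ 3\<bar> \<le> h"
    and s: "0 < s" "s \<le> 1"
  shows "points (dilate s P') \<subseteq> points (dilate (s + 120 * K^10 * h) P)"
proof
  fix p assume p: "p \<in> points (dilate s P')"
  define a b y z where "a = edge1 P $ 1" "b = edge2 P $ 2" "y = edge3 P $ 2" "z = edge3 P $ 3"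
  define a' b' y' z' where "a' = edge1 P' $ 1" "b' = edge2 P' $ 2" "y' = edge3 P' $ 2" "z' = edge3 P' $ 3"
  note abyz = \<open>a = _\<close> \<open>b = _\<close> \<open>y = _\<close> \<open>z = _\<close> \<open>a' = _\<close> \<open>b' = _\<close> \<open>y' = _\<close> \<open>z' = _\<close>
  define v c where "v = p - centre P'" "c = centre P' - centre P"
  note vc = this
  define H where "H = 120 * K^10 * h"
  have H: "0 \<le> H" unfolding H_def using K h by simp
  have pv: "p - centre P = v + c" unfolding vc by simp
  have t: "0 \<le> t" "t \<le> 1" "0 \<le> t'" "t' \<le> 1" using P P' unfolding plate_form_def by auto
  have size: "w / K \<le> \<bar>a\<bar>" "1 / (3 * K) \<le> \<bar>b\<bar>" "1 / (12 * K^8) \<le> \<bar>z\<bar>" "\<bar>y\<bar> \<le> K"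
    using P unfolding plate_form_def abyz by auto
  have nz: "z \<noteq> 0" "z' \<noteq> 0" using plate_form_nonzero(3)[OF K w P] plate_form_nonzero(3)[OF K w P']
    unfolding abyz by auto
  have v: "\<bar>tangent_form t' v\<bar> \<le> s * \<bar>a'\<bar> / 2" "\<bar>v $ 2 - v $ 3 * (y' / z')\<bar> \<le> s * \<bar>b'\<bar> / 2"
    "\<bar>v $ 3\<bar> \<le> s * \<bar>z'\<bar> / 2"
    using p points_plate_form[OF K w P' s(1)] unfolding abyz vc by auto
  have sK: "s * K \<le> K" using s K by (simp add: mult_le_cancel_right1)
  have vb: "\<bar>v $ 2\<bar> \<le> K" "\<bar>v $ 3\<bar> \<le> K / 2"
    using plate_form_point_bounds[OF K w P' s(1) p] sK unfolding vc by linarith+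
  have near': "\<bar>a'\<bar> \<le> \<bar>a\<bar> + h * w" "\<bar>b'\<bar> \<le> \<bar>b\<bar> + h" "\<bar>z'\<bar> \<le> \<bar>z\<bar> + h"
    using near(4) near(5) near(8) unfolding abyz by linarith+
  have sx: "s * (x + e) \<le> s * x + e" if "0 \<le> e" for x e :: real
    using s that mult_left_le_one_le[of e s] by (simp add: distrib_left)
  have sm: "s * x \<le> s * x'" if "x \<le> x'" for x x' :: real using that s by simp
  have powers: "K^8 \<le> K^10" "K^2 \<le> K^10" using K by (auto intro: power_increasing)
  have Hz: "3 * h \<le> H * \<bar>z\<bar>"
  proof -
    have "3 * h \<le> (120 * K^8 * h) * (1 / (12 * K^8))" using K h by simp
    also have "\<dots> \<le> H * \<bar>z\<bar>" unfolding H_def using size(3) K h powers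
      by (intro mult_mono) auto
    finally show ?thesis .
  qed
  have Hb: "40 * K^9 * h \<le> H * \<bar>b\<bar>"
  proof -
    have "40 * K^9 * h = (120 * K^10 * h) * (1 / (3 * K))" using K by (simp add: field_simps eval_nat_numeral)
    also have "\<dots> \<le> H * \<bar>b\<bar>" unfolding H_def using size(2) K h by (intro mult_left_mono) auto
    finally show ?thesis .
  qed
  have Ha: "30 * K * (h * w) \<le> H * \<bar>a\<bar>"
  proof -
    have "30 * K * (h * w) = (30 * K^2 * h) * (w / K)" using K by (simp add: field_simps power2_eq_square)
    also have "\<dots> \<le> (120 * K^10 * h) * \<bar>a\<bar>" using size(1) K h w powers by (intro mult_mono) auto
    finally show ?thesis unfolding H_def .
  qed
  have third: "\<bar>(v + c) $ 3\<bar> \<le> (s + H) * \<bar>z\<bar> / 2"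
  proof -
    have "s * \<bar>z'\<bar> \<le> s * \<bar>z\<bar> + h" using sm[OF near'(3)] sx[of h "\<bar>z\<bar>"] h by linarith
    moreover have "\<bar>c $ 3\<bar> \<le> h" using near(3) unfolding vc .
    moreover have "(v + c) $ 3 = v $ 3 + c $ 3" by simp
    ultimately have "\<bar>(v + c) $ 3\<bar> \<le> s * \<bar>z\<bar> / 2 + 3 * h / 2" using v(3) by linarith
    then show ?thesis using Hz by (simp add: distrib_right)
  qed
  have second: "\<bar>(v + c) $ 2 - (v + c) $ 3 * (y / z)\<bar> \<le> (s + H) * \<bar>b\<bar> / 2"
  proof -
    have eq: "(v + c) $ 2 - (v + c) $ 3 * (y / z) =
        (v $ 2 - v $ 3 * (y' / z')) + v $ 3 * (y' / z' - y / z) + c $ 2 - c $ 3 * (y / z)"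
      by (simp add: algebra_simps)
    have sum4: "\<bar>x1 + x2 + x3 - x4\<bar> \<le> u1 + u2 + u3 + u4"
      if "\<bar>x1\<bar> \<le> u1" "\<bar>x2\<bar> \<le> u2" "\<bar>x3\<bar> \<le> u3" "\<bar>x4\<bar> \<le> u4" for x1 x2 x3 x4 u1 u2 u3 u4 :: real
      using that by linarith
    have iz: "1 / \<bar>z\<bar> \<le> 12 * K^8" using size(3) K nz by (simp add: field_simps)
    have "\<bar>y / z\<bar> = \<bar>y\<bar> * (1 / \<bar>z\<bar>)" by (simp add: abs_divide)
    also have "\<dots> \<le> K * (12 * K^8)" using size(4) iz K by (intro mult_mono) auto
    finally have yz: "\<bar>y / z\<bar> \<le> 12 * K^9" by (simp add: eval_nat_numeral algebra_simps)
    have "\<bar>v $ 3 * (y' / z' - y / z)\<bar> \<le> h / 2 + 6 * K^9 * h"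
    proof -
      have "y' / z' - y / z = ((y' - y) - (z' - z) * (y / z)) / z'" using nz by (simp add: field_simps)
      then have "\<bar>v $ 3 * (y' / z' - y / z)\<bar> = \<bar>v $ 3\<bar> / \<bar>z'\<bar> * \<bar>(y' - y) - (z' - z) * (y / z)\<bar>"
        by (simp add: abs_mult abs_divide)
      also have "\<dots> \<le> (1 / 2) * (h + h * (12 * K^9))"
      proof (intro mult_mono)
        have "s * \<bar>z'\<bar> \<le> 1 * \<bar>z'\<bar>" using s by (intro mult_right_mono) auto
        then have "\<bar>v $ 3\<bar> * 2 \<le> \<bar>z'\<bar>" using v(3) by linarith
        then show "\<bar>v $ 3\<bar> / \<bar>z'\<bar> \<le> 1 / 2" using nz by (simp add: pos_divide_le_eq)
        have "\<bar>(z' - z) * (y / z)\<bar> \<le> h * (12 * K^9)"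
          unfolding abs_mult using near(8) yz h unfolding abyz by (intro mult_mono) auto
        then show "\<bar>(y' - y) - (z' - z) * (y / z)\<bar> \<le> h + h * (12 * K^9)" using near(7) unfolding abyz
          by linarith
      qed auto
      also have "\<dots> \<le> h / 2 + 6 * K^9 * h" using h by simp
      finally show ?thesis .
    qed
    moreover have "\<bar>c $ 3 * (y / z)\<bar> \<le> h * (12 * K^9)"
      unfolding abs_mult using near(3) yz h unfolding vc by (intro mult_mono) auto
    moreover have "\<bar>c $ 2\<bar> \<le> h" using near(2) unfolding vc .
    moreover have "s * \<bar>b'\<bar> \<le> s * \<bar>b\<bar> + h" using sm[OF near'(2)] sx[of h "\<bar>b\<bar>"] h by linarith
    ultimately have "\<bar>(v + c) $ 2 - (v + c) $ 3 * (y / z)\<bar>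
        \<le> (s * \<bar>b\<bar> + h) / 2 + (h / 2 + 6 * K^9 * h) + h + h * (12 * K^9)"
      unfolding eq using v(2) sum4 by (meson divide_right_mono order.trans zero_le_numeral)
    moreover have "1 * h \<le> K^9 * h" using K h by (intro mult_right_mono) auto
    ultimately have "\<bar>(v + c) $ 2 - (v + c) $ 3 * (y / z)\<bar> \<le> s * \<bar>b\<bar> / 2 + 40 * K^9 * h / 2"
      by argo
    then show ?thesis using Hb unfolding distrib_right by argo
  qed
  have first: "\<bar>tangent_form t (v + c)\<bar> \<le> (s + H) * \<bar>a\<bar> / 2"
  proof -
    have hw0: "0 \<le> h * w" using h w by simp
    have hw: "0 \<le> h * w" "h * w \<le> K * (h * w)" using hw0 mult_right_mono[OF K hw0] by simp_all
    have "\<bar>(t + t') * v $ 3\<bar> \<le> 2 * (K / 2)" unfolding abs_mult using t vb by (intro mult_mono) auto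
    then have "\<bar>3 * (t + t') * v $ 3\<bar> \<le> 3 * K" by (simp only: abs_mult mult.assoc abs_numeral)
    then have "\<bar>2 * v $ 2 + 3 * (t + t') * v $ 3\<bar> \<le> 5 * K" using vb by linarith
    then have "\<bar>(t - t') * (2 * v $ 2 + 3 * (t + t') * v $ 3)\<bar> \<le> (h * w) * (5 * K)"
      unfolding abs_mult using near(6) hw by (intro mult_mono) auto
    then have "\<bar>tangent_form t v - tangent_form t' v\<bar> \<le> 5 * (K * (h * w))"
      unfolding tangent_form_param_diff by (simp add: mult.commute mult.left_commute)
    moreover have "\<bar>tangent_form t c\<bar> \<le> 9 * (h * w)"
    proof -
      have "\<bar>(t + l) * c $ 3\<bar> \<le> 2 * h" unfolding abs_mult using t l near(3) unfolding vc
        by (intro mult_mono) auto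
      then have "\<bar>3 * (t + l) * c $ 3\<bar> \<le> 6 * h" by (simp only: abs_mult mult.assoc abs_numeral)
      then have "\<bar>2 * c $ 2 + 3 * (t + l) * c $ 3\<bar> \<le> 8 * h" using near(2) unfolding vc by linarith
      then have "\<bar>(t - l) * (2 * c $ 2 + 3 * (t + l) * c $ 3)\<bar> \<le> w * (8 * h)"
        unfolding abs_mult using l w by (intro mult_mono) auto
      then have "\<bar>tangent_form t c - tangent_form l c\<bar> \<le> w * (8 * h)" unfolding tangent_form_param_diff .
      moreover have "\<bar>tangent_form l c\<bar> \<le> h * w" using near(1) unfolding vc .
      moreover have "w * (8 * h) = 8 * (h * w)" by simp
      ultimately show ?thesis by linarith
    qed
    moreover have "s * \<bar>a'\<bar> \<le> s * \<bar>a\<bar> + h * w" using sm[OF near'(1)] sx[of "h * w" "\<bar>a\<bar>"] hw by linarith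
    ultimately have "\<bar>tangent_form t (v + c)\<bar> \<le> s * \<bar>a\<bar> / 2 + 30 * (K * (h * w)) / 2"
      using v(1) hw unfolding tangent_form_add by linarith
    then show ?thesis using Ha by (simp add: distrib_right)
  qed
  have "0 < s + H" using s H by simp
  from points_plate_form[OF K w P this, of p] first second third
  show "p \<in> points (dilate (s + 120 * K^10 * h) P)" unfolding pv abyz H_def by blast
qed

text \<open>The pigeonhole principle: round the \<open>n\<close> parameters to multiples of \<open>h\<close>.\<close>
lemma card_le_of_separated_parameters:
  fixes f :: "'a \<Rightarrow> real list" and b h :: real
  assumes h: "0 < h" and len: "\<And>x. x \<in> F \<Longrightarrow> length (f x) = n"
    and bounded: "\<And>x i. x \<in> F \<Longrightarrow> i < n \<Longrightarrow> \<bar>f x ! i\<bar> \<le> b"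
    and separated: "\<And>x y. x \<in> F \<Longrightarrow> y \<in> F \<Longrightarrow> (\<And>i. i < n \<Longrightarrow> \<bar>f x ! i - f y ! i\<bar> \<le> h) \<Longrightarrow> x = y"
  shows "finite F" "card F \<le> card {-\<lceil>b / h\<rceil>..\<lceil>b / h\<rceil>} ^ n"
proof -
  define g where "g x = map (\<lambda>u. \<lfloor>u / h\<rfloor>) (f x)" for x
  have inj: "inj_on g F"
  proof (rule inj_onI)
    fix x y assume xy: "x \<in> F" "y \<in> F" "g x = g y"
    show "x = y"
    proof (rule separated[OF xy(1,2)])
      fix i assume i: "i < n"
      have "g x ! i = \<lfloor>f x ! i / h\<rfloor>" "g y ! i = \<lfloor>f y ! i / h\<rfloor>"
        using i len[OF xy(1)] len[OF xy(2)] unfolding g_def by simp_all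
      then have "\<lfloor>f x ! i / h\<rfloor> = \<lfloor>f y ! i / h\<rfloor>" using xy(3) by simp
      then have "\<bar>f x ! i / h - f y ! i / h\<bar> \<le> 1" by linarith
      then show "\<bar>f x ! i - f y ! i\<bar> \<le> h"
        using h by (simp add: diff_divide_distrib[symmetric] pos_divide_le_eq)
    qed
  qed
  have sub: "g ` F \<subseteq> {us. set us \<subseteq> {-\<lceil>b / h\<rceil>..\<lceil>b / h\<rceil>} \<and> length us = n}"
  proof
    fix us assume "us \<in> g ` F"
    then obtain x where x: "x \<in> F" "us = g x" by auto
    have "\<lfloor>f x ! i / h\<rfloor> \<in> {-\<lceil>b / h\<rceil>..\<lceil>b / h\<rceil>}" if "i < n" for i
    proof -
      have "\<bar>f x ! i / h\<bar> \<le> b / h" using bounded[OF x(1) that] h by (simp add: abs_divide divide_right_mono)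
      then show ?thesis unfolding atLeastAtMost_iff by linarith
    qed
    then show "us \<in> {us. set us \<subseteq> {-\<lceil>b / h\<rceil>..\<lceil>b / h\<rceil>} \<and> length us = n}"
      using x len[OF x(1)] unfolding g_def by (auto simp: in_set_conv_nth)
  qed
  have fin: "finite {us. set us \<subseteq> {-\<lceil>b / h\<rceil>..\<lceil>b / h\<rceil>} \<and> length us = n}" by (rule finite_lists_length_eq) simp
  have card: "card {us. set us \<subseteq> {-\<lceil>b / h\<rceil>..\<lceil>b / h\<rceil>} \<and> length us = n} = card {-\<lceil>b / h\<rceil>..\<lceil>b / h\<rceil>} ^ n"
    by (rule card_lists_length_eq) simp
  show "finite F" using finite_imageD[OF finite_subset[OF sub fin] inj] .
  show "card F \<le> card {-\<lceil>b / h\<rceil>..\<lceil>b / h\<rceil>} ^ n"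
    using card_mono[OF fin sub] unfolding card_image[OF inj] card .
qed

text \<open>
  The number of cells of side \<open>\<eta> / (120 K\<^sup>1\<^sup>0)\<close> that meet the cube \<open>{-b..b}\<^sup>8\<close> of normalised parameters of
  plates, up to rounding.
\<close>
definition plate_number :: "real \<Rightarrow> real \<Rightarrow> real \<Rightarrow> nat" where
  "plate_number K b \<eta> = (let h = \<eta> / (120 * K^10) in card {-\<lceil>b / h\<rceil>..\<lceil>b / h\<rceil>} ^ 8)"

text \<open>
  Plates are described by eight normalised parameters. The position and size across the plate and the
  offset of its parameter \<open>t\<close> are measured in units of \<open>w\<close>, so that the bound does not depend on \<open>w\<close>.
\<close>
lemma card_distinct_plates_le:
  assumes K: "1 \<le> K" and w: "0 < w" and l: "0 \<le> l" "l \<le> 1" and \<eta>: "0 < \<eta>" "\<eta> \<le> 1" and b: "2 * K \<le> b"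
    and F: "\<And>P. P \<in> F \<Longrightarrow> \<exists>t. \<bar>t - l\<bar> \<le> w \<and> plate_form K w t P"
      "\<And>P. P \<in> F \<Longrightarrow> \<bar>centre P $ 2\<bar> \<le> 2 * K" "\<And>P. P \<in> F \<Longrightarrow> \<bar>centre P $ 3\<bar> \<le> 2 * K"
      "\<And>P. P \<in> F \<Longrightarrow> \<bar>tangent_form l (centre P) - u\<bar> \<le> b * w"
    and distinct: "\<And>P P'. P \<in> F \<Longrightarrow> P' \<in> F \<Longrightarrow>
      (\<And>s. 0 < s \<Longrightarrow> s \<le> 1 \<Longrightarrow> points (dilate s P') \<subseteq> points (dilate (s + \<eta>) P)) \<Longrightarrow>
      (\<And>s. 0 < s \<Longrightarrow> s \<le> 1 \<Longrightarrow> points (dilate s P) \<subseteq> points (dilate (s + \<eta>) P')) \<Longrightarrow> P = P'"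
  shows "finite F" "card F \<le> plate_number K b \<eta>"
proof -
  define h where "h = \<eta> / (120 * K^10)"
  have h: "0 < h" "120 * K^10 * h = \<eta>" unfolding h_def using \<eta> K by auto
  have "\<eta> * 1 \<le> 1 * (120 * K^10)" using \<eta> K
    by (intro mult_mono) (auto intro: order.trans[OF _ mult_left_mono[of 1]])
  then have h1: "h \<le> 1" unfolding h_def using K by (simp add: divide_le_eq)
  obtain t where t: "\<And>P. P \<in> F \<Longrightarrow> \<bar>t P - l\<bar> \<le> w" "\<And>P. P \<in> F \<Longrightarrow> plate_form K w (t P) P" using F(1) by metis
  define f where "f P = [(tangent_form l (centre P) - u) / w, centre P $ 2, centre P $ 3, edge1 P $ 1 / w,
    edge2 P $ 2, (t P - l) / w, edge3 P $ 2, edge3 P $ 3]" for P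
  have less8: "(\<forall>i<8. prod_NM i) \<longleftrightarrow> prod_NM 0 \<and> prod_NM 1 \<and> prod_NM 2 \<and> prod_NM 3 \<and> prod_NM 4 \<and> prod_NM 5
    \<and> prod_NM 6 \<and> prod_NM 7" for prod_NM :: "nat \<Rightarrow> bool"
    by (simp add: eval_nat_numeral less_Suc_eq all_conj_distrib)
  have dw: "\<bar>x / w\<bar> \<le> c \<longleftrightarrow> \<bar>x\<bar> \<le> c * w" for x c using w by (simp add: abs_divide pos_divide_le_eq)
  have len: "length (f P) = 8" for P unfolding f_def by simp
  have bounded: "\<bar>f P ! i\<bar> \<le> b" if P: "P \<in> F" and i: "i < 8" for P i
  proof -
    have "K * w \<le> b * w" "1 * w \<le> b * w" using b K w by (intro mult_right_mono; simp)+
    then have "\<forall>i<8. \<bar>f P ! i\<bar> \<le> b"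
      unfolding less8 f_def using F(2-4)[OF P] t[OF P] b K dw unfolding plate_form_def by (simp add: dw)
    then show ?thesis using i by blast
  qed
  have sep: "P = P'" if P: "P \<in> F" "P' \<in> F" and c: "\<And>i. i < 8 \<Longrightarrow> \<bar>f P ! i - f P' ! i\<bar> \<le> h" for P P'
  proof -
    have "\<forall>i<8. \<bar>f P ! i - f P' ! i\<bar> \<le> h" using c by blast
    then have c': "\<bar>tangent_form l (centre P) - tangent_form l (centre P')\<bar> \<le> h * w"
      "\<bar>centre P $ 2 - centre P' $ 2\<bar> \<le> h" "\<bar>centre P $ 3 - centre P' $ 3\<bar> \<le> h"
      "\<bar>edge1 P $ 1 - edge1 P' $ 1\<bar> \<le> h * w" "\<bar>edge2 P $ 2 - edge2 P' $ 2\<bar> \<le> h" "\<bar>t P - t P'\<bar> \<le> h * w"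
      "\<bar>edge3 P $ 2 - edge3 P' $ 2\<bar> \<le> h" "\<bar>edge3 P $ 3 - edge3 P' $ 3\<bar> \<le> h"
      unfolding less8 f_def
      by (auto simp: pos_divide_le_eq[OF w] abs_of_pos[OF w] simp flip: diff_divide_distrib)
    show ?thesis
    proof (rule distinct[OF P])
      fix s :: real assume s: "0 < s" "s \<le> 1"
      show "points (dilate s P') \<subseteq> points (dilate (s + \<eta>) P)"
        using subset_of_nearby_plate[OF K w t(2)[OF P(1)] t(2)[OF P(2)] l t(1)[OF P(1)] _ h1 _ _ _ _ _ _
          _ _ s] c' h
        by (simp add: tangent_form_diff abs_minus_commute)
      show "points (dilate s P) \<subseteq> points (dilate (s + \<eta>) P')"
        using subset_of_nearby_plate[OF K w t(2)[OF P(2)] t(2)[OF P(1)] l t(1)[OF P(2)] _ h1 _ _ _ _ _ _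
          _ _ s] c' h
        by (simp add: tangent_form_diff abs_minus_commute)
    qed
  qed
  show "finite F" "card F \<le> plate_number K b \<eta>"
    unfolding plate_number_def Let_def h_def[symmetric]
    by (rule card_le_of_separated_parameters[OF h(1) len bounded sep]; assumption)+
qed

section \<open>From the geometric hypotheses to the incidence problem\<close>

definition cube_at :: "real \<Rightarrow> real^3 \<Rightarrow> (real^3) set" where
  "cube_at \<delta> p = {x. \<forall>j. p $ j \<le> x $ j \<and> x $ j < p $ j + \<delta>}"

text \<open>The left end point determines the interval and serves as its parameter.\<close>
lemma interval_left_end:
  assumes "0 < \<delta>" "I \<in> intervals \<delta> a b"
  shows "\<exists>n::int. Inf I = a + of_int n * \<delta>" "a \<le> Inf I" "Inf I < b" "I = {Inf I .. min (Inf I + \<delta>) b}"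
proof -
  obtain k :: nat where k: "I = {a + real k * \<delta> .. min (a + (real k + 1) * \<delta>) b}" "a + real k * \<delta> < b"
    using assms(2) unfolding intervals_def by blast
  have e: "a + (real k + 1) * \<delta> = (a + real k * \<delta>) + \<delta>" by (simp add: algebra_simps)
  then have i: "Inf I = a + real k * \<delta>" unfolding k using k(2) assms(1) by (intro cInf_atLeastAtMost) auto
  then show "\<exists>n::int. Inf I = a + of_int n * \<delta>" by (metis of_int_of_nat_eq)
  show "a \<le> Inf I" "Inf I < b" "I = {Inf I .. min (Inf I + \<delta>) b}"
    unfolding i using k e assms(1) by auto
qed

lemma moment_plate_form:
  assumes K: "1 \<le> K" and \<delta>: "0 < \<delta>" "\<delta> \<le> w" and I: "I \<in> intervals \<delta> a b" "0 \<le> a" "b \<le> 1"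
    and P: "moment_plate K w I P"
  obtains t where "\<bar>t - Inf I\<bar> \<le> w" "plate_form K w t P"
proof -
  obtain t where t: "t \<in> I" "plate K w (unit_tangent t) P" using P unfolding moment_plate_def by blast
  note e = interval_left_end[OF \<delta>(1) I(1)]
  have "Inf I \<le> t" "t \<le> Inf I + \<delta>" "t \<le> b" using t(1) e(4) by (metis atLeastAtMost_iff min.bounded_iff)+
  then show ?thesis using that[of t] plate_imp_plate_form[OF K _ _ _ t(2)] \<delta> e(2) I by auto
qed

lemma centre_in_points: "0 \<le> s \<Longrightarrow> centre P \<in> points (dilate s P)"
  unfolding points_def by (auto intro!: exI[of _ 0])

text \<open>
  The hypotheses on a single interval \<open>I\<close>, from which the axioms of \<open>plate_incidences\<close> about \<open>I\<close> follow.
\<close>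
locale plates_in_direction =
  fixes K D \<delta> W a b :: real and I :: "real set" and S :: "parallelepiped set"
  assumes K: "1 \<le> K" and D: "1 < D" and \<delta>: "0 < \<delta>" and W: "1 \<le> W" and \<delta>W: "\<delta> * W \<le> 1"
    and I: "I \<in> intervals \<delta> a b" "0 \<le> a" "b \<le> 1" and finite_S: "finite S"
begin

abbreviation value_of :: "parallelepiped \<Rightarrow> real" where
  "value_of P \<equiv> tangent_form (Inf I) (centre P)"

lemma scales: "\<delta> \<le> 1 / W" "0 < 1 / W" "1 / W \<le> 1" "\<delta> \<le> 1"
proof -
  show s: "\<delta> \<le> 1 / W" "0 < 1 / W" "1 / W \<le> 1" using \<delta>W W by (auto simp: pos_le_divide_eq)
  then show "\<delta> \<le> 1" by linarith
qed

lemma left_end: "0 \<le> Inf I" "Inf I \<le> 1"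
  using interval_left_end[OF \<delta> I(1)] I by auto

lemma form_of:
  assumes "moment_plate K w I P" "\<delta> \<le> w"
  shows "\<exists>t. \<bar>t - Inf I\<bar> \<le> w \<and> plate_form K w t P"
  using moment_plate_form[OF K \<delta> assms(2) I assms(1)] by blast

lemma centre_of:
  assumes "moment_plate K w I P" "\<delta> \<le> w" "w \<le> 1"
  shows "\<bar>centre P $ 2\<bar> \<le> 2 * K" "\<bar>centre P $ 3\<bar> \<le> 2 * K" "\<bar>value_of P\<bar> \<le> 12 * K\<^sup>2"
proof -
  obtain t where "\<bar>t - Inf I\<bar> \<le> w" "plate_form K w t P" using form_of[OF assms(1,2)] by blast
  moreover have "points P \<inter> unit_cube \<noteq> {}" using assms(1) unfolding moment_plate_def by blast
  ultimately show "\<bar>centre P $ 2\<bar> \<le> 2 * K" "\<bar>centre P $ 3\<bar> \<le> 2 * K" "\<bar>value_of P\<bar> \<le> 12 * K\<^sup>2"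
    using centre_bounds[OF K _ assms(3) _ left_end] \<delta> assms(2) by auto
qed

lemma contained_value:
  assumes "moment_plate K w I P" "\<delta> \<le> w" "contained K A P" "p \<in> A"
  shows "\<bar>tangent_form (Inf I) p - value_of P\<bar> \<le> 6 * K\<^sup>2 * w"
proof -
  obtain t where t: "\<bar>t - Inf I\<bar> \<le> w" "plate_form K w t P" using form_of[OF assms(1,2)] by blast
  have "p \<in> points (dilate K P)" using assms(3,4) unfolding contained_def by blast
  then show ?thesis using value_near_centre[OF K _ t(2) left_end t(1)] \<delta> assms(2) by simp
qed

text \<open>
  With \<open>\<eta> = 1 - 1/D\<close>, plates with nearly equal parameters are comparable with constant \<open>D\<close>: the scales
  \<open>s = 1\<close> and \<open>s = 1/D\<close> give the two inclusions, as \<open>1 + \<eta> \<le> D\<close> and \<open>1/D + \<eta> = 1\<close>.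
\<close>
lemma card_plates_through_le:
  assumes ed: "essentially_distinct D (associated K \<delta> S I)" and p: "p \<in> A"
  shows "card {P \<in> associated K \<delta> S I. contained K A P} \<le> plate_number K (7 * K\<^sup>2) (1 - 1 / D)"
proof (rule card_distinct_plates_le(2)[OF K \<delta> left_end])
  have "2 * K \<le> 2 * K\<^sup>2" using K by (simp add: power2_eq_square mult_le_cancel_left1)
  then show "2 * K \<le> 7 * K\<^sup>2" using zero_le_power2[of K] by linarith
  show "0 < 1 - 1 / D" "1 - 1 / D \<le> 1" using D by auto
next
  fix P assume "P \<in> {P \<in> associated K \<delta> S I. contained K A P}"
  then have P: "moment_plate K \<delta> I P" "contained K A P" unfolding associated_def by auto
  show "\<exists>t. \<bar>t - Inf I\<bar> \<le> \<delta> \<and> plate_form K \<delta> t P" using form_of[OF P(1)] by simp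
  show "\<bar>centre P $ 2\<bar> \<le> 2 * K" "\<bar>centre P $ 3\<bar> \<le> 2 * K" using centre_of[OF P(1)] scales by auto
  have "6 * K\<^sup>2 * \<delta> \<le> 7 * K\<^sup>2 * \<delta>" using \<delta> by simp
  then show "\<bar>value_of P - tangent_form (Inf I) p\<bar> \<le> 7 * K\<^sup>2 * \<delta>"
    using contained_value[OF P(1) _ P(2) p] by (simp add: abs_minus_commute)
next
  fix P P' assume P: "P \<in> {P \<in> associated K \<delta> S I. contained K A P}"
    "P' \<in> {P \<in> associated K \<delta> S I. contained K A P}"
    and near: "\<And>s. 0 < s \<Longrightarrow> s \<le> 1 \<Longrightarrow> points (dilate s P') \<subseteq> points (dilate (s + (1 - 1 / D)) P)"
      "\<And>s. 0 < s \<Longrightarrow> s \<le> 1 \<Longrightarrow> points (dilate s P) \<subseteq> points (dilate (s + (1 - 1 / D)) P')"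
  obtain t where t: "plate_form K \<delta> t P" using P(1) form_of unfolding associated_def by blast
  have "points (dilate (1 / D) P) \<subseteq> points (dilate (1 / D + (1 - 1 / D)) P')"
    using D by (intro near(2)) auto
  then have 1: "points (dilate (1 / D) P) \<subseteq> points P'" by (simp add: dilate_1)
  have "0 \<le> (D - 1)\<^sup>2 / D" using D by simp
  also have "(D - 1)\<^sup>2 / D = D - (1 + (1 - 1 / D))" using D by (simp add: field_simps power2_eq_square)
  finally have "1 + (1 - 1 / D) \<le> D" by simp
  moreover have "1 / D < 1" using D by simp
  then have "0 < 1 + (1 - 1 / D)" by linarith
  ultimately have "points (dilate (1 + (1 - 1 / D)) P) \<subseteq> points (dilate D P)"
    by (intro points_plate_form_mono[OF K \<delta> t])
  then have 2: "points P' \<subseteq> points (dilate D P)" using near(1)[of 1] by (simp add: dilate_1)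
  have "comparable D P P'" unfolding comparable_def using 1 2 by blast
  then show "P = P'" using ed P unfolding essentially_distinct_def by blast
qed

lemma uniform_N_nonneg:
  assumes unif: "uniform_plates K (1 / W) I N (associated K \<delta> S I)"
  shows "0 \<le> N" and "associated K \<delta> S I \<noteq> {} \<Longrightarrow> 1 \<le> K * N"
proof -
  obtain T where T: "plate_tiling K (1 / W) I T"
    "\<And>P. P \<in> associated K \<delta> S I \<Longrightarrow> \<exists>\<Sigma>\<in>T. contained K (points P) \<Sigma>"
    "\<And>\<Sigma>. \<Sigma> \<in> T \<Longrightarrow> sim K (real (card {P \<in> associated K \<delta> S I. contained K (points P) \<Sigma>})) N"
    using unif unfolding uniform_plates_def by blast
  have KN: "real (card {P \<in> associated K \<delta> S I. contained K (points P) \<Sigma>}) \<le> K * N" if "\<Sigma> \<in> T" for \<Sigma>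
    using T(3)[OF that] unfolding sim_def by blast
  have "(0 :: real^3) \<in> unit_cube" by (simp add: mem_box_cart)
  then obtain \<Sigma> where "\<Sigma> \<in> T" using T(1) unfolding plate_tiling_def by blast
  then have "0 \<le> K * N" using order.trans[OF of_nat_0_le_iff KN] by blast
  then show "0 \<le> N" using K by (simp add: zero_le_mult_iff)
  show "1 \<le> K * N" if nonempty: "associated K \<delta> S I \<noteq> {}"
  proof -
    obtain P where P: "P \<in> associated K \<delta> S I" using nonempty by blast
    obtain \<Sigma> where \<Sigma>: "\<Sigma> \<in> T" "contained K (points P) \<Sigma>" using T(2)[OF P] by blast
    have "finite {P \<in> associated K \<delta> S I. contained K (points P) \<Sigma>}" using finite_S
      unfolding associated_def by auto
    moreover have "P \<in> {P \<in> associated K \<delta> S I. contained K (points P) \<Sigma>}" using P \<Sigma> by blast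
    ultimately have "0 < card {P \<in> associated K \<delta> S I. contained K (points P) \<Sigma>}" using card_gt_0_iff by blast
    then show ?thesis using KN[OF \<Sigma>(1)] by linarith
  qed
qed

text \<open>
  The plates in the slab lie in tiles whose values are near \<open>u\<close>. Two tiles with nearly equal parameters
  would both contain the half-size copy of one of them, against disjointness of the interiors.
\<close>
lemma card_fat_slab_le:
  assumes unif: "uniform_plates K (1 / W) I N (associated K \<delta> S I)"
  shows "real (card {P \<in> associated K \<delta> S I. \<bar>value_of P - u\<bar> \<le> 1 / W})
    \<le> real (plate_number K (7 * K\<^sup>2) (1/2)) * (K * N)"
proof -
  obtain T where T: "plate_tiling K (1 / W) I T"
    "\<And>P. P \<in> associated K \<delta> S I \<Longrightarrow> \<exists>\<Sigma>\<in>T. contained K (points P) \<Sigma>"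
    "\<And>\<Sigma>. \<Sigma> \<in> T \<Longrightarrow> sim K (real (card {P \<in> associated K \<delta> S I. contained K (points P) \<Sigma>})) N"
    using unif unfolding uniform_plates_def by blast
  have Tp: "moment_plate K (1 / W) I \<Sigma>" if "\<Sigma> \<in> T" for \<Sigma> using T(1) that unfolding plate_tiling_def by blast
  define T' where "T' = {\<Sigma> \<in> T. \<bar>value_of \<Sigma> - u\<bar> \<le> 7 * K\<^sup>2 * (1 / W)}"
  have T': "finite T'" "card T' \<le> plate_number K (7 * K\<^sup>2) (1/2)"
  proof -
    have "2 * K \<le> 2 * K\<^sup>2" using K by (simp add: power2_eq_square mult_le_cancel_left1)
    then have b: "2 * K \<le> 7 * K\<^sup>2" using zero_le_power2[of K] by linarith
    have sep: "\<Sigma> = \<Sigma>'" if \<Sigma>: "\<Sigma> \<in> T'" "\<Sigma>' \<in> T'"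
      and near: "\<And>s. 0 < s \<Longrightarrow> s \<le> 1 \<Longrightarrow> points (dilate s \<Sigma>') \<subseteq> points (dilate (s + 1/2) \<Sigma>)" for \<Sigma> \<Sigma>'
    proof (rule ccontr)
      assume "\<Sigma> \<noteq> \<Sigma>'"
      then have disj: "interior (points \<Sigma>) \<inter> interior (points \<Sigma>') = {}"
        using T(1) \<Sigma> unfolding plate_tiling_def T'_def by blast
      obtain t where t: "plate_form K (1 / W) t \<Sigma>'" using form_of[OF Tp] scales \<Sigma> unfolding T'_def by blast
      have "points (dilate (1/2) \<Sigma>') \<subseteq> points (dilate (1/2 + 1/2) \<Sigma>)" by (rule near) auto
      moreover have "points (dilate (1/2) \<Sigma>') \<subseteq> points (dilate 1 \<Sigma>')"
        by (rule points_plate_form_mono[OF K scales(2) t]) auto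
      ultimately have "interior (points (dilate (1/2) \<Sigma>')) \<subseteq> interior (points \<Sigma>) \<inter> interior (points \<Sigma>')"
        by (simp add: dilate_1 interior_mono)
      moreover have "interior (points (dilate (1/2) \<Sigma>')) \<noteq> {}"
        by (rule interior_plate_nonempty[OF K scales(2) t]) simp
      ultimately show False using disj by blast
    qed
    have "finite T' \<and> card T' \<le> plate_number K (7 * K\<^sup>2) (1/2)"
    proof (intro conjI; rule card_distinct_plates_le[OF K scales(2) left_end _ _ b, where
      u = u and \<eta> = "1/2" and F = T'])
      show "\<And>P. P \<in> T' \<Longrightarrow> \<exists>t. \<bar>t - Inf I\<bar> \<le> 1 / W \<and> plate_form K (1 / W) t P"
        "\<And>P. P \<in> T' \<Longrightarrow> \<exists>t. \<bar>t - Inf I\<bar> \<le> 1 / W \<and> plate_form K (1 / W) t P"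
        using form_of[OF Tp] scales unfolding T'_def by blast+
    qed (use centre_of[OF Tp] scales sep in \<open>auto simp: T'_def\<close>)
    then show "finite T'" "card T' \<le> plate_number K (7 * K\<^sup>2) (1/2)" by auto
  qed
  have KN: "real (card {P \<in> associated K \<delta> S I. contained K (points P) \<Sigma>}) \<le> K * N" if "\<Sigma> \<in> T" for \<Sigma>
    using T(3)[OF that] unfolding sim_def by blast
  have "{P \<in> associated K \<delta> S I. \<bar>value_of P - u\<bar> \<le> 1 / W}
      \<subseteq> (\<Union>\<Sigma>\<in>T'. {P \<in> associated K \<delta> S I. contained K (points P) \<Sigma>})"
  proof
    fix P assume P: "P \<in> {P \<in> associated K \<delta> S I. \<bar>value_of P - u\<bar> \<le> 1 / W}"
    then obtain \<Sigma> where \<Sigma>: "\<Sigma> \<in> T" "contained K (points P) \<Sigma>" using T(2) by blast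
    have "centre P \<in> points P" using centre_in_points[of 1 P] by (simp add: dilate_1)
    then have "\<bar>value_of P - value_of \<Sigma>\<bar> \<le> 6 * K\<^sup>2 * (1 / W)"
      using contained_value[OF Tp[OF \<Sigma>(1)] scales(1) \<Sigma>(2)] by blast
    moreover have "1 * (1 / W) \<le> K\<^sup>2 * (1 / W)" using K scales(2) by (intro mult_right_mono) auto
    moreover have "\<bar>value_of P - u\<bar> \<le> 1 / W" using P by blast
    ultimately have "\<bar>value_of \<Sigma> - u\<bar> \<le> 7 * (K\<^sup>2 * (1 / W))" by linarith
    then show "P \<in> (\<Union>\<Sigma>\<in>T'. {P \<in> associated K \<delta> S I. contained K (points P) \<Sigma>})"
      using P \<Sigma> unfolding T'_def by (auto simp: mult.assoc)
  qed
  then have "real (card {P \<in> associated K \<delta> S I. \<bar>value_of P - u\<bar> \<le> 1 / W})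
      \<le> real (card (\<Union>\<Sigma>\<in>T'. {P \<in> associated K \<delta> S I. contained K (points P) \<Sigma>}))"
    using finite_S T'(1) by (intro of_nat_mono card_mono) (auto simp: associated_def)
  also have "\<dots> \<le> real (card T') * (K * N)"
    using T'(1) KN unfolding T'_def by (intro real_card_UN_le) auto
  also have "\<dots> \<le> real (plate_number K (7 * K\<^sup>2) (1/2)) * (K * N)"
    using T'(2) uniform_N_nonneg(1)[OF unif] K by (intro mult_right_mono) auto
  finally show ?thesis .
qed

text \<open>
  Let \<open>q\<close> be a point of \<open>P\<close> in the unit cube. Shifts along the x axis that keep \<open>q\<close> in the cube move the
  value of the form over \<open>[\<beta>, \<beta> + 1]\<close>, which contains an integer \<open>j \<le> 6\<close>, as \<open>0 \<le> \<beta> \<le> 5\<close>.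
\<close>
lemma periodic_representative:
  assumes per: "periodic_x K (1 / W) (associated K \<delta> S I)" and P: "P \<in> associated K \<delta> S I"
  shows "\<exists>P'\<in>associated K \<delta> S I. (\<exists>k::int. \<bar>value_of P' - value_of P - of_int k / W\<bar> \<le> 6 * K\<^sup>2 * \<delta>) \<and>
    (\<exists>j::nat. j \<le> 6 \<and> \<bar>value_of P' - real j\<bar> \<le> 13 * K\<^sup>2 / W)"
proof -
  define l where "l = Inf I"
  have mp: "moment_plate K \<delta> I P" using P unfolding associated_def by blast
  obtain t where t: "\<bar>t - l\<bar> \<le> \<delta>" "plate_form K \<delta> t P" using form_of[OF mp] unfolding l_def by blast
  obtain q where q: "q \<in> points P" "q \<in> unit_cube" using mp unfolding moment_plate_def by blast
  have qj: "0 \<le> q $ j" "q $ j \<le> 1" for j using q(2) by (auto simp: mem_box_cart)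
  define x \<beta> where "x = q $ 1" "\<beta> = tangent_form l q - q $ 1"
  note x\<beta> = this
  have l: "0 \<le> l" "l \<le> 1" using left_end unfolding l_def by auto
  have "0 \<le> \<beta>" unfolding x\<beta> tangent_form_def using l qj by simp
  have "\<beta> \<le> 5" using abs_tangent_form_le[OF l, of q 1] qj[of 2] qj[of 3] unfolding x\<beta> by auto
  define j where "j = nat \<lceil>\<beta>\<rceil>"
  have j: "\<beta> \<le> real j" "real j \<le> \<beta> + 1" "j \<le> 6"
    unfolding j_def using \<open>0 \<le> \<beta>\<close> \<open>\<beta> \<le> 5\<close> by linarith+
  \<comment> \<open>Move \<open>q\<close> along the x axis in steps of \<open>1/W\<close>, inside the cube, until the form nearly equals \<open>j\<close>.\<close>
  define s where "s = real j - \<beta>"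
  have "\<exists>k::int. 0 \<le> x + of_int k / W \<and> x + of_int k / W \<le> 1 \<and> \<bar>x + of_int k / W - s\<bar> \<le> 1 / W"
  proof -
    have s: "0 \<le> s" "s \<le> 1" "0 \<le> x" "x \<le> 1" unfolding s_def x\<beta>(1) using j qj[of 1] by auto
    have W0: "0 < W" using W by simp
    have fl: "of_int \<lfloor>y * W\<rfloor> / W \<le> y" "y - 1 / W \<le> of_int \<lfloor>y * W\<rfloor> / W" "0 \<le> y \<Longrightarrow> 0 \<le> of_int \<lfloor>y * W\<rfloor> / W" for y
    proof -
      have "of_int \<lfloor>y * W\<rfloor> \<le> y * W" "y * W - 1 \<le> of_int \<lfloor>y * W\<rfloor>" by linarith+
      then have "of_int \<lfloor>y * W\<rfloor> / W \<le> y * W / W" "(y * W - 1) / W \<le> of_int \<lfloor>y * W\<rfloor> / W"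
        using W0 by (intro divide_right_mono; simp)+
      then show "of_int \<lfloor>y * W\<rfloor> / W \<le> y" "y - 1 / W \<le> of_int \<lfloor>y * W\<rfloor> / W"
        using W0 by (simp_all add: diff_divide_distrib)
      show "0 \<le> of_int \<lfloor>y * W\<rfloor> / W" if "0 \<le> y" using that W0 by simp
    qed
    show ?thesis
    proof (cases "x \<le> s")
      case True
      then show ?thesis using fl[of "s - x"] s by (intro exI[of _ "\<lfloor>(s - x) * W\<rfloor>"]) linarith
    next
      case False
      have e: "of_int (- \<lfloor>(x - s) * W\<rfloor>) / W = - (of_int \<lfloor>(x - s) * W\<rfloor> / W)" by simp
      show ?thesis using False fl[of "x - s"] s unfolding e
        by (intro exI[of _ "- \<lfloor>(x - s) * W\<rfloor>"]) (unfold e, linarith)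
    qed
  qed
  then obtain k :: int where k: "0 \<le> x + of_int k / W" "x + of_int k / W \<le> 1"
    "\<bar>x + of_int k / W - s\<bar> \<le> 1 / W" by blast
  define h where "h = of_int k * (1 / W)"
  have h: "of_int k / W = h" unfolding h_def by simp
  define q' where "q' = q + h *\<^sub>R axis 1 1"
  have tf_axis: "tangent_form l (u + h *\<^sub>R axis 1 1) = tangent_form l u + h" for u
    unfolding tangent_form_def by (simp add: axis_def)
  have q'_shift: "q' \<in> points (shift_x h P)"
    using q(1) unfolding points_def q'_def by (auto simp: algebra_simps)
  have "q' \<in> unit_cube"
    using k(1,2) qj unfolding q'_def mem_box_cart forall_3 by (simp add: axis_def x\<beta>(1) h)
  then have "points (shift_x (of_int k * (1 / W)) P) \<inter> unit_cube \<noteq> {}" using q'_shift unfolding h_def by blast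
  then obtain P' where P': "P' \<in> associated K \<delta> S I" "comparable K (shift_x h P) P'"
    using per P unfolding periodic_x_def h_def by blast
  have pf: "plate_form K \<delta> t (shift_x h P)" by (rule plate_form_shift_x[OF t(2)])
  have near: "\<bar>tangent_form l u - tangent_form l (centre (shift_x h P))\<bar> \<le> 6 * K\<^sup>2 * \<delta>"
    if "u \<in> points (dilate K (shift_x h P))" for u
    by (rule value_near_centre[OF K \<delta> pf l t(1) that])
  have "centre P' \<in> points P'" using centre_in_points[of 1 P'] by (simp add: dilate_1)
  then have "centre P' \<in> points (dilate K (shift_x h P))" using P'(2) unfolding comparable_def by blast
  note c' = near[OF this, simplified shift_x_sel tf_axis]
  have "q' \<in> points (dilate K (shift_x h P))"
    using q'_shift points_plate_form_mono[OF K \<delta> pf _ K] dilate_1[of "shift_x h P"] by auto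
  note q'' = near[OF this, simplified shift_x_sel tf_axis]
  have "tangent_form l q' = \<beta> + (x + h)" unfolding q'_def tf_axis x\<beta> by simp
  then have "\<bar>tangent_form l q' - real j\<bar> \<le> 1 / W" using k(3) unfolding s_def h by simp
  then have "\<bar>tangent_form l (centre P') - real j\<bar> \<le> 12 * (K\<^sup>2 * \<delta>) + 1 / W" using c' q'' by linarith
  moreover have "K\<^sup>2 * \<delta> \<le> K\<^sup>2 * (1 / W)" using scales(1) by (intro mult_left_mono) auto
  moreover have "1 * (1 / W) \<le> K\<^sup>2 * (1 / W)" using K scales(2) by (intro mult_right_mono) auto
  ultimately have "\<bar>tangent_form l (centre P') - real j\<bar> \<le> 13 * (K\<^sup>2 * (1 / W))" by linarith
  then have "\<bar>value_of P' - real j\<bar> \<le> 13 * K\<^sup>2 / W" unfolding l_def by simp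
  moreover have "\<bar>value_of P' - value_of P - of_int k / W\<bar> \<le> 6 * K\<^sup>2 * \<delta>"
    using c' unfolding h l_def by (simp add: diff_diff_eq)
  ultimately show ?thesis using P'(1) j(3) by blast
qed

end

section \<open>The bound for rich cubes\<close>

definition incidence_constant :: "real \<Rightarrow> real \<Rightarrow> real" where
  "incidence_constant K D = 13 * K\<^sup>2 + K * real (plate_number K (7 * K\<^sup>2) (1/2))
    + real (plate_number K (7 * K\<^sup>2) (1 - 1 / D))"

text \<open>
  The cubes are represented by their corners, which lie on the lattice of mesh \<open>\<delta>\<close>. A nonempty set of
  rich cubes makes some \<open>S I\<close> nonempty in each family, whence \<open>N i \<ge> 1 / K\<close>.
\<close>
lemma rich_cubes_bound:
  fixes \<delta> W \<alpha> K D :: real and \<I> :: "nat \<Rightarrow> real set set" and M N r :: "nat \<Rightarrow> real"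
  assumes \<alpha>: "1/3 < \<alpha>" "\<alpha> \<le> 2/3" and K: "1 \<le> K" and D: "1 < D"
    and \<delta>: "0 < \<delta>" "\<delta> < 1" and W\<alpha>: "W = \<delta> powr (3 * \<alpha> - 2)" and finite_S: "finite S"
    and I1: "\<I> 1 \<subseteq> intervals \<delta> 0 (1/6)" and I2: "\<I> 2 \<subseteq> intervals \<delta> (1/3) (1/2)"
    and I3: "\<I> 3 \<subseteq> intervals \<delta> (2/3) 1"
    and card_I: "\<And>i. i \<in> {1,2,3} \<Longrightarrow> sim K (real (card (\<I> i))) (M i)"
    and ed: "\<And>i I. i \<in> {1,2,3} \<Longrightarrow> I \<in> \<I> i \<Longrightarrow> essentially_distinct D (associated K \<delta> S I)"
    and per: "\<And>i I. i \<in> {1,2,3} \<Longrightarrow> I \<in> \<I> i \<Longrightarrow> periodic_x K (1 / W) (associated K \<delta> S I)"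
    and unif: "\<And>i I. i \<in> {1,2,3} \<Longrightarrow> I \<in> \<I> i \<Longrightarrow> uniform_plates K (1 / W) I (N i) (associated K \<delta> S I)"
    and r: "\<And>i. i \<in> {1,2,3} \<Longrightarrow> 1 \<le> r i \<and> r i \<le> M i"
    and nonempty: "rich_cubes K \<delta> (\<lambda>i. \<Union>I \<in> \<I> i. associated K \<delta> S I) r \<noteq> {}"
  shows "real (card (rich_cubes K \<delta> (\<lambda>i. \<Union>I \<in> \<I> i. associated K \<delta> S I) r))
    \<le> plate_incidences.final_constant (incidence_constant K D) ((4 - 6 * \<alpha>) / (3 * \<alpha> - 1))
      * (geom_mean3 N * geom_mean3 M / ((geom_mean3 r)\<^sup>2 * \<delta>)) powr ((4 - 6 * \<alpha>) / (3 * \<alpha> - 1))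
      * (geom_mean3 N * geom_mean3 M / geom_mean3 r) ^ 3 * W"
proof -
  define B where "B = incidence_constant K D"
  define cubes where "cubes = rich_cubes K \<delta> (\<lambda>i. \<Union>I \<in> \<I> i. associated K \<delta> S I) r"
  define X where "X = {p. (\<forall>j. (\<exists>n::nat. p $ j = real n * \<delta>) \<and> p $ j < 1) \<and> cube_at \<delta> p \<in> cubes}"
  define a b where "a i = (if i = 1 then 0 else if i = 2 then 1/3 else 2/3 :: real)"
    and "b i = (if i = 1 then 1/6 else if i = 2 then 1/2 else 1 :: real)" for i :: nat
  have W: "1 \<le> W" unfolding W\<alpha> using \<delta> \<alpha> powr_mono'[of "3 * \<alpha> - 2" 0 \<delta>] by simp
  have "\<delta> * W = \<delta> powr (3 * \<alpha> - 1)" unfolding W\<alpha> using \<delta> by (simp add: powr_mult_base)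
  then have \<delta>W: "\<delta> * W \<le> 1" using \<delta> \<alpha> powr_mono'[of 0 "3 * \<alpha> - 1" \<delta>] by simp
  have ab: "0 \<le> a i" "b i \<le> 1" "a i \<le> b i" for i unfolding a_def b_def by auto
  have I: "I \<in> intervals \<delta> (a i) (b i)" if "i \<in> {1,2,3}" "I \<in> \<I> i" for i I
    using that I1 I2 I3 unfolding a_def b_def by auto
  have dir: "plates_in_direction K D \<delta> W (a i) (b i) I S" if "i \<in> {1,2,3}" "I \<in> \<I> i" for i I
    using K D \<delta> W \<delta>W I[OF that] ab[of i] finite_S by unfold_locales auto
  have K2: "1 \<le> K\<^sup>2" "K \<le> K\<^sup>2" using K
    by (simp add: one_le_power, simp add: power2_eq_square mult_le_cancel_left1)
  have nums: "0 \<le> K * real (plate_number K (7 * K\<^sup>2) (1/2))" using K by simp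
  have B_ge: "13 * K\<^sup>2 \<le> B" "K * real (plate_number K (7 * K\<^sup>2) (1/2)) \<le> B"
    "real (plate_number K (7 * K\<^sup>2) (1 - 1 / D)) \<le> B"
    unfolding B_def incidence_constant_def using nums K2 by linarith+
  have BK: "1 \<le> B" "K \<le> B" using B_ge K2 by linarith+
  have corners: "cubes \<subseteq> cube_at \<delta> ` X"
  proof
    fix q assume q: "q \<in> cubes"
    then obtain k :: "3 \<Rightarrow> nat" where k: "q = {p. \<forall>j. real (k j) * \<delta> \<le> p $ j \<and> p $ j < (real (k j) + 1) * \<delta>}"
      "\<forall>j. real (k j) * \<delta> < 1" unfolding cubes_def rich_cubes_def delta_cubes_def by blast
    define p :: "real^3" where "p = (\<chi> j. real (k j) * \<delta>)"
    have "q = cube_at \<delta> p" unfolding k(1) cube_at_def p_def by (simp add: distrib_right)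
    moreover from this have "p \<in> X" using q k(2) unfolding X_def p_def by auto
    ultimately show "q \<in> cube_at \<delta> ` X" by blast
  qed
  have X_unit: "0 \<le> p $ j \<and> p $ j \<le> 1" if "p \<in> X" for p j
    using that \<delta> unfolding X_def
      by (auto simp: less_imp_le) (metis mult_nonneg_nonneg less_imp_le of_nat_0_le_iff)
  have X_lattice: "\<exists>n::int. p $ j = of_int n * \<delta>" if pX: "p \<in> X" for p j
  proof -
    obtain n :: nat where "p $ j = real n * \<delta>" using pX unfolding X_def by blast
    then have "p $ j = of_int (int n) * \<delta>" by simp
    then show ?thesis by blast
  qed
  have finite_X: "finite X"
  proof (rule card_lattice_cluster_le(1)[OF \<delta>(1), of "1 / \<delta>"])
    fix p p' j assume "p \<in> X" "p' \<in> X"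
    then show "\<bar>p $ j - p' $ j\<bar> \<le> 1 / \<delta> * \<delta>" using X_unit[of p j] X_unit[of p' j] \<delta> by auto
  qed (use \<delta> X_lattice in auto)
  have p_in: "p \<in> cube_at \<delta> p" for p unfolding cube_at_def using \<delta> by simp
  have left: "\<exists>n::int. Inf I = a i + of_int n * \<delta>" "a i \<le> Inf I" "Inf I < b i"
    "I = {Inf I .. min (Inf I + \<delta>) (b i)}"
    if "i \<in> {1,2,3}" "I \<in> \<I> i" for i I
    using interval_left_end[OF \<delta>(1) I[OF that]] by blast+
  have inj: "inj_on Inf (\<I> i)" if "i \<in> {1,2,3}" for i
    by (rule inj_onI) (metis left(4)[OF that])
  have card_le: "finite (\<I> i) \<and> real (card (\<I> i)) \<le> 2 / \<delta>" if i: "i \<in> {1,2,3}" for i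
  proof -
    have grid: "\<exists>n::int. x = a i + of_int n * \<delta>" if "x \<in> Inf ` \<I> i" for x using that left(1)[OF i] by auto
    have near: "\<bar>x - y\<bar> \<le> 1" if xy: "x \<in> Inf ` \<I> i" "y \<in> Inf ` \<I> i" for x y
    proof -
      have "0 \<le> x \<and> x \<le> 1" if "x \<in> Inf ` \<I> i" for x
        using that left(2,3)[OF i] ab[of i] by fastforce
      then show ?thesis using xy by (smt (verit))
    qed
    have g: "finite (Inf ` \<I> i)" "real (card (Inf ` \<I> i)) \<le> 1 / \<delta> + 1"
      by (rule card_grid_le[OF \<delta>(1) _ grid near]; simp)+
    have "1 / \<delta> + 1 \<le> 2 / \<delta>" using \<delta> by (simp add: field_simps)
    then show ?thesis using g inj[OF i] finite_imageD card_image by (metis order.trans)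
  qed
  interpret plate_incidences \<delta> W B X \<I> Inf a "associated K \<delta> S" "\<lambda>I P. tangent_form (Inf I) (centre P)"
    "\<lambda>P p. contained K (cube_at \<delta> p) P" M N r
  proof
    fix I assume "I \<in> \<I> 1" then show "0 \<le> Inf I \<and> Inf I \<le> 1/6" using left(2,3)[of 1 I]
      unfolding a_def b_def by auto
  next
    fix I assume "I \<in> \<I> 2" then show "1/3 \<le> Inf I \<and> Inf I \<le> 1/2" using left(2,3)[of 2 I]
      unfolding a_def b_def by auto
  next
    fix I assume "I \<in> \<I> 3" then show "2/3 \<le> Inf I \<and> Inf I \<le> 1" using left(2,3)[of 3 I]
      unfolding a_def b_def by auto
  next
    fix i :: nat assume i: "i \<in> {1,2,3}"
    show "finite (\<I> i)" using card_le[OF i] by blast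
    show "inj_on Inf (\<I> i)" by (rule inj[OF i])
    have "0 \<le> M i" "real (card (\<I> i)) \<le> K * M i" using r[OF i] card_I[OF i] unfolding sim_def by auto
    then show "real (card (\<I> i)) \<le> B * M i" using mult_right_mono[OF BK(2), of "M i"] by linarith
    show "1 \<le> r i" using r[OF i] by blast
    have "M i \<le> K * real (card (\<I> i))" "1 \<le> M i" using r[OF i] card_I[OF i] unfolding sim_def by auto
    then have "\<I> i \<noteq> {}" by auto
    then obtain I where "I \<in> \<I> i" by blast
    then show "0 \<le> N i"
      using plates_in_direction.uniform_N_nonneg(1)[OF dir[OF i] unif[OF i]] by blast
  next
    fix i :: nat and I assume iI: "i \<in> {1,2,3}" "I \<in> \<I> i"
    interpret d: plates_in_direction K D \<delta> W "a i" "b i" I S by (rule dir[OF iI])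
    show "\<exists>n::int. Inf I = a i + of_int n * \<delta>" by (rule left(1)[OF iI])
    show "finite (associated K \<delta> S I)" using finite_S unfolding associated_def by simp
    show "real (card {P \<in> associated K \<delta> S I. \<bar>tangent_form (Inf I) (centre P) - u\<bar> \<le> 1 / W}) \<le> B * N i" for u
    proof -
      have "real (plate_number K (7 * K\<^sup>2) (1/2)) * (K * N i) \<le> B * N i"
        using mult_right_mono[OF B_ge(2) d.uniform_N_nonneg(1)[OF unif[OF iI]]] by (simp add: mult_ac)
      then show ?thesis using d.card_fat_slab_le[OF unif[OF iI], of u] by linarith
    qed
    show "real (card {P \<in> associated K \<delta> S I. contained K (cube_at \<delta> p) P}) \<le> B" for p
      using of_nat_mono[OF d.card_plates_through_le[OF ed[OF iI] p_in], where 'a = real] B_ge(3)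
        by (rule order.trans)
  next
    fix i :: nat and I P assume iI: "i \<in> {1,2,3}" "I \<in> \<I> i" and P: "P \<in> associated K \<delta> S I"
    interpret d: plates_in_direction K D \<delta> W "a i" "b i" I S by (rule dir[OF iI])
    have mp: "moment_plate K \<delta> I P" using P unfolding associated_def by blast
    have bounds: "12 * K\<^sup>2 \<le> B" "6 * K\<^sup>2 * \<delta> \<le> B * \<delta>" "13 * K\<^sup>2 / W \<le> B / W"
      using B_ge(1) K2 \<delta> W by (auto intro!: mult_right_mono divide_right_mono)
    show "\<bar>tangent_form (Inf I) (centre P)\<bar> \<le> B"
      using d.centre_of(3)[OF mp] d.scales bounds(1) by simp
    show "\<bar>tangent_form (Inf I) p - tangent_form (Inf I) (centre P)\<bar> \<le> B * \<delta>"
      if "contained K (cube_at \<delta> p) P" for p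
      using d.contained_value[OF mp order.refl that p_in] bounds(2) by linarith
    obtain P' k j where "P' \<in> associated K \<delta> S I"
      "\<bar>tangent_form (Inf I) (centre P') - tangent_form (Inf I) (centre P) - of_int k / W\<bar> \<le> 6 * K\<^sup>2 * \<delta>"
      "j \<le> (6::nat)" "\<bar>tangent_form (Inf I) (centre P') - real j\<bar> \<le> 13 * K\<^sup>2 / W"
      using d.periodic_representative[OF per[OF iI] P] by blast
    then show "\<exists>P'\<in>associated K \<delta> S I.
        (\<exists>k::int. \<bar>tangent_form (Inf I) (centre P') - tangent_form (Inf I) (centre P) - of_int k / W\<bar>
          \<le> B * \<delta>) \<and>
        (\<exists>l::nat. l \<le> 6 \<and> \<bar>tangent_form (Inf I) (centre P') - real l\<bar> \<le> B / W)"
      using bounds by (meson order.trans)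
  next
    fix i :: nat and p assume i: "i \<in> {1,2,3}" and p: "p \<in> X"
    have "cube_at \<delta> p \<in> cubes" using p unfolding X_def by blast
    then have "r i \<le> real (card {P \<in> (\<Union>I \<in> \<I> i. associated K \<delta> S I). contained K (cube_at \<delta> p) P})"
      using i unfolding cubes_def rich_cubes_def by auto
    also have "{P \<in> (\<Union>I \<in> \<I> i. associated K \<delta> S I). contained K (cube_at \<delta> p) P}
        = (\<Union>I \<in> \<I> i. {P \<in> associated K \<delta> S I. contained K (cube_at \<delta> p) P})" by blast
    also have "real (card (\<Union>I \<in> \<I> i. {P \<in> associated K \<delta> S I. contained K (cube_at \<delta> p) P}))
        \<le> real (\<Sum>I\<in>\<I> i. card {P \<in> associated K \<delta> S I. contained K (cube_at \<delta> p) P})"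
      using card_le[OF i] by (intro of_nat_mono card_UN_le) blast
    finally show "r i \<le> real (\<Sum>I\<in>\<I> i. card {P \<in> associated K \<delta> S I. contained K (cube_at \<delta> p) P})" .
  qed (use \<delta> W \<delta>W BK finite_X X_unit X_lattice in auto)
  have "cubes \<noteq> {}" using nonempty unfolding cubes_def .
  then obtain p where p: "p \<in> X" using corners by blast
  have N_ge: "1 \<le> B * N i" if i: "i \<in> {1,2,3}" for i
  proof -
    have "0 < (\<Sum>I\<in>\<I> i. card {P \<in> associated K \<delta> S I. contained K (cube_at \<delta> p) P})"
      using rich[OF i p] r_ge_1[OF i] by linarith
    then obtain I where "I \<in> \<I> i" "card {P \<in> associated K \<delta> S I. contained K (cube_at \<delta> p) P} \<noteq> 0"
      by (metis (no_types, lifting) less_numeral_extra(3) sum.neutral)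
    then have I: "I \<in> \<I> i" "associated K \<delta> S I \<noteq> {}" by auto
    have "1 \<le> K * N i" using plates_in_direction.uniform_N_nonneg(2)[OF dir[OF i I(1)] unif[OF i I(1)] I(2)] .
    then show ?thesis using mult_right_mono[OF BK(2) N_nonneg[OF i]] by linarith
  qed
  have M_le: "M i * \<delta> \<le> 2 * B" if i: "i \<in> {1,2,3}" for i
  proof -
    have "M i \<le> K * real (card (\<I> i))" using card_I[OF i] unfolding sim_def by blast
    also have "\<dots> \<le> B * (2 / \<delta>)" using card_le[OF i] K BK by (intro mult_mono) auto
    finally have "M i * \<delta> \<le> B * (2 / \<delta>) * \<delta>" using \<delta> by (intro mult_right_mono) auto
    then show ?thesis using \<delta> by simp
  qed
  have "card cubes \<le> card (cube_at \<delta> ` X)" using corners finite_X by (intro card_mono) auto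
  also have "\<dots> \<le> card X" by (rule card_image_le[OF finite_X])
  finally have "real (card cubes) \<le> real (card X)" by simp
  also note card_X_le[OF \<alpha> W\<alpha> _ M_le N_ge]
  finally show ?thesis using r unfolding cubes_def B_def by blast
qed

theorem theorem6p6:
  fixes \<alpha> \<epsilon> K D :: real
  assumes "1/3 < \<alpha>" and "\<alpha> \<le> 2/3" and "\<epsilon> > 0" and "K \<ge> 1" and "D > 1"
  shows "\<exists>C::real. \<forall>(\<delta>::real) (W::real) (S :: parallelepiped set) (\<I> :: nat \<Rightarrow> real set set)
      (M :: nat \<Rightarrow> real) (N :: nat \<Rightarrow> real) (r :: nat \<Rightarrow> real).
    0 < \<delta> \<and> \<delta> < 1 \<and> W = \<delta> powr (3 * \<alpha> - 2) \<and>
    finite S \<and>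
    \<I> 1 \<subseteq> intervals \<delta> 0 (1/6) \<and>
    \<I> 2 \<subseteq> intervals \<delta> (1/3) (1/2) \<and>
    \<I> 3 \<subseteq> intervals \<delta> (2/3) 1 \<and>
    (\<forall>i\<in>{1..3}. sim K (real (card (\<I> i))) (M i)) \<and>
    (\<forall>P\<in>S. \<exists>I \<in> \<I> 1 \<union> \<I> 2 \<union> \<I> 3. moment_plate K \<delta> I P) \<and>
    (\<forall>I \<in> \<I> 1 \<union> \<I> 2 \<union> \<I> 3. essentially_distinct D (associated K \<delta> S I)) \<and>
    (\<forall>I \<in> \<I> 1 \<union> \<I> 2 \<union> \<I> 3. periodic_x K (1 / W) (associated K \<delta> S I)) \<and>
    (\<forall>i\<in>{1..3}. \<forall>I \<in> \<I> i. uniform_plates K (1 / W) I (N i) (associated K \<delta> S I)) \<and>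
    (\<forall>i\<in>{1..3}. 1 \<le> r i \<and> r i \<le> M i)
    \<longrightarrow>
    real (card (rich_cubes K \<delta> (\<lambda>i. \<Union>I \<in> \<I> i. associated K \<delta> S I) r))
      \<le> C * \<delta> powr (- \<epsilon>)
          * (geom_mean3 N * geom_mean3 M / ((geom_mean3 r)\<^sup>2 * \<delta>))
              powr ((4 - 6 * \<alpha>) / (3 * \<alpha> - 1))
          * (geom_mean3 N * geom_mean3 M / geom_mean3 r) ^ 3 * W"
proof -
  define p where "p = (4 - 6 * \<alpha>) / (3 * \<alpha> - 1)"
  define C where "C = \<bar>plate_incidences.final_constant (incidence_constant K D) p\<bar>"
  show ?thesis unfolding p_def[symmetric]
  proof (intro exI[of _ C] allI impI, elim conjE)
    fix \<delta> W :: real and S :: "parallelepiped set" and \<I> :: "nat \<Rightarrow> real set set" and M N r :: "nat \<Rightarrow> real"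
    let ?Q = "rich_cubes K \<delta> (\<lambda>i. \<Union>I \<in> \<I> i. associated K \<delta> S I) r"
    assume \<delta>: "0 < \<delta>" "\<delta> < 1" and W: "W = \<delta> powr (3 * \<alpha> - 2)" and S: "finite S"
      and I: "\<I> 1 \<subseteq> intervals \<delta> 0 (1/6)" "\<I> 2 \<subseteq> intervals \<delta> (1/3) (1/2)" "\<I> 3 \<subseteq> intervals \<delta> (2/3) 1"
      and M: "\<forall>i\<in>{1..3}. sim K (real (card (\<I> i))) (M i)"
      and ed: "\<forall>I \<in> \<I> 1 \<union> \<I> 2 \<union> \<I> 3. essentially_distinct D (associated K \<delta> S I)"
      and per: "\<forall>I \<in> \<I> 1 \<union> \<I> 2 \<union> \<I> 3. periodic_x K (1 / W) (associated K \<delta> S I)"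
      and unif: "\<forall>i\<in>{1..3}. \<forall>I \<in> \<I> i. uniform_plates K (1 / W) I (N i) (associated K \<delta> S I)"
      and r: "\<forall>i\<in>{1..3}. 1 \<le> r i \<and> r i \<le> M i"
    define A where "A = (geom_mean3 N * geom_mean3 M / ((geom_mean3 r)\<^sup>2 * \<delta>)) powr p"
    define V where "V = (geom_mean3 N * geom_mean3 M / geom_mean3 r) ^ 3 * W"
    have "0 \<le> geom_mean3 g" for g unfolding geom_mean3_def by simp
    then have V: "0 \<le> V" unfolding V_def W by simp
    have A: "0 \<le> A" unfolding A_def by simp
    have \<epsilon>: "1 \<le> \<delta> powr (- \<epsilon>)" using \<delta> assms(3) powr_mono'[of "- \<epsilon>" 0 \<delta>] by simp
    have set3: "{1..3} = {1, 2, 3::nat}" by auto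
    have "real (card ?Q) \<le> C * (A * V)"
    proof (cases "?Q = {}")
      case True
      then show ?thesis using A V unfolding C_def by simp
    next
      case False
      have "real (card ?Q) \<le> plate_incidences.final_constant (incidence_constant K D) p * A
          * (geom_mean3 N * geom_mean3 M / geom_mean3 r) ^ 3 * W"
        unfolding A_def p_def
        by (rule rich_cubes_bound[OF assms(1,2,4,5) \<delta> W S I _ _ _ _ _ False])
          (use M ed per unif r set3 in auto)
      also have "\<dots> = plate_incidences.final_constant (incidence_constant K D) p * (A * V)"
        unfolding V_def by simp
      also have "\<dots> \<le> C * (A * V)" unfolding C_def using A V by (intro mult_right_mono) auto
      finally show ?thesis .
    qed
    also have "\<dots> \<le> C * \<delta> powr (- \<epsilon>) * (A * V)"
      using \<epsilon> A V unfolding C_def by (intro mult_right_mono) (auto simp: mult_le_cancel_left1)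
    finally show "real (card ?Q) \<le> C * \<delta> powr (- \<epsilon>)
        * (geom_mean3 N * geom_mean3 M / ((geom_mean3 r)\<^sup>2 * \<delta>)) powr p
        * (geom_mean3 N * geom_mean3 M / geom_mean3 r) ^ 3 * W"
      unfolding A_def V_def by (simp add: mult.assoc)
  qed
qed

end
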